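(* The operations $\mathsf{queryLT}$, $\mathsf{insertLT}$ and $\mathsf{removeLT}$ of the linearised tree data structure described in the context solve the dynamic monotonic interval scheduling problem in $O(\log n)$ amortised time per operation, where $n$ is the size of the set $I$ of intervals.
   Context: An interval $i$ is a pair $(s(i),f(i))\in\mathbb{R}^2$ with $s(i)<f(i)$. Intervals $i,j$ are compatible if $f(i)<s(j)$ or $f(j)<s(i)$; otherwise they overlap. Intervals have pairwise distinct finishing times; $\preceq$ is the ordering by finishing time. A set $I$ is monotonic if no interval of $I$ properly contains another. The greedy optimal set of $I$: $i_1$ is the least interval, and $i_{k+1}$ is the least interval with $i_k\prec i_{k+1}$ compatible with $i_k$. $\mathsf{rc}(i)$ is the least $j\in I$ with $i\prec j$ compatible with $i$; $\mathsf{lc}(i)$ is the greatest $j\in I$ with $j\prec i$ compatible with $i$. The dynamic monotonic interval scheduling problem: process an arbitrary sequence of operations $\mathsf{insert}(i)$, $\mathsf{remove}(i)$, $\mathsf{query}(i)$ on a set $I$ that remains monotonic at all times, with $\mathsf{query}(i)$ returning $\mathsf{true}$ iff $i$ is in the greedy optimal set of the current $I$. Intervals $i,j$ are equivalent ($i\sim j$) iff $\mathsf{rc}(i)=\mathsf{rc}(j)$; $[i]$ is the class of $i$. The linearised tree $\mathcal{L}(I)=(I;E_\sim,E_c)$ has edges: $(i,j)\in E_\sim$ iff $i\sim j$ and $i$ is the previous interval of $j$ (in $\preceq$ on $I$); $(i,j)\in E_c$ iff $i$ is the greatest interval of $[i]$ and $j=\mathsf{rc}(i)$. The data structure stores $\mathcal{L}(I)$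 as a Sleator–Tarjan dynamic tree (operations link, cut, expose, with solid paths in splay trees) together with a balanced search tree $T(I)$ ordered by $\preceq$, used to compute next, previous, $\mathsf{rc}$ and $\mathsf{lc}$ in $O(\log n)$ time. $\mathsf{queryLT}(i)$: let $m$ be the least interval; if $i=m$ return $\mathsf{true}$; expose $m$; if $i$ is not on the path from $m$ to the root return $\mathsf{false}$; otherwise let $j$ be the node preceding $i$ on this path (so $(j,i)$ is an edge) and return $\mathsf{true}$ iff $i$ is compatible with $j$. $\mathsf{insertLT}(i)$: insert $i$ into $T(I)$; if $i$ is not the greatest interval, link $i$ to $\mathsf{rc}(i)$ if $\mathsf{lc}(\mathsf{rc}(i))=i$, otherwise link $i$ to $\mathsf{next}(i)$; if $j=\mathsf{previous}(i)$ satisfies $\mathsf{rc}(j)=\mathsf{rc}(i)$, cut $j$ and link $j$ to $i$; if $j=\mathsf{lc}(i)$ satisfies $\mathsf{rc}(j)=i$, cut $j$ and link $j$ to $i$. $\mathsf{removeLT}(i)$: cut $i$ from its parent (if any); if $j=\mathsf{previous}(i)$ satisfies $\mathsf{rc}(j)=\mathsf{rc}(i)$, cut $j$ and link it to $\mathsf{rc}(i)$ if $i=\mathsf{lc}(\mathsf{rc}(i))$, else to $\mathsf{next}(i)$ if $i$ is not the root; if $j=\mathsf{lc}(i)$ satisfies $\mathsf{rc}(j)=i$, cut $j$, delete $i$ from $T(I)$, and (if $j$ was not a root) with $k=\mathsf{next}(j)$ link $j$ to $k$ if $\mathsf{rc}(k)=\mathsf{rc}(j)$, else to $\mathsf{rc}(j)$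 (computed in the updated set); otherwise just delete $i$ from $T(I)$. *)

theory Defs
  imports
    Complex_Main
    "HOL-Library.Multiset"
    "HOL-Library.Tree"
    "HOL-Library.Monad_Syntax"
    "HOL-Library.Landau_Symbols"
begin

section \<open>Monotonic interval scheduling\<close>

type_synonym interval = "real \<times> real"

abbreviation start :: "interval \<Rightarrow> real" where "start \<equiv> fst"
abbreviation fin :: "interval \<Rightarrow> real" where "fin \<equiv> snd"

definition proper :: "interval \<Rightarrow> bool" where
  "proper i \<longleftrightarrow> start i < fin i"

definition compatible :: "interval \<Rightarrow> interval \<Rightarrow> bool" where
  "compatible i j \<longleftrightarrow> fin i < start j \<or> fin j < start i"

definition prec :: "interval \<Rightarrow> interval \<Rightarrow> bool" (infix \<open>\<prec>\<close> 50) where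
  "i \<prec> j \<longleftrightarrow> fin i < fin j"

definition monotonic :: "interval set \<Rightarrow> bool" where
  "monotonic I \<longleftrightarrow> (\<forall>i\<in>I. \<forall>j\<in>I. \<not> {start j..fin j} \<subset> {start i..fin i})"

definition instance_set :: "interval set \<Rightarrow> bool" where
  "instance_set I \<longleftrightarrow> (\<forall>i\<in>I. proper i) \<and> inj_on fin I \<and> monotonic I"

text \<open>
  The least and the greatest element with a given property, with respect to finishing times.
  They are only used for subsets of finite sets with pairwise distinct finishing times.
\<close>

definition least :: "(interval \<Rightarrow> bool) \<Rightarrow> interval option" where
  "least P = (if \<exists>j. P j then Some (arg_min fin P) else None)"

definition greatest :: "(interval \<Rightarrow> bool) \<Rightarrow> interval option" where
  "greatest P = (if \<exists>j. P j then Some (arg_max fin P) else None)"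

definition rc :: "interval set \<Rightarrow> interval \<Rightarrow> interval option" where
  "rc I i = least (\<lambda>j. j \<in> I \<and> i \<prec> j \<and> compatible i j)"

definition previous :: "interval set \<Rightarrow> interval \<Rightarrow> interval option" where
  "previous I i = greatest (\<lambda>j. j \<in> I \<and> j \<prec> i)"

inductive_set greedy :: "interval set \<Rightarrow> interval set" for I where
  first: "least (\<lambda>j. j \<in> I) = Some i \<Longrightarrow> i \<in> greedy I"
| succ: "i \<in> greedy I \<Longrightarrow> least (\<lambda>j. j \<in> I \<and> i \<prec> j \<and> compatible i j) = Some k \<Longrightarrow> k \<in> greedy I"

text \<open>
  The linearised tree.  Intervals without right compatible interval (\<open>rc I i = None\<close>) form one
  equivalence class; the greatest interval is the root.
\<close>

definition equiv_rc :: "interval set \<Rightarrow> interval \<Rightarrow> interval \<Rightarrow> bool" where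
  "equiv_rc I i j \<longleftrightarrow> rc I i = rc I j"

definition E_sim :: "interval set \<Rightarrow> (interval \<times> interval) set" where
  "E_sim I = {(i, j). i \<in> I \<and> j \<in> I \<and> equiv_rc I i j \<and> previous I j = Some i}"

definition E_c :: "interval set \<Rightarrow> (interval \<times> interval) set" where
  "E_c I = {(i, j). i \<in> I \<and> greatest (\<lambda>k. k \<in> I \<and> equiv_rc I k i) = Some i \<and> rc I i = Some j}"


subsection \<open>Operation sequences\<close>

datatype operation = Insert interval | Remove interval | Query interval

fun apply_op :: "operation \<Rightarrow> interval set \<Rightarrow> interval set" where
  "apply_op (Insert i) I = insert i I"
| "apply_op (Remove i) I = I - {i}"
| "apply_op (Query i) I = I"

fun admissible_op :: "operation \<Rightarrow> interval set \<Rightarrow> bool" where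
  "admissible_op (Insert i) I \<longleftrightarrow> i \<notin> I"
| "admissible_op (Remove i) I \<longleftrightarrow> i \<in> I"
| "admissible_op (Query i) I \<longleftrightarrow> proper i"

fun admissible :: "operation list \<Rightarrow> interval set \<Rightarrow> bool" where
  "admissible [] I \<longleftrightarrow> instance_set I"
| "admissible (p # ops) I \<longleftrightarrow> instance_set I \<and> admissible_op p I \<and> admissible ops (apply_op p I)"

fun correct_answers :: "operation list \<Rightarrow> interval set \<Rightarrow> bool list" where
  "correct_answers [] I = []"
| "correct_answers (Query i # ops) I = (i \<in> greedy I) # correct_answers ops I"
| "correct_answers (p # ops) I = correct_answers ops (apply_op p I)"

text \<open>The sizes of the current set at the moments when the operations are invoked.\<close>

fun sizes :: "operation list \<Rightarrow> interval set \<Rightarrow> nat list" where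
  "sizes [] I = []"
| "sizes (p # ops) I = card I # sizes ops (apply_op p I)"


section \<open>Computations with a step counter\<close>

datatype 'a tm = TM (result: 'a) (steps: nat)

definition bind_tm :: "'a tm \<Rightarrow> ('a \<Rightarrow> 'b tm) \<Rightarrow> 'b tm" where
  "bind_tm m f = TM (result (f (result m))) (steps m + steps (f (result m)))"

adhoc_overloading Monad_Syntax.bind \<rightleftharpoons> bind_tm

definition return :: "'a \<Rightarrow> 'a tm" where
  "return x = TM x 0"

definition tick :: "'a tm \<Rightarrow> 'a tm" where
  "tick m = TM (result m) (Suc (steps m))"

lemma bind_tm_cong [fundef_cong]:
  "m = n \<Longrightarrow> (\<And>x. x = result n \<Longrightarrow> f x = g x) \<Longrightarrow> bind_tm m f = bind_tm n g"
  by (simp add: bind_tm_def)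

text \<open>
  Every recursive call of every function below that traverses or restructures a tree is charged
  one step; the work done per call is a bounded number of comparisons and pointer assignments.
\<close>


section \<open>The balanced search tree: an AVL tree ordered by finishing time\<close>

text \<open>Each node carries the height of its subtree.\<close>

type_synonym search_tree = "(interval \<times> nat) tree"

fun ht :: "search_tree \<Rightarrow> nat" where
  "ht Leaf = 0"
| "ht (Node l (a, n) r) = n"

definition node :: "search_tree \<Rightarrow> interval \<Rightarrow> search_tree \<Rightarrow> search_tree" where
  "node l a r = Node l (a, max (ht l) (ht r) + 1) r"

definition balL :: "search_tree \<Rightarrow> interval \<Rightarrow> search_tree \<Rightarrow> search_tree" where
  "balL t c r =
    (if ht t = ht r + 2 then
       case t of Node l (a, _) m \<Rightarrow>
         if ht m \<le> ht l then node l a (node m c r)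
         else case m of Node m1 (b, _) m2 \<Rightarrow> node (node l a m1) b (node m2 c r)
     else node t c r)"

definition balR :: "search_tree \<Rightarrow> interval \<Rightarrow> search_tree \<Rightarrow> search_tree" where
  "balR l a t =
    (if ht t = ht l + 2 then
       case t of Node m (c, _) r \<Rightarrow>
         if ht m \<le> ht r then node (node l a m) c r
         else case m of Node m1 (b, _) m2 \<Rightarrow> node (node l a m1) b (node m2 c r)
     else node l a t)"

fun insert_T :: "interval \<Rightarrow> search_tree \<Rightarrow> search_tree tm" where
  "insert_T x Leaf = tick (return (Node Leaf (x, 1) Leaf))"
| "insert_T x (Node l (a, n) r) = tick (
    if x \<prec> a then do { l' \<leftarrow> insert_T x l; return (balL l' a r) }
    else if a \<prec> x then do { r' \<leftarrow> insert_T x r; return (balR l a r') }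
    else return (Node l (a, n) r))"

fun split_max :: "search_tree \<Rightarrow> interval \<Rightarrow> search_tree \<Rightarrow> (search_tree \<times> interval) tm" where
  "split_max l a Leaf = tick (return (l, a))"
| "split_max l a (Node rl (b, _) rr) = tick (do {
    (r', m) \<leftarrow> split_max rl b rr;
    return (balL l a r', m) })"

fun delete_T :: "interval \<Rightarrow> search_tree \<Rightarrow> search_tree tm" where
  "delete_T x Leaf = tick (return Leaf)"
| "delete_T x (Node l (a, n) r) = tick (
    if x \<prec> a then do { l' \<leftarrow> delete_T x l; return (balR l' a r) }
    else if a \<prec> x then do { r' \<leftarrow> delete_T x r; return (balL l a r') }
    else (case l of
      Leaf \<Rightarrow> return r
    | Node ll (b, _) lr \<Rightarrow> do {
        (l', m) \<leftarrow> split_max ll b lr;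
        return (balR l' m r) }))"

fun member_T :: "interval \<Rightarrow> search_tree \<Rightarrow> bool tm" where
  "member_T x Leaf = tick (return False)"
| "member_T x (Node l (a, _) r) = tick (
    if x \<prec> a then member_T x l
    else if a \<prec> x then member_T x r
    else return (x = a))"

text \<open>
  Search for the least element satisfying a property that is inherited by greater elements, and
  for the greatest element satisfying a property that is inherited by smaller elements; \<open>b\<close> is
  the best candidate found so far.
\<close>

fun search_least :: "(interval \<Rightarrow> bool) \<Rightarrow> search_tree \<Rightarrow> interval option \<Rightarrow> interval option tm" where
  "search_least P Leaf b = tick (return b)"
| "search_least P (Node l (a, _) r) b =
    tick (if P a then search_least P l (Some a) else search_least P r b)"

fun search_greatest :: "(interval \<Rightarrow> bool) \<Rightarrow> search_tree \<Rightarrow> interval option \<Rightarrow> interval option tm" where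
  "search_greatest P Leaf b = tick (return b)"
| "search_greatest P (Node l (a, _) r) b =
    tick (if P a then search_greatest P r (Some a) else search_greatest P l b)"

definition min_T :: "search_tree \<Rightarrow> interval option tm" where
  "min_T T = search_least (\<lambda>_. True) T None"

definition next_T :: "interval \<Rightarrow> search_tree \<Rightarrow> interval option tm" where
  "next_T i T = search_least (\<lambda>j. i \<prec> j) T None"

definition previous_T :: "interval \<Rightarrow> search_tree \<Rightarrow> interval option tm" where
  "previous_T i T = search_greatest (\<lambda>j. j \<prec> i) T None"

text \<open>
  In a monotonic set start and finishing times are ordered in the same way, hence the following
  two search properties are inherited as required.
\<close>

definition rc_T :: "interval \<Rightarrow> search_tree \<Rightarrow> interval option tm" where
  "rc_T i T = search_least (\<lambda>j. i \<prec> j \<and> compatible i j) T None"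

definition lc_T :: "interval \<Rightarrow> search_tree \<Rightarrow> interval option tm" where
  "lc_T i T = search_greatest (\<lambda>j. j \<prec> i \<and> compatible i j) T None"


section \<open>Dynamic trees with solid paths in splay trees\<close>

text \<open>
  A real tree is represented by a virtual tree in the sense of Sleator and Tarjan: a node has a
  left and a right child and a collection of middle children.  The nodes reachable through left and
  right children form a solid subtree, a splay tree whose symmetric order lists a solid path from
  its bottom-most node to its top-most node.  A middle child of \<open>w\<close> is the root of the solid
  subtree of another solid path, whose top-most node has the real parent \<open>w\<close> (a dashed edge).
\<close>

datatype 'a vtree = VLeaf | VNode "'a vtree" 'a "'a vtree multiset" "'a vtree"

type_synonym 'a forest = "'a vtree multiset"

fun solid_path :: "'a vtree \<Rightarrow> 'a list" where
  "solid_path VLeaf = []"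
| "solid_path (VNode l v ms r) = solid_path l @ v # solid_path r"

primrec vertices :: "'a vtree \<Rightarrow> 'a multiset" where
  "vertices VLeaf = {#}"
| "vertices (VNode l v ms r) =
    add_mset v (vertices l + vertices r + \<Sum>\<^sub># (image_mset vertices ms))"

primrec edges :: "'a vtree \<Rightarrow> ('a \<times> 'a) set" where
  "edges VLeaf = {}"
| "edges (VNode l v ms r) =
    edges l \<union> edges r \<union> \<Union> (set_mset (image_mset edges ms))
    \<union> (if l = VLeaf then {} else {(last (solid_path l), v)})
    \<union> (if r = VLeaf then {} else {(v, hd (solid_path r))})
    \<union> {(last (solid_path t), v) | t. t \<in># ms}"

definition forest_vertices :: "'a forest \<Rightarrow> 'a multiset" where
  "forest_vertices F = \<Sum>\<^sub># (image_mset vertices F)"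

definition forest_edges :: "'a forest \<Rightarrow> ('a \<times> 'a) set" where
  "forest_edges F = (\<Union>t\<in>set_mset F. edges t)"

text \<open>
  Parent pointers are modelled by a zipper: the frames of a node are its proper ancestors in the
  virtual tree from the bottom up, each with its remaining subtrees, and the constructor tells
  whether one arrives from the left, from the right or from a middle child.
\<close>

datatype 'a frame =
    FromLeft 'a "'a vtree multiset" "'a vtree"
  | FromRight "'a vtree" 'a "'a vtree multiset"
  | FromMiddle "'a vtree" 'a "'a vtree multiset" "'a vtree"

fun plug :: "'a vtree \<Rightarrow> 'a frame list \<Rightarrow> 'a vtree" where
  "plug t [] = t"
| "plug t (FromLeft p ms r # fs) = plug (VNode t p ms r) fs"
| "plug t (FromRight l p ms # fs) = plug (VNode l p ms t) fs"
| "plug t (FromMiddle l p ms r # fs) = plug (VNode l p (add_mset t ms) r) fs"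

text \<open>
  Dereferencing the node \<open>v\<close>: its left subtree, middle children, right subtree and ancestors, and
  the other virtual trees of the forest.  As a node is given by its address, this costs nothing,
  but walking along the ancestors does.  When every vertex occurs once, the decomposition is unique.
\<close>

definition locate ::
  "'a \<Rightarrow> 'a forest \<Rightarrow> 'a vtree \<times> 'a vtree multiset \<times> 'a vtree \<times> 'a frame list \<times> 'a forest" where
  "locate v F = (SOME (l, ms, r, fs, G). F = add_mset (plug (VNode l v ms r) fs) G)"

definition add_vtree :: "'a vtree \<Rightarrow> 'a vtree multiset \<Rightarrow> 'a vtree multiset" where
  "add_vtree t F = (if t = VLeaf then F else add_mset t F)"

text \<open>
  Bottom-up splaying of a node, given by its left and right subtrees and its ancestors, to the root
  of its solid subtree.  The middle children travel with their parents.
\<close>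

fun splay ::
  "'a vtree \<Rightarrow> 'a vtree \<Rightarrow> 'a frame list \<Rightarrow> ('a vtree \<times> 'a vtree \<times> 'a frame list) tm" where
  "splay l r (FromLeft p ms a # FromLeft g gs b # fs) =
    tick (splay l (VNode r p ms (VNode a g gs b)) fs)"
| "splay l r (FromRight a p ms # FromRight b g gs # fs) =
    tick (splay (VNode (VNode b g gs a) p ms l) r fs)"
| "splay l r (FromLeft p ms a # FromRight b g gs # fs) =
    tick (splay (VNode b g gs l) (VNode r p ms a) fs)"
| "splay l r (FromRight a p ms # FromLeft g gs b # fs) =
    tick (splay (VNode a p ms l) (VNode r g gs b) fs)"
| "splay l r (FromLeft p ms a # fs) = tick (return (l, VNode r p ms a, fs))"
| "splay l r (FromRight a p ms # fs) = tick (return (VNode a p ms l, r, fs))"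
| "splay l r fs = tick (return (l, r, fs))"

lemma length_splay:
  "result (splay l r fs) = (l', r', fs') \<Longrightarrow> length fs' \<le> length fs"
  by (induction l r fs rule: splay.induct) (auto simp: tick_def return_def)

text \<open>
  Splicing along the way to the root: each ancestor \<open>w\<close> that is reached through a dashed edge is
  splayed to the root of its solid subtree, then its left subtree becomes a middle child and is
  replaced by the subtree one comes from.
\<close>

function splice :: "'a frame list \<Rightarrow> 'a frame list tm" where
  "splice (FromMiddle l w ms r # fs) = tick (do {
    (l', r', fs') \<leftarrow> splay l r fs;
    fs'' \<leftarrow> splice fs';
    return (FromLeft w (add_vtree l' ms) r' # fs'') })"
| "splice [] = tick (return [])"
| "splice (FromLeft p ms a # fs) = tick (return (FromLeft p ms a # fs))"
| "splice (FromRight a p ms # fs) = tick (return (FromRight a p ms # fs))"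
  by pat_completeness auto
termination
proof (relation "measure length", goal_cases)
  case 1
  show ?case by simp
next
  case (2 l w ms r fs x l' y r' fs')
  then have "result (splay l r fs) = (l', r', fs')" by simp
  then show ?case by (auto dest: length_splay)
qed

text \<open>
  The path from \<open>v\<close> to the root becomes solid and all other edges incident to it become dashed;
  \<open>v\<close> becomes the root of the virtual tree.  Splaying within solid subtrees, splicing and the
  final splay are the three passes of Sleator and Tarjan.
\<close>

definition expose :: "'a \<Rightarrow> 'a forest \<Rightarrow> 'a forest tm" where
  "expose v F = (case locate v F of (l0, ms, r0, fs0, G) \<Rightarrow> tick (do {
    (l1, r1, fs1) \<leftarrow> splay l0 r0 fs0;
    fs2 \<leftarrow> splice fs1;
    (l3, r3, fs3) \<leftarrow> splay l1 r1 fs2;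
    return (add_mset (plug (VNode VLeaf v (add_vtree l3 ms) r3) fs3) G) }))"

text \<open>\<open>link v w\<close> makes the root \<open>v\<close> of a real tree a child of the node \<open>w\<close> of another real tree.\<close>

definition link :: "'a \<Rightarrow> 'a \<Rightarrow> 'a forest \<Rightarrow> 'a forest tm" where
  "link v w F = tick (do {
    F \<leftarrow> expose v F;
    F \<leftarrow> expose w F;
    case locate v F of (l, ms, r, _, G) \<Rightarrow>
    case locate w G of (l', ms', r', _, H) \<Rightarrow>
      return (add_mset (VNode l' w (add_mset (VNode l v ms r) ms') r') H) })"

text \<open>\<open>cut v\<close> removes the edge from \<open>v\<close> to its real parent, if there is one.\<close>

definition cut :: "'a \<Rightarrow> 'a forest \<Rightarrow> 'a forest tm" where
  "cut v F = tick (do {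
    F \<leftarrow> expose v F;
    case locate v F of (l, ms, r, _, G) \<Rightarrow>
      return (add_mset (VNode l v ms VLeaf) (add_vtree r G)) })"

definition new_node :: "'a \<Rightarrow> 'a forest \<Rightarrow> 'a forest tm" where
  "new_node v F = tick (return (add_mset (VNode VLeaf v {#} VLeaf) F))"

definition free_node :: "'a \<Rightarrow> 'a forest \<Rightarrow> 'a forest tm" where
  "free_node v F = tick (return (F - {# VNode VLeaf v {#} VLeaf #}))"

text \<open>
  Does \<open>v\<close> lie on the solid path that contains the root of its real tree?  The node is splayed; the
  answer is positive iff it has become the root of the virtual tree.
\<close>

definition on_root_path :: "'a \<Rightarrow> 'a forest \<Rightarrow> (bool \<times> 'a forest) tm" where
  "on_root_path v F = (case locate v F of (l, ms, r, fs, G) \<Rightarrow> tick (do {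
    (l', r', fs') \<leftarrow> splay l r fs;
    return (fs' = [], add_mset (plug (VNode l' v ms r') fs') G) }))"

text \<open>Walking from a node to the last node, in symmetric order, of its solid subtree.\<close>

fun last_node ::
  "'a vtree \<Rightarrow> 'a \<Rightarrow> 'a vtree multiset \<Rightarrow> 'a vtree \<Rightarrow> 'a frame list
    \<Rightarrow> ('a vtree \<times> 'a \<times> 'a vtree multiset \<times> 'a frame list) tm" where
  "last_node l v ms VLeaf fs = tick (return (l, v, ms, fs))"
| "last_node l v ms (VNode l' v' ms' r') fs =
    tick (last_node l' v' ms' r' (FromRight l v ms # fs))"

text \<open>The node preceding \<open>v\<close> on its solid path, which is splayed after it has been found.\<close>

definition before :: "'a \<Rightarrow> 'a forest \<Rightarrow> ('a option \<times> 'a forest) tm" where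
  "before v F = (case locate v F of (l, ms, r, fs, G) \<Rightarrow> tick (do {
    (l', r', fs') \<leftarrow> splay l r fs;
    case l' of
      VLeaf \<Rightarrow> return (None, add_mset (plug (VNode l' v ms r') fs') G)
    | VNode a u us b \<Rightarrow> do {
        (c, w, ws, gs) \<leftarrow> last_node a u us b (FromLeft v ms r' # fs');
        (c', d', gs') \<leftarrow> splay c VLeaf gs;
        return (Some w, add_mset (plug (VNode c' w ws d') gs') G) } }))"


section \<open>The linearised tree data structure\<close>

type_synonym linearised_tree = "search_tree \<times> interval forest"

definition empty_LT :: linearised_tree where
  "empty_LT = (Leaf, {#})"

definition stores_LT :: "interval set \<Rightarrow> linearised_tree \<Rightarrow> bool" where
  "stores_LT I = (\<lambda>(T, F).
    set (map fst (inorder T)) = I \<and> sorted_wrt (\<prec>) (map fst (inorder T)) \<and>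
    forest_vertices F = mset_set I \<and> forest_edges F = E_sim I \<union> E_c I)"

text \<open>
  After \<open>expose m\<close> the path from \<open>m\<close> to the root is the solid path containing the root.
  An interval that is not in the set has no node and is not on this path.
\<close>

definition queryLT :: "interval \<Rightarrow> linearised_tree \<Rightarrow> (bool \<times> linearised_tree) tm" where
  "queryLT i = (\<lambda>(T, F). tick (do {
    mo \<leftarrow> min_T T;
    case mo of
      None \<Rightarrow> return (False, (T, F))
    | Some m \<Rightarrow>
        if i = m then return (True, (T, F))
        else do {
          F \<leftarrow> expose m F;
          isin \<leftarrow> member_T i T;
          if \<not> isin then return (False, (T, F))
          else do {
            (on_path, F) \<leftarrow> on_root_path i F;
            if \<not> on_path then return (False, (T, F))
            else do {
              (jo, F) \<leftarrow> before i F;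
              return (case jo of None \<Rightarrow> False | Some j \<Rightarrow> compatible i j, (T, F)) } } } }))"

definition insertLT :: "interval \<Rightarrow> linearised_tree \<Rightarrow> linearised_tree tm" where
  "insertLT i = (\<lambda>(T, F). tick (do {
    T \<leftarrow> insert_T i T;
    F \<leftarrow> new_node i F;
    n \<leftarrow> next_T i T;
    r \<leftarrow> rc_T i T;
    F \<leftarrow> (case n of
        None \<Rightarrow> return F
      | Some k \<Rightarrow> (case r of
          None \<Rightarrow> link i k F
        | Some r' \<Rightarrow> do {
            h \<leftarrow> lc_T r' T;
            if h = Some i then link i r' F else link i k F }));
    p \<leftarrow> previous_T i T;
    F \<leftarrow> (case p of
        None \<Rightarrow> return F
      | Some j \<Rightarrow> do {
          rj \<leftarrow> rc_T j T;
          if rj = r then do { F \<leftarrow> cut j F; link j i F } else return F });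
    q \<leftarrow> lc_T i T;
    F \<leftarrow> (case q of
        None \<Rightarrow> return F
      | Some j \<Rightarrow> do {
          rj \<leftarrow> rc_T j T;
          if rj = Some i then do { F \<leftarrow> cut j F; link j i F } else return F });
    return (T, F) }))"

definition removeLT :: "interval \<Rightarrow> linearised_tree \<Rightarrow> linearised_tree tm" where
  "removeLT i = (\<lambda>(T, F). tick (do {
    F \<leftarrow> cut i F;
    n \<leftarrow> next_T i T;
    r \<leftarrow> rc_T i T;
    p \<leftarrow> previous_T i T;
    F \<leftarrow> (case p of
        None \<Rightarrow> return F
      | Some j \<Rightarrow> do {
          rj \<leftarrow> rc_T j T;
          if rj = r then do {
            F \<leftarrow> cut j F;
            h \<leftarrow> (case r of None \<Rightarrow> return None | Some r' \<Rightarrow> lc_T r' T);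
            case n of
              None \<Rightarrow> return F
            | Some k \<Rightarrow> if h = Some i then link j (the r) F else link j k F }
          else return F });
    q \<leftarrow> lc_T i T;
    rq \<leftarrow> (case q of None \<Rightarrow> return None | Some j \<Rightarrow> rc_T j T);
    (T, F) \<leftarrow> (if rq = Some i then do {
        let j = the q;
        F \<leftarrow> cut j F;
        T \<leftarrow> delete_T i T;
        ko \<leftarrow> next_T j T;
        case ko of
          None \<Rightarrow> return (T, F)
        | Some k \<Rightarrow> do {
            rk \<leftarrow> rc_T k T;
            rj \<leftarrow> rc_T j T;
            F \<leftarrow> (if rk = rj then link j k F else link j (the rj) F);
            return (T, F) } }
      else do {
        T \<leftarrow> delete_T i T;
        return (T, F) });
    F \<leftarrow> free_node i F;
    return (T, F) }))"

fun run_LT :: "operation list \<Rightarrow> linearised_tree \<Rightarrow> (bool list \<times> linearised_tree) tm" where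
  "run_LT [] D = return ([], D)"
| "run_LT (Insert i # ops) D = do { D \<leftarrow> insertLT i D; run_LT ops D }"
| "run_LT (Remove i # ops) D = do { D \<leftarrow> removeLT i D; run_LT ops D }"
| "run_LT (Query i # ops) D = do {
    (b, D) \<leftarrow> queryLT i D;
    (bs, D) \<leftarrow> run_LT ops D;
    return (b # bs, D) }"

end

theory Submission
  imports Defs "HOL-Real_Asymp.Real_Asymp"
begin

text \<open>
  The edges of the linearised tree form the graph of a parent function: the parent of \<open>x\<close> is the
  next interval if that is equivalent to \<open>x\<close>, and \<open>rc x\<close> otherwise.  Inserting or removing \<open>i\<close>
  changes only the parents of \<open>i\<close>, of the interval preceding \<open>i\<close> (if it is equivalent to \<open>i\<close>) and of
  \<open>lc i\<close> (if \<open>i\<close> is its right compatible interval), which are the edges that the operations relink.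
  Following parents from the least interval, one meets every greedy interval, and a node other than
  the start is greedy iff it is compatible with its predecessor on this path: equivalent
  consecutive intervals overlap.

  Link-cut operations are analysed with three times the potential that sums the binary logarithms
  of the sizes of all virtual subtrees.  The first pass and the splicing of an exposure telescope;
  the splices themselves are paid by the last splay, whose path has one node for each of them.
\<close>


section \<open>Search trees\<close>

text \<open>Between the first and the last step of an insertion or removal the forest need not be
  the linearised tree of any set: edges are missing, and in a removal the search tree may already
  have lost a node that the forest still has. Link and cut are therefore specified for any forest
  whose edges are the graph of a partial map that increases finishing times. This monotonicity rules
  out the cycles that \<open>link\<close> must not create; the map is identified with the parent
  function only at the two ends.

  The factor three comes from the splices. Each of them leaves two steps without payment, and one
  step of the last splay passes at most two of the nodes that they leave behind. Such a step has to
  pay for itself and for four others, while a double rotation frees only two units of the plain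
  potential; three times the potential frees six.

  Costs are counted in multiples of one bound \<open>unit_cost n\<close> that covers every search in
  the balanced tree and every dynamic tree operation; 30 of them are a rounded budget for an
  operation.\<close>

abbreviation keys :: "search_tree \<Rightarrow> interval list" where
  "keys T \<equiv> map fst (inorder T)"

fun avl :: "search_tree \<Rightarrow> bool" where
  "avl Leaf \<longleftrightarrow> True"
| "avl (Node l (a, n) r) \<longleftrightarrow> avl l \<and> avl r \<and> height l \<le> height r + 1 \<and> height r \<le> height l + 1 \<and>
     n = max (height l) (height r) + 1"

lemma ht_avl [simp]: "avl T \<Longrightarrow> ht T = height T"
  by (cases T rule: ht.cases) auto

lemma keys_node [simp]: "keys (node l a r) = keys l @ a # keys r"
  by (simp add: node_def)

lemma height_node [simp]: "height (node l a r) = max (height l) (height r) + 1"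
  by (simp add: node_def)

lemma avl_node [simp]:
  "avl (node l a r) \<longleftrightarrow> avl l \<and> avl r \<and> height l \<le> height r + 1 \<and> height r \<le> height l + 1"
  by (auto simp: node_def)

text \<open>The three shapes of rebalancing: none, a single rotation, a double one. When the inner
  grandchild is higher than the outer one it has positive height, so it is a node that can be lifted
  to the top.\<close>

lemma balL_cases:
  assumes "avl l" "avl r" "height r \<le> height l + 1"
  obtains "height l \<noteq> height r + 2" "balL l a r = node l a r"
  | ll b n m where "l = Node ll (b, n) m" "height l = height r + 2" "height m \<le> height ll"
      "balL l a r = node ll b (node m a r)"
  | ll b n m1 c k m2 where "l = Node ll (b, n) (Node m1 (c, k) m2)" "height l = height r + 2"
      "height (Node m1 (c, k) m2) > height ll"
      "balL l a r = node (node ll b m1) c (node m2 a r)"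
proof (cases "height l = height r + 2")
  case True
  then obtain ll b n m where l: "l = Node ll (b, n) m" by (cases l) auto
  show thesis
  proof (cases "height m \<le> height ll")
    case True
    then show thesis using that(2)[OF l] l assms \<open>height l = height r + 2\<close> by (simp add: balL_def)
  next
    case False
    then obtain m1 c k m2 where "m = Node m1 (c, k) m2" by (cases m) auto
    then show thesis using that(3)[of ll b n m1 c k m2] l assms \<open>height l = height r + 2\<close> False
      by (simp add: balL_def)
  qed
qed (use assms that(1) in \<open>simp add: balL_def\<close>)

lemma balR_cases:
  assumes "avl l" "avl r" "height l \<le> height r + 1"
  obtains "height r \<noteq> height l + 2" "balR l a r = node l a r"
  | rr b n m where "r = Node m (b, n) rr" "height r = height l + 2" "height m \<le> height rr"
      "balR l a r = node (node l a m) b rr"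
  | rr b n m1 c k m2 where "r = Node (Node m1 (c, k) m2) (b, n) rr" "height r = height l + 2"
      "height (Node m1 (c, k) m2) > height rr"
      "balR l a r = node (node l a m1) c (node m2 b rr)"
proof (cases "height r = height l + 2")
  case True
  then obtain rr b n m where l: "r = Node m (b, n) rr" by (cases r) auto
  show thesis
  proof (cases "height m \<le> height rr")
    case True
    then show thesis using that(2)[OF l] l assms \<open>height r = height l + 2\<close> by (simp add: balR_def)
  next
    case False
    then obtain m1 c k m2 where "m = Node m1 (c, k) m2" by (cases m) auto
    then show thesis using that(3)[of m1 c k m2 b n rr] l assms \<open>height r = height l + 2\<close> False
      by (simp add: balR_def)
  qed
qed (use assms that(1) in \<open>simp add: balR_def\<close>)

text \<open>A left subtree that is two levels too high is the worst that one insertion on the left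
  or one deletion on the right produces. After a rotation only bounds on the height survive; the
  exact value is available when no rotation takes place, and the callers split on this case.\<close>

lemma balL:
  assumes "avl l" "avl r" "height l \<le> height r + 2" "height r \<le> height l + 1"
  shows keys_balL: "keys (balL l a r) = keys l @ a # keys r"
    and avl_balL: "avl (balL l a r)"
    and height_balL: "height (balL l a r) \<le> max (height l) (height r) + 1"
      "max (height l) (height r) \<le> height (balL l a r)"
      "height l \<noteq> height r + 2 \<Longrightarrow> height (balL l a r) = max (height l) (height r) + 1"
proof -
  have "keys (balL l a r) = keys l @ a # keys r \<and> avl (balL l a r) \<and>
    height (balL l a r) \<le> max (height l) (height r) + 1 \<and>
    max (height l) (height r) \<le> height (balL l a r) \<and>
    (height l \<noteq> height r + 2 \<longrightarrow> height (balL l a r) = max (height l) (height r) + 1)"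
    using assms(1,2,4)
  proof (cases rule: balL_cases[where a = a])
    case 1
    then show ?thesis using assms by auto
  next
    case (2 ll b n m)
    then show ?thesis using assms(1-3) by auto
  next
    case (3 ll b n m1 c k m2)
    then show ?thesis using assms(1-3) by auto
  qed
  then show "keys (balL l a r) = keys l @ a # keys r" "avl (balL l a r)"
    "height (balL l a r) \<le> max (height l) (height r) + 1"
    "max (height l) (height r) \<le> height (balL l a r)"
    "height l \<noteq> height r + 2 \<Longrightarrow> height (balL l a r) = max (height l) (height r) + 1"
    by auto
qed

lemma balR:
  assumes "avl l" "avl r" "height r \<le> height l + 2" "height l \<le> height r + 1"
  shows keys_balR: "keys (balR l a r) = keys l @ a # keys r"
    and avl_balR: "avl (balR l a r)"
    and height_balR: "height (balR l a r) \<le> max (height l) (height r) + 1"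
      "max (height l) (height r) \<le> height (balR l a r)"
      "height r \<noteq> height l + 2 \<Longrightarrow> height (balR l a r) = max (height l) (height r) + 1"
proof -
  have "keys (balR l a r) = keys l @ a # keys r \<and> avl (balR l a r) \<and>
    height (balR l a r) \<le> max (height l) (height r) + 1 \<and>
    max (height l) (height r) \<le> height (balR l a r) \<and>
    (height r \<noteq> height l + 2 \<longrightarrow> height (balR l a r) = max (height l) (height r) + 1)"
    using assms(1,2,4)
  proof (cases rule: balR_cases[where a = a])
    case 1
    then show ?thesis using assms by auto
  next
    case (2 rr b n m)
    then show ?thesis using assms(1-3) by auto
  next
    case (3 rr b n m1 c k m2)
    then show ?thesis using assms(1-3) by auto
  qed
  then show "keys (balR l a r) = keys l @ a # keys r" "avl (balR l a r)"
    "height (balR l a r) \<le> max (height l) (height r) + 1"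
    "max (height l) (height r) \<le> height (balR l a r)"
    "height r \<noteq> height l + 2 \<Longrightarrow> height (balR l a r) = max (height l) (height r) + 1"
    by auto
qed

lemmas tm_simps = bind_tm_def return_def tick_def

lemma avl_insert_T:
  assumes "avl T"
  shows "avl (result (insert_T x T)) \<and> height T \<le> height (result (insert_T x T)) \<and>
    height (result (insert_T x T)) \<le> height T + 1"
  using assms
proof (induction x T rule: insert_T.induct)
  case (2 x l a n r)
  consider "x \<prec> a" | "\<not> x \<prec> a" "a \<prec> x" | "\<not> x \<prec> a" "\<not> a \<prec> x" by blast
  then show ?case
  proof cases
    case 1
    let ?l = "result (insert_T x l)"
    have "avl ?l" "height l \<le> height ?l" "height ?l \<le> height l + 1" "avl r"
      "height l \<le> height r + 1" "height r \<le> height l + 1"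
      using 2 1 by (auto simp: tm_simps)
    then show ?thesis
      using 1 avl_balL[of ?l r a] height_balL[of ?l r a]
      by (cases "height ?l = height r + 2") (auto simp: tm_simps max_def)
  next
    case 2
    let ?r = "result (insert_T x r)"
    have "avl ?r" "height r \<le> height ?r" "height ?r \<le> height r + 1" "avl l"
      "height l \<le> height r + 1" "height r \<le> height l + 1"
      using "2.IH"(2) "2.prems" 2 by (auto simp: tm_simps)
    then show ?thesis
      using 2 avl_balR[of l ?r a] height_balR[of l ?r a]
      by (cases "height ?r = height l + 2") (auto simp: tm_simps max_def)
  qed (use 2 in \<open>auto simp: tm_simps\<close>)
qed (auto simp: tm_simps)

lemma sorted_wrt_prec_middle:
  "sorted_wrt (\<prec>) (xs @ a # ys) \<longleftrightarrow> sorted_wrt (\<prec>) xs \<and> sorted_wrt (\<prec>) ys \<and>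
     (\<forall>x\<in>set xs. x \<prec> a) \<and> (\<forall>y\<in>set ys. a \<prec> y)"
  by (fastforce simp: sorted_wrt_append prec_def)

text \<open>Distinct finishing times are essential: another key with the finishing time of
  \<open>x\<close> would send \<open>insert_T\<close> into its last branch, where \<open>x\<close>
  is dropped.\<close>

lemma insert_T_keys:
  assumes "avl T" "sorted_wrt (\<prec>) (keys T)" "x \<notin> set (keys T)" "inj_on fin (insert x (set (keys T)))"
  shows "sorted_wrt (\<prec>) (keys (result (insert_T x T))) \<and>
    set (keys (result (insert_T x T))) = insert x (set (keys T))"
  using assms
proof (induction x T rule: insert_T.induct)
  case (2 x l a n r)
  have s: "sorted_wrt (\<prec>) (keys l)" "sorted_wrt (\<prec>) (keys r)" "\<forall>y\<in>set (keys l). y \<prec> a"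
    "\<forall>y\<in>set (keys r). a \<prec> y"
    using "2.prems"(2) by (auto simp: sorted_wrt_prec_middle)
  have lr: "avl l" "avl r"
    using "2.prems"(1) by auto
  have inj: "inj_on fin (insert x (set (keys l)))" "inj_on fin (insert x (set (keys r)))"
    by (rule inj_on_subset[OF "2.prems"(4)]; auto)+
  have "fin x \<noteq> fin a"
    using "2.prems"(3) inj_onD[OF "2.prems"(4), of x a] by auto
  then consider "x \<prec> a" | "\<not> x \<prec> a" "a \<prec> x" by (auto simp: prec_def)
  then show ?case
  proof cases
    case 1
    let ?l = "result (insert_T x l)"
    have IH: "sorted_wrt (\<prec>) (keys ?l)" "set (keys ?l) = insert x (set (keys l))"
      using "2.IH"(1)[OF 1 lr(1) s(1) _ inj(1)] "2.prems"(3) by simp_all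
    have bal: "avl ?l" "height ?l \<le> height r + 2" "height r \<le> height ?l + 1"
      using avl_insert_T[of l x] "2.prems"(1) by auto
    have key: "keys (result (insert_T x (Node l (a, n) r))) = keys ?l @ a # keys r"
      using keys_balL[OF bal(1) lr(2) bal(2,3)] 1 by (simp add: tm_simps)
    show ?thesis
      unfolding key sorted_wrt_prec_middle using IH s 1 by (simp add: insert_commute)
  next
    case 2
    let ?r = "result (insert_T x r)"
    have IH: "sorted_wrt (\<prec>) (keys ?r)" "set (keys ?r) = insert x (set (keys r))"
      using "2.IH"(2)[OF 2 lr(2) s(2) _ inj(2)] "2.prems"(3) by simp_all
    have bal: "avl ?r" "height ?r \<le> height l + 2" "height l \<le> height ?r + 1"
      using avl_insert_T[of r x] "2.prems"(1) by auto
    have key: "keys (result (insert_T x (Node l (a, n) r))) = keys l @ a # keys ?r"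
      using keys_balR[OF lr(1) bal] 2 by (simp add: tm_simps)
    show ?thesis
      unfolding key sorted_wrt_prec_middle using IH s 2 by (simp add: insert_commute)
  qed
qed (auto simp: tm_simps)

lemma steps_insert_T: "steps (insert_T x T) \<le> height T + 1"
  by (induction x T rule: insert_T.induct) (auto simp: tm_simps)

lemma split_max:
  assumes "avl (Node l (a, n) r)" "result (split_max l a r) = (l', m)"
  shows "avl l' \<and> height l' \<le> height (Node l (a, n) r) \<and> height (Node l (a, n) r) \<le> height l' + 1 \<and>
    keys l @ a # keys r = keys l' @ [m]"
  using assms
proof (induction l a r arbitrary: n l' m rule: split_max.induct)
  case (1 l a)
  then show ?case by (auto simp: tm_simps)
next
  case (2 l a rl b k rr)
  let ?r = "Node rl (b, k) rr"
  obtain r' m' where r': "result (split_max rl b rr) = (r', m')" by (meson surj_pair)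
  have IH: "avl r'" "height r' \<le> height ?r" "height ?r \<le> height r' + 1"
     "keys rl @ b # keys rr = keys r' @ [m']"
    using "2.IH"[OF _ r', of k] "2.prems"(1) by auto
  have l': "l' = balL l a r'" "m' = m"
    using "2.prems"(2) r' by (auto simp: tm_simps)
  have "avl l" "height l \<le> height ?r + 1" "height ?r \<le> height l + 1" using "2.prems"(1) by auto
  then show ?case
    using IH l' avl_balL[of l r' a] height_balL[of l r' a]
    by (cases "height l = height r' + 2") (auto simp: keys_balL max_def)
qed

lemma avl_delete_T:
  assumes "avl T"
  shows "avl (result (delete_T x T)) \<and> height T \<le> height (result (delete_T x T)) + 1 \<and>
    height (result (delete_T x T)) \<le> height T"
  using assms
proof (induction x T rule: delete_T.induct)
  case (2 x l a n r)
  have lr: "avl l" "avl r" "height l \<le> height r + 1" "height r \<le> height l + 1"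
    using "2.prems" by auto
  consider "x \<prec> a" | "\<not> x \<prec> a" "a \<prec> x" | "\<not> x \<prec> a" "\<not> a \<prec> x" by blast
  then show ?case
  proof cases
    case 1
    let ?l = "result (delete_T x l)"
    have "avl ?l" "height l \<le> height ?l + 1" "height ?l \<le> height l"
      using 2 1 by (auto simp: tm_simps)
    then show ?thesis
      using 1 lr avl_balR[of ?l r a] height_balR[of ?l r a]
      by (cases "height r = height ?l + 2") (auto simp: tm_simps max_def)
  next
    case 2
    let ?r = "result (delete_T x r)"
    have "avl ?r" "height r \<le> height ?r + 1" "height ?r \<le> height r"
      using "2.IH"(2) "2.prems" 2 by (auto simp: tm_simps)
    then show ?thesis
      using 2 lr avl_balL[of l ?r a] height_balL[of l ?r a]
      by (cases "height l = height ?r + 2") (auto simp: tm_simps max_def)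
  next
    case 3
    show ?thesis
    proof (cases l)
      case Leaf
      then show ?thesis using 3 lr by (auto simp: tm_simps)
    next
      case (Node ll bk lr')
      obtain b k where bk: "bk = (b, k)" by fastforce
      obtain l' m where l': "result (split_max ll b lr') = (l', m)" by (meson surj_pair)
      have "avl l'" "height l' \<le> height l" "height l \<le> height l' + 1"
        using split_max[OF _ l', of k] lr(1) Node bk by auto
      moreover have "result (delete_T x (Node l (a, n) r)) = balR l' m r"
        using 3 Node bk l' by (simp add: tm_simps)
      ultimately show ?thesis
        using lr avl_balR[of l' r m] height_balR[of l' r m]
        by (cases "height r = height l' + 2") (auto simp: max_def)
    qed
  qed
qed (auto simp: tm_simps)

text \<open>\<open>removeAll\<close> distributes over the append of the two subtrees, and by the
  search order it is the identity on the side that the search does not enter.\<close>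

lemma delete_T_keys:
  assumes "avl T" "sorted_wrt (\<prec>) (keys T)" "x \<in> set (keys T)"
  shows "keys (result (delete_T x T)) = removeAll x (keys T)"
  using assms
proof (induction x T rule: delete_T.induct)
  case (2 x l a n r)
  have s: "sorted_wrt (\<prec>) (keys l)" "sorted_wrt (\<prec>) (keys r)" "\<forall>y\<in>set (keys l). y \<prec> a"
    "\<forall>y\<in>set (keys r). a \<prec> y"
    using "2.prems"(2) by (auto simp: sorted_wrt_prec_middle)
  have lr: "avl l" "avl r"
    using "2.prems" by auto
  consider "x \<prec> a" | "\<not> x \<prec> a" "a \<prec> x" | "\<not> x \<prec> a" "\<not> a \<prec> x" by blast
  then show ?case
  proof cases
    case 1
    have x: "x \<in> set (keys l)" "x \<notin> set (keys r)" "x \<noteq> a"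
      using 1 s "2.prems"(3) by (auto simp: prec_def)
    have "avl (result (delete_T x l))" "height r \<le> height (result (delete_T x l)) + 2"
      "height (result (delete_T x l)) \<le> height r + 1"
      using avl_delete_T[OF lr(1), of x] "2.prems"(1) by auto
    then show ?thesis
      using 1 x s lr "2.IH"(1) by (simp add: tm_simps keys_balR)
  next
    case 2
    have x: "x \<in> set (keys r)" "x \<notin> set (keys l)" "x \<noteq> a"
      using 2 s "2.prems"(3) by (auto simp: prec_def)
    have "\<not> x \<prec> a" "avl (result (delete_T x r))" "height l \<le> height (result (delete_T x r)) + 2"
      "height (result (delete_T x r)) \<le> height l + 1"
      using avl_delete_T[OF lr(2), of x] "2.prems"(1) 2 by auto
    then show ?thesis
      using 2 x s lr "2.IH"(2) by (simp add: tm_simps keys_balL)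
  next
    case 3
    have x: "x \<notin> set (keys r)" "x \<notin> set (keys l)" "x = a"
      using 3 s "2.prems"(3) by (auto simp: prec_def)
    show ?thesis
    proof (cases l)
      case Leaf
      then show ?thesis using 3 x by (simp add: tm_simps)
    next
      case (Node ll bk lr')
      obtain b k where bk: "bk = (b, k)" by fastforce
      obtain l' m where l': "result (split_max ll b lr') = (l', m)" by (meson surj_pair)
      have "avl l'" "keys l = keys l' @ [m]" "height r \<le> height l' + 2" "height l' \<le> height r + 1"
        using split_max[OF _ l', of k] lr(1) Node bk "2.prems"(1) by auto
      moreover have "result (delete_T x (Node l (a, n) r)) = balR l' m r"
        using 3 Node bk l' by (simp add: tm_simps)
      ultimately show ?thesis
        using lr x by (simp add: keys_balR)
    qed
  qed
qed (auto simp: tm_simps)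

lemma steps_split_max: "steps (split_max l a r) \<le> height r + 1"
  by (induction l a r rule: split_max.induct) (auto simp: tm_simps split: prod.splits)

lemma steps_delete_T: "steps (delete_T x T) \<le> height T + 1"
proof (induction x T rule: delete_T.induct)
  case (2 x l a n r)
  consider "x \<prec> a" | "\<not> x \<prec> a" "a \<prec> x" | "\<not> x \<prec> a" "\<not> a \<prec> x" "l = Leaf"
    | ll b k lr where "\<not> x \<prec> a" "\<not> a \<prec> x" "l = Node ll (b, k) lr"
    by (cases l) auto
  then show ?case
  proof cases
    case 1
    then show ?thesis using "2.IH"(1) by (simp add: tm_simps)
  next
    case 2
    then show ?thesis using "2.IH"(2) by (simp add: tm_simps)
  next
    case 3
    then show ?thesis by (simp add: tm_simps)
  next
    case 4
    then show ?thesis using steps_split_max[of ll b lr] by (auto simp: tm_simps split: prod.split)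
  qed
qed (auto simp: tm_simps)

text \<open>In logarithmic form, the height is at most twice the binary logarithm of
  \<open>size1\<close>. This is coarser than the Fibonacci bound but has a purely algebraic
  induction step, and constant factors do not matter.\<close>

lemma avl_size: "avl T \<Longrightarrow> (2::nat) ^ height T \<le> (size1 T)\<^sup>2"
proof (induction T rule: avl.induct)
  case (2 l a n r)
  have IH: "(2::nat) ^ height l \<le> (size1 l)\<^sup>2" "(2::nat) ^ height r \<le> (size1 r)\<^sup>2"
    using 2 by auto
  have "(2::nat) ^ height l \<le> 2 ^ (height r + 1)" "(2::nat) ^ height r \<le> 2 ^ (height l + 1)"
    using "2.prems" by (auto intro!: power_increasing simp del: power_Suc)
  then have le: "(2::nat) ^ height l \<le> 2 * (size1 r)\<^sup>2" "(2::nat) ^ height r \<le> 2 * (size1 l)\<^sup>2"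
    using IH by auto
  \<comment> \<open>Here \<open>x\<close> is the power for one subtree, \<open>a\<close> its size
    and \<open>b\<close> the size of the other; \<open>x <= 2 * b^2\<close> expresses the balance.
    If \<open>a <= b\<close>, then \<open>2 * x <= 2 * a^2 <= (a + b)^2\<close>; otherwise
    \<open>2 * x <= 4 * b^2 <= (a + b)^2\<close>.\<close>
  have *: "2 * x \<le> (a + b)\<^sup>2" if "x \<le> a\<^sup>2" "x \<le> 2 * b\<^sup>2" for x a b :: nat
  proof (cases "a \<le> b")
    case True
    then have "a * a \<le> a * b" "a * a \<le> b * b" by (intro mult_mono; simp)+
    then show ?thesis using that unfolding power2_eq_square by (simp add: algebra_simps)
  next
    case False
    then have "b * b \<le> a * b" "b * b \<le> b * a" "b * b \<le> a * a" by (intro mult_mono; simp)+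
    then show ?thesis using that unfolding power2_eq_square distrib_left distrib_right by linarith
  qed
  from *[OF IH(1) le(1)] *[OF IH(2) le(2)] show ?case
    by (auto simp: max_def add.commute)
qed auto

lemma height_le_log: "avl T \<Longrightarrow> real (height T) \<le> 2 * log 2 (real (size T) + 1)"
proof -
  assume "avl T"
  have "(2::real) ^ height T \<le> (real (size1 T))\<^sup>2"
    using of_nat_mono[OF avl_size[OF \<open>avl T\<close>], where ?'a = real] by simp
  then have "log 2 (2 ^ height T) \<le> log 2 ((real (size1 T))\<^sup>2)"
    by (subst log_le_cancel_iff) (auto simp: size1_size add_nonneg_eq_0_iff)
  then show ?thesis by (simp add: log_nat_power size1_size add.commute)
qed

section \<open>Searching an ordered tree for members and for boundary elements\<close>

lemma member_T:
  assumes "sorted_wrt (\<prec>) (keys T)"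
  shows "result (member_T x T) \<longleftrightarrow> x \<in> set (keys T)"
  using assms
proof (induction x T rule: member_T.induct)
  case (2 x l a n r)
  have s: "sorted_wrt (\<prec>) (keys l)" "sorted_wrt (\<prec>) (keys r)" "\<forall>y\<in>set (keys l). y \<prec> a"
    "\<forall>y\<in>set (keys r). a \<prec> y"
    using "2.prems"(1) by (auto simp: sorted_wrt_prec_middle)
  consider "x \<prec> a" | "\<not> x \<prec> a" "a \<prec> x" | "\<not> x \<prec> a" "\<not> a \<prec> x" by blast
  then show ?case
  proof cases
    case 1
    then have "x \<noteq> a" "x \<notin> set (keys r)" using s(4) by (auto simp: prec_def)
    then show ?thesis using "2.IH"(1)[OF 1 s(1)] 1 by (simp add: tm_simps)
  next
    case 2
    then have "x \<noteq> a" "x \<notin> set (keys l)" using s(3) by (auto simp: prec_def)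
    then show ?thesis using "2.IH"(2)[OF 2 s(2)] 2 by (simp add: tm_simps)
  next
    case 3
    then have "x \<notin> set (keys l)" "x \<notin> set (keys r)" using s(3,4) by (auto simp: prec_def)
    then show ?thesis using 3 by (simp add: tm_simps)
  qed
qed (auto simp: tm_simps)

lemma steps_member_T: "steps (member_T x T) \<le> height T + 1"
  by (induction x T rule: member_T.induct) (auto simp: tm_simps)

lemma steps_search_least: "steps (search_least P T b) \<le> height T + 1"
  by (induction P T b rule: search_least.induct) (auto simp: tm_simps)

lemma steps_search_greatest: "steps (search_greatest P T b) \<le> height T + 1"
  by (induction P T b rule: search_greatest.induct) (auto simp: tm_simps)

lemma find_append:
  "find P (xs @ ys) = (case find P xs of None \<Rightarrow> find P ys | Some a \<Rightarrow> Some a)"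
  by (induction xs) auto

text \<open>If \<open>P a\<close> fails, upward closure makes it fail on the whole left subtree, so
  only the right one has to be searched. If it holds, everything on the right comes later than
  \<open>a\<close>, which becomes the fallback for the left subtree.\<close>

lemma search_least_find:
  assumes "sorted_wrt (\<prec>) (keys T)"
    and "\<And>x y. x \<in> set (keys T) \<Longrightarrow> y \<in> set (keys T) \<Longrightarrow> x \<prec> y \<Longrightarrow> P x \<Longrightarrow> P y"
  shows "result (search_least P T b) = (case find P (keys T) of None \<Rightarrow> b | Some a \<Rightarrow> Some a)"
  using assms
proof (induction P T b rule: search_least.induct)
  case (2 P l a n r b)
  have s: "sorted_wrt (\<prec>) (keys l)" "sorted_wrt (\<prec>) (keys r)" "\<forall>y\<in>set (keys l). y \<prec> a"
    "\<forall>y\<in>set (keys r). a \<prec> y"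
    using "2.prems"(1) by (auto simp: sorted_wrt_prec_middle)
  show ?case
  proof (cases "P a")
    case True
    have "result (search_least P l (Some a)) =
      (case find P (keys l) of None \<Rightarrow> Some a | Some a \<Rightarrow> Some a)"
      by (rule "2.IH"(1)[OF True s(1)]) (rule "2.prems"(2); simp)
    then show ?thesis using True by (simp add: tm_simps find_append split: option.split)
  next
    case False
    have "result (search_least P r b) =
      (case find P (keys r) of None \<Rightarrow> b | Some a \<Rightarrow> Some a)"
      by (rule "2.IH"(2)[OF False s(2)]) (rule "2.prems"(2); simp)
    moreover have "\<not> P y" if "y \<in> set (keys l)" for y
      using "2.prems"(2)[of y a] that s(3) False by auto
    then have "find P (keys l) = None"
      unfolding find_None_iff by blast
    ultimately show ?thesis using False by (simp add: tm_simps find_append)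
  qed
qed (auto simp: tm_simps)

lemma search_greatest_find:
  assumes "sorted_wrt (\<prec>) (keys T)"
    and "\<And>x y. x \<in> set (keys T) \<Longrightarrow> y \<in> set (keys T) \<Longrightarrow> x \<prec> y \<Longrightarrow> P y \<Longrightarrow> P x"
  shows "result (search_greatest P T b) =
    (case find P (rev (keys T)) of None \<Rightarrow> b | Some a \<Rightarrow> Some a)"
  using assms
proof (induction P T b rule: search_greatest.induct)
  case (2 P l a n r b)
  have s: "sorted_wrt (\<prec>) (keys l)" "sorted_wrt (\<prec>) (keys r)" "\<forall>y\<in>set (keys l). y \<prec> a"
    "\<forall>y\<in>set (keys r). a \<prec> y"
    using "2.prems"(1) by (auto simp: sorted_wrt_prec_middle)
  show ?case
  proof (cases "P a")
    case True
    have "result (search_greatest P r (Some a)) =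
      (case find P (rev (keys r)) of None \<Rightarrow> Some a | Some a \<Rightarrow> Some a)"
      by (rule "2.IH"(1)[OF True s(2)]) (rule "2.prems"(2); simp)
    then show ?thesis using True by (simp add: tm_simps find_append split: option.split)
  next
    case False
    have "result (search_greatest P l b) =
      (case find P (rev (keys l)) of None \<Rightarrow> b | Some a \<Rightarrow> Some a)"
      by (rule "2.IH"(2)[OF False s(1)]) (rule "2.prems"(2); simp)
    moreover have "\<not> P y" if "y \<in> set (keys r)" for y
      using "2.prems"(2)[of a y] that s(4) False by auto
    then have "find P (rev (keys r)) = None"
      unfolding find_None_iff set_rev by blast
    ultimately show ?thesis using False by (simp add: tm_simps find_append)
  qed
qed (auto simp: tm_simps)

text \<open>\<open>arg_min\<close> is a choice operator; strict precedence of \<open>a\<close> over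
  all other candidates makes the minimiser unique and thereby determines the choice.\<close>

lemma least_eq_Some:
  assumes "P a" "\<And>b. P b \<Longrightarrow> b \<noteq> a \<Longrightarrow> a \<prec> b"
  shows "least P = Some a"
proof -
  have "P b \<and> (\<nexists>c. P c \<and> fin c < fin b) \<longleftrightarrow> b = a" for b
    using assms(1) assms(2)[of b] assms(2) unfolding prec_def by (metis less_asym)
  then have "arg_min fin P = a"
    by (simp add: arg_min_def is_arg_min_def)
  then show ?thesis using assms(1) unfolding least_def by metis
qed

lemma greatest_eq_Some:
  assumes "P a" "\<And>b. P b \<Longrightarrow> b \<noteq> a \<Longrightarrow> b \<prec> a"
  shows "greatest P = Some a"
proof -
  have "P b \<and> (\<nexists>c. P c \<and> fin b < fin c) \<longleftrightarrow> b = a" for b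
    using assms(1) assms(2)[of b] assms(2) unfolding prec_def by (metis less_asym)
  then have "arg_max fin P = a"
    by (simp add: arg_max_def is_arg_max_def)
  then show ?thesis using assms(1) unfolding greatest_def by metis
qed

lemma find_eq_least:
  assumes "sorted_wrt (\<prec>) xs"
  shows "find P xs = least (\<lambda>j. j \<in> set xs \<and> P j)"
  using assms
proof (induction xs)
  case (Cons x xs)
  show ?case
  proof (cases "P x")
    case True
    then show ?thesis using Cons.prems by (auto intro!: least_eq_Some[symmetric])
  next
    case False
    then have "(\<lambda>j. j \<in> set (x # xs) \<and> P j) = (\<lambda>j. j \<in> set xs \<and> P j)" by auto
    then show ?thesis using False Cons by simp
  qed
qed (simp add: least_def)

lemma find_rev_eq_greatest:
  assumes "sorted_wrt (\<prec>) xs"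
  shows "find P (rev xs) = greatest (\<lambda>j. j \<in> set xs \<and> P j)"
  using assms
proof (induction xs rule: rev_induct)
  case (snoc x xs)
  show ?case
  proof (cases "P x")
    case True
    then show ?thesis using snoc.prems by (auto intro!: greatest_eq_Some[symmetric] simp: sorted_wrt_append)
  next
    case False
    then have "(\<lambda>j. j \<in> set (xs @ [x]) \<and> P j) = (\<lambda>j. j \<in> set xs \<and> P j)" by auto
    then show ?thesis using False snoc by (simp add: sorted_wrt_append)
  qed
qed (simp add: greatest_def)


section \<open>Virtual trees\<close>

text \<open>An empty middle child would contribute a spurious edge from \<open>last []\<close> to
  \<open>edges\<close>, so it is excluded. The quantifier ranges over an image multiset because
  primitive recursion through multisets goes through \<open>image_mset\<close>.\<close>

primrec wf_vtree :: "'a vtree \<Rightarrow> bool" where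
  "wf_vtree VLeaf \<longleftrightarrow> True"
| "wf_vtree (VNode l v ms r) \<longleftrightarrow>
    wf_vtree l \<and> wf_vtree r \<and> VLeaf \<notin># ms \<and> (\<forall>b\<in>#image_mset wf_vtree ms. b)"

lemma solid_path_eq_Nil [simp]: "solid_path t = [] \<longleftrightarrow> t = VLeaf"
  by (cases t) auto

lemma set_solid_path: "x \<in> set (solid_path t) \<Longrightarrow> x \<in># vertices t"
  by (induction t rule: solid_path.induct) auto

lemma hd_solid_path: "t \<noteq> VLeaf \<Longrightarrow> hd (solid_path t) \<in># vertices t"
  by (intro set_solid_path) auto

lemma last_solid_path: "t \<noteq> VLeaf \<Longrightarrow> last (solid_path t) \<in># vertices t"
  by (intro set_solid_path) auto

lemma edges_vertices:
  "wf_vtree t \<Longrightarrow> (x, y) \<in> edges t \<Longrightarrow> x \<in># vertices t \<and> y \<in># vertices t"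
proof (induction t)
  case (VNode l v ms r)
  have "t \<noteq> VLeaf" if "t \<in># ms" for t using that VNode.prems(1) by auto
  then show ?case using VNode hd_solid_path[of r] last_solid_path[of l] last_solid_path
    by (auto split: if_splits) blast+
qed auto

lemma count_le_one_disjoint:
  "count (add_mset v (A + B)) z \<le> 1 \<Longrightarrow> z \<in># A \<Longrightarrow> z \<notin># B \<and> z \<noteq> v"
  unfolding count_greater_zero_iff[symmetric]
  by (auto simp del: count_greater_zero_iff split: if_splits)

text \<open>The last node of the solid path is the root of the real tree. It is \<open>v\<close>
  itself or lies in \<open>r\<close>; sources of the other edges lie in \<open>l\<close> or in a
  middle child, and uniqueness of vertices keeps them apart from it.\<close>

lemma edges_not_last:
  assumes "wf_vtree t" "\<And>x. count (vertices t) x \<le> 1" "(x, y) \<in> edges t"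
  shows "x \<noteq> last (solid_path t)"
  using assms
proof (induction t)
  case (VNode l v ms r)
  have disj: "z \<notin># vertices r \<and> z \<noteq> v" if "z \<in># vertices l + \<Sum>\<^sub># (image_mset vertices ms)" for z
    using count_le_one_disjoint[of v "vertices l + \<Sum>\<^sub># (image_mset vertices ms)" "vertices r" z]
      VNode.prems(2)[of z] that by (simp add: ac_simps)
  have v: "v \<notin># vertices r"
    using VNode.prems(2)[of v] by (auto simp: not_in_iff)
  have ms: "t \<noteq> VLeaf \<and> wf_vtree t" if "t \<in># ms" for t using that VNode.prems(1) by auto
  have last: "last (solid_path (VNode l v ms r)) \<in># add_mset v (vertices r)"
    using last_solid_path[of r] by auto
  consider "(x, y) \<in> edges l" | "(x, y) \<in> edges r" | t where "t \<in># ms" "(x, y) \<in> edges t"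
    | "l \<noteq> VLeaf" "x = last (solid_path l)" | "r \<noteq> VLeaf" "x = v"
    | t where "t \<in># ms" "x = last (solid_path t)"
    using VNode.prems(3) by (auto split: if_splits)
  then show ?case
  proof cases
    case 1
    then show ?thesis using edges_vertices[of l] disj[of x] VNode.prems(1) last by auto
  next
    case 2
    moreover have "r \<noteq> VLeaf" using 2 by auto
    moreover have "count (vertices r) z \<le> 1" for z
      using VNode.prems(2)[of z] by (auto split: if_splits)
    ultimately show ?thesis using VNode.IH(3) VNode.prems(1) by auto
  next
    case 3
    then have "x \<in># vertices t" using edges_vertices[of t] ms[of t] by blast
    then have "x \<in># vertices l + \<Sum>\<^sub># (image_mset vertices ms)" using 3(1) by auto
    then show ?thesis using disj[of x] last by auto
  next
    case 4
    then show ?thesis using last_solid_path[of l] disj[of x] last by auto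
  next
    case 5
    then show ?thesis using last_solid_path[of r] v by auto
  next
    case 6
    then have "x \<in># vertices t" using last_solid_path[of t] ms[of t] by blast
    then have "x \<in># vertices l + \<Sum>\<^sub># (image_mset vertices ms)" using 6(1) by auto
    then show ?thesis using disj[of x] last by auto
  qed
qed auto

text \<open>A node of \<open>l\<close> or of a middle child climbs to the top of its own solid path,
  from there by one edge to \<open>v\<close>, and from \<open>v\<close> along
  \<open>r\<close>.\<close>

lemma reach_last:
  "wf_vtree t \<Longrightarrow> x \<in># vertices t \<Longrightarrow> (x, last (solid_path t)) \<in> (edges t)\<^sup>*"
proof (induction t arbitrary: x)
  case (VNode l v ms r)
  let ?E = "edges (VNode l v ms r)"
  have sub: "(edges l)\<^sup>* \<subseteq> ?E\<^sup>*" "(edges r)\<^sup>* \<subseteq> ?E\<^sup>*" "\<And>t. t \<in># ms \<Longrightarrow> (edges t)\<^sup>* \<subseteq> ?E\<^sup>*"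
    by (rule rtrancl_mono; auto)+
  have v: "(v, last (solid_path (VNode l v ms r))) \<in> ?E\<^sup>*"
  proof (cases "r = VLeaf")
    case False
    then have "(v, hd (solid_path r)) \<in> ?E" by simp
    moreover have "(hd (solid_path r), last (solid_path r)) \<in> ?E\<^sup>*"
      using VNode.IH(3)[of "hd (solid_path r)"] hd_solid_path[OF False] VNode.prems(1) sub(2) by auto
    ultimately show ?thesis using False by (auto intro: converse_rtrancl_into_rtrancl)
  qed simp
  consider "x \<in># vertices l" | "x = v" | "x \<in># vertices r" | t where "t \<in># ms" "x \<in># vertices t"
    using VNode.prems(2) by auto
  then show ?case
  proof cases
    case 1
    then have "(x, last (solid_path l)) \<in> ?E\<^sup>*"
      using VNode.IH(1)[of x] VNode.prems(1) sub(1) by auto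
    moreover have "(last (solid_path l), v) \<in> ?E" using 1 by auto
    ultimately show ?thesis using v by (meson rtrancl.rtrancl_into_rtrancl rtrancl_trans)
  next
    case 2
    then show ?thesis using v by simp
  next
    case 3
    then have "r \<noteq> VLeaf" by auto
    then show ?thesis
      using 3 VNode.IH(3)[of x] VNode.prems(1) sub(2) by auto
  next
    case 4
    then have "(x, last (solid_path t)) \<in> ?E\<^sup>*"
      using VNode.IH(2)[of t x] VNode.prems(1) sub(3)[of t] by auto
    moreover have "(last (solid_path t), v) \<in> ?E" using 4 by auto
    ultimately show ?thesis using v by (meson rtrancl.rtrancl_into_rtrancl rtrancl_trans)
  qed
qed auto

text \<open>\<open>free_node\<close> subtracts a literal singleton tree, so isolation has to
  determine the shape of the virtual tree. Without outgoing edge \<open>v\<close> is the real root,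
  hence reached from the virtual root \<open>u\<close>; without incoming edge this forces
  \<open>u = v\<close>. Any subtree of \<open>u\<close> would contribute an edge at
  \<open>u\<close>.\<close>

lemma isolated_vtree:
  assumes "wf_vtree t" "v \<in># vertices t" "\<And>x. (x, v) \<notin> edges t" "\<And>x. (v, x) \<notin> edges t"
  shows "t = VNode VLeaf v {#} VLeaf"
proof -
  obtain l u ms r where t: "t = VNode l u ms r" using assms(2) by (cases t) auto
  have "v = last (solid_path t)"
    using reach_last[OF assms(1,2)] assms(4) by (metis converse_rtranclE)
  then have "(u, v) \<in> (edges t)\<^sup>*"
    using reach_last[OF assms(1), of u] t by simp
  then have "u = v" using assms(3) by (metis rtranclE)
  moreover have "(last (solid_path l), u) \<in> edges t" if "l \<noteq> VLeaf" using that t by simp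
  moreover have "(u, hd (solid_path r)) \<in> edges t" if "r \<noteq> VLeaf" using that t by simp
  moreover have "(last (solid_path s), u) \<in> edges t" if "s \<in># ms" for s using that t by auto
  ultimately have "l = VLeaf" "r = VLeaf" "\<And>s. s \<notin># ms"
    using assms(3,4) by blast+
  then have "ms = {#}" by (simp add: multiset_eq_iff not_in_iff)
  then show ?thesis using t \<open>u = v\<close> \<open>l = VLeaf\<close> \<open>r = VLeaf\<close> by simp
qed

lemma successively_solid_path: "successively (\<lambda>x y. (x, y) \<in> edges t) (solid_path t)"
proof (induction t rule: solid_path.induct)
  case (2 l v ms r)
  have "successively (\<lambda>x y. (x, y) \<in> edges (VNode l v ms r)) (solid_path l)"
    "successively (\<lambda>x y. (x, y) \<in> edges (VNode l v ms r)) (solid_path r)"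
    using 2 by (auto elim!: successively_mono)
  then show ?case by (auto simp: successively_append_iff successively_Cons)
qed auto

lemma successively_reach:
  "successively (\<lambda>x y. (x, y) \<in> E) xs \<Longrightarrow> x \<in> set xs \<Longrightarrow> (hd xs, x) \<in> E\<^sup>*"
proof (induction xs)
  case (Cons a xs)
  then show ?case
    by (auto simp: successively_Cons intro: converse_rtrancl_into_rtrancl)
qed auto

text \<open>The solid path is closed under following edges: a node with an outgoing edge is not the
  last one, its successor on the path is a target of such an edge, and single-valuedness leaves no
  other target.\<close>

lemma reach_set_solid_path:
  assumes "wf_vtree t" "\<And>x. count (vertices t) x \<le> 1" "single_valued (edges t)"
    and "(x, y) \<in> (edges t)\<^sup>*" "x \<in> set (solid_path t)"
  shows "y \<in> set (solid_path t)"
  using assms(4,5)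
proof (induction rule: rtrancl_induct)
  case (step y z)
  then obtain xs ys where p: "solid_path t = xs @ y # ys" by (meson split_list)
  have "y \<noteq> last (solid_path t)" using edges_not_last[OF assms(1,2) step.hyps(2)] .
  then obtain w ws where "ys = w # ws" using p by (cases ys) auto
  then have "(y, w) \<in> edges t"
    using successively_solid_path[of t] p by (auto simp: successively_append_iff successively_Cons)
  then have "w = z" using assms(3) step.hyps(2) by (auto dest: single_valuedD)
  then show ?case using p \<open>ys = w # ws\<close> by simp
qed auto


subsection \<open>Equivalence of virtual trees\<close>

text \<open>The relation preserved by rotations: the solid path stays the same, node by node.
  Well-formedness is an equivalence so that it can be transported both ways.\<close>

definition solid_eq :: "'a vtree \<Rightarrow> 'a vtree \<Rightarrow> bool" where
  "solid_eq t t' \<longleftrightarrow> solid_path t = solid_path t' \<and> edges t = edges t' \<and> vertices t = vertices t' \<and>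
     (wf_vtree t \<longleftrightarrow> wf_vtree t')"

text \<open>The weaker relation preserved by splices, which exchange solid and dashed edges. Of the
  solid path only its last node remains, since that is the real root and all that a parent across a
  dashed edge sees.\<close>

definition real_eq :: "'a vtree \<Rightarrow> 'a vtree \<Rightarrow> bool" where
  "real_eq t t' \<longleftrightarrow> last (solid_path t) = last (solid_path t') \<and> edges t = edges t' \<and>
     vertices t = vertices t' \<and> (wf_vtree t \<longleftrightarrow> wf_vtree t') \<and> (t = VLeaf \<longleftrightarrow> t' = VLeaf)"

lemma solid_eq_Leaf: "solid_eq t t' \<Longrightarrow> t = VLeaf \<longleftrightarrow> t' = VLeaf"
  unfolding solid_eq_def by (metis solid_path_eq_Nil)

lemma solid_eq_refl [simp]: "solid_eq t t"
  by (simp add: solid_eq_def)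

lemma solid_eq_trans: "solid_eq t t' \<Longrightarrow> solid_eq t' t'' \<Longrightarrow> solid_eq t t''"
  by (simp add: solid_eq_def)

lemma real_eq_trans: "real_eq t t' \<Longrightarrow> real_eq t' t'' \<Longrightarrow> real_eq t t''"
  by (simp add: real_eq_def)

lemma solid_eq_imp_real_eq: "solid_eq t t' \<Longrightarrow> real_eq t t'"
  using solid_eq_Leaf by (auto simp: solid_eq_def real_eq_def)

lemma solid_eq_rotate:
  "solid_eq (VNode a x ms (VNode b y ns c)) (VNode (VNode a x ms b) y ns c)"
  by (cases "b = VLeaf") (auto simp: solid_eq_def)

lemma solid_eq_rotate':
  "solid_eq (VNode (VNode a x ms b) y ns c) (VNode a x ms (VNode b y ns c))"
  using solid_eq_rotate by (metis solid_eq_def)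

lemma solid_eq_left: "solid_eq t t' \<Longrightarrow> solid_eq (VNode t v ms r) (VNode t' v ms r)"
  using solid_eq_Leaf[of t t'] by (simp add: solid_eq_def)

lemma solid_eq_right: "solid_eq t t' \<Longrightarrow> solid_eq (VNode l v ms t) (VNode l v ms t')"
  using solid_eq_Leaf[of t t'] by (simp add: solid_eq_def)

text \<open>A middle child shows itself to its parent only through its real root, so even the weak
  relation below a dashed edge yields the strong one above it.\<close>

lemma real_eq_middle:
  assumes "real_eq t t'"
  shows "solid_eq (VNode l v (add_mset t ms) r) (VNode l v (add_mset t' ms) r)"
proof -
  have "{(last (solid_path s), v) |s. s \<in># add_mset t ms} =
    insert (last (solid_path t), v) {(last (solid_path s), v) |s. s \<in># ms}" for t
    by auto
  then show ?thesis
    using assms unfolding solid_eq_def edges.simps by (auto simp: real_eq_def)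
qed

lemma solid_eq_plug: "solid_eq t t' \<Longrightarrow> solid_eq (plug t fs) (plug t' fs)"
proof (induction t fs arbitrary: t' rule: plug.induct)
  case (4 t l p ms r fs)
  then show ?case using real_eq_middle solid_eq_imp_real_eq by fastforce
qed (auto intro: solid_eq_left solid_eq_right)

fun solid_frame :: "'a frame \<Rightarrow> bool" where
  "solid_frame (FromMiddle l p ms r) \<longleftrightarrow> False"
| "solid_frame _ \<longleftrightarrow> True"

lemma not_solid_frameE:
  assumes "\<not> solid_frame f" obtains l p ms r where "f = FromMiddle l p ms r"
  using assms by (cases f) auto

text \<open>Across a solid edge the parent would see more of the path than its last node; hence the
  first frame has to come from a middle child.\<close>

lemma real_eq_plug:
  assumes "real_eq t t'" "fs = [] \<or> \<not> solid_frame (hd fs)"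
  shows "real_eq (plug t fs) (plug t' fs)"
proof (cases fs)
  case (Cons f gs)
  then obtain l p ms r where "f = FromMiddle l p ms r"
    using assms(2) by (auto elim: not_solid_frameE)
  then show ?thesis
    using Cons solid_eq_imp_real_eq[OF solid_eq_plug[OF real_eq_middle[OF assms(1)]]] by simp
qed (use assms in simp)

text \<open>One splice: the left subtree and a middle child trade places. Both give the edge from
  their real root to \<open>w\<close>, and \<open>edges\<close> does not record whether an edge is
  solid or dashed.\<close>

lemma real_eq_swap:
  assumes "t \<noteq> VLeaf"
  shows "real_eq (VNode t w (add_vtree l ms) r) (VNode l w (add_mset t ms) r)"
  using assms by (auto simp: real_eq_def add_vtree_def)

lemma real_eq_drop_left:
  "real_eq (VNode VLeaf w (add_vtree l ms) r) (VNode l w ms r)"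
  by (auto simp: real_eq_def add_vtree_def)

lemma plug_append: "plug t (fs @ gs) = plug (plug t fs) gs"
  by (induction t fs rule: plug.induct) auto

lemma plug_neq_VLeaf: "t \<noteq> VLeaf \<Longrightarrow> plug t fs \<noteq> VLeaf"
  by (induction t fs rule: plug.induct) auto

lemma vertices_plug_cong: "vertices t = vertices t' \<Longrightarrow> vertices (plug t fs) = vertices (plug t' fs)"
  by (induction t fs arbitrary: t' rule: plug.induct) auto

lemma vertices_plug_sub: "vertices t \<subseteq># vertices (plug t fs)"
proof (induction t fs rule: plug.induct)
  case (2 t p ms r fs)
  have "vertices t \<subseteq># add_mset p (vertices r + \<Sum>\<^sub># (image_mset vertices ms)) + vertices t"
    by (rule mset_subset_eq_add_right)
  then have sub: "vertices t \<subseteq># vertices (VNode t p ms r)" by (simp add: ac_simps)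
  show ?case using subset_mset.order_trans[OF sub 2] by simp
next
  case (3 t l p ms fs)
  have "vertices t \<subseteq># add_mset p (vertices l + \<Sum>\<^sub># (image_mset vertices ms)) + vertices t"
    by (rule mset_subset_eq_add_right)
  then have sub: "vertices t \<subseteq># vertices (VNode l p ms t)" by (simp add: ac_simps)
  show ?case using subset_mset.order_trans[OF sub 3] by simp
next
  case (4 t l p ms r fs)
  have "vertices t \<subseteq># add_mset p (vertices l + vertices r + \<Sum>\<^sub># (image_mset vertices ms)) + vertices t"
    by (rule mset_subset_eq_add_right)
  then have sub: "vertices t \<subseteq># vertices (VNode l p (add_mset t ms) r)" by (simp add: ac_simps)
  show ?case using subset_mset.order_trans[OF sub 4] by simp
qed simp

lemma not_on_solid_path_plug:
  assumes "x \<in># vertices t" "x \<notin> set (solid_path t)" "count (vertices (plug t fs)) x \<le> 1"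
  shows "x \<notin> set (solid_path (plug t fs))"
  using assms
proof (induction t fs rule: plug.induct)
  case (2 t p ms r fs)
  have "count (vertices (VNode t p ms r)) x \<le> 1"
    using "2.prems"(3) mset_subset_eq_count[OF vertices_plug_sub, of "VNode t p ms r" x fs] by simp
  then have "x \<noteq> p" "x \<notin># vertices r"
    using "2.prems"(1) count_le_one_disjoint[of p "vertices t" "vertices r + \<Sum>\<^sub># (image_mset vertices ms)" x]
    by (simp_all add: ac_simps)
  then show ?case using 2 set_solid_path by force
next
  case (3 t l p ms fs)
  have "count (vertices (VNode l p ms t)) x \<le> 1"
    using "3.prems"(3) mset_subset_eq_count[OF vertices_plug_sub, of "VNode l p ms t" x fs] by simp
  then have "x \<noteq> p" "x \<notin># vertices l"
    using "3.prems"(1) count_le_one_disjoint[of p "vertices t" "vertices l + \<Sum>\<^sub># (image_mset vertices ms)" x]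
    by (simp_all add: ac_simps)
  then show ?case using 3 set_solid_path by force
next
  case (4 t l p ms r fs)
  have "count (vertices (VNode l p (add_mset t ms) r)) x \<le> 1"
    using "4.prems"(3) mset_subset_eq_count[OF vertices_plug_sub, of "VNode l p (add_mset t ms) r" x fs]
    by simp
  then have "x \<noteq> p" "x \<notin># vertices l" "x \<notin># vertices r"
    using "4.prems"(1) count_le_one_disjoint[of p "vertices t"
      "vertices l + vertices r + \<Sum>\<^sub># (image_mset vertices ms)" x]
    by (simp_all add: ac_simps)
  then show ?case using 4 set_solid_path by force
qed simp

text \<open>This makes the answer of \<open>on_root_path\<close> sound: if ancestors remain after
  splaying, the nearest one is across a dashed edge, and uniqueness of vertices prevents a second
  occurrence on the solid path above.\<close>

lemma middle_not_on_solid_path: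
  assumes "x \<in># vertices t" "\<not> solid_frame f" "count (vertices (plug t (f # fs))) x \<le> 1"
  shows "x \<notin> set (solid_path (plug t (f # fs)))"
proof -
  obtain l p ms r where f: "f = FromMiddle l p ms r" using assms(2) by (rule not_solid_frameE)
  let ?t = "VNode l p (add_mset t ms) r"
  have "count (vertices ?t) x \<le> 1"
    using assms(3) f mset_subset_eq_count[OF vertices_plug_sub, of ?t x fs] by simp
  then have "x \<notin> set (solid_path ?t)"
    using assms(1) set_solid_path[of x l] set_solid_path[of x r]
      count_le_one_disjoint[of p "vertices t"
        "vertices l + vertices r + \<Sum>\<^sub># (image_mset vertices ms)" x]
    by (auto simp: ac_simps)
  then show ?thesis
    using not_on_solid_path_plug[of x ?t fs] assms(1,3) f by simp
qed


subsection \<open>Splaying and splicing\<close>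

text \<open>The size includes everything below middle children. Ranks therefore grow across dashed
  edges as well as solid ones, which lets the costs of successive splays add up to a single
  difference.\<close>

definition rank :: "'a vtree \<Rightarrow> real" where
  "rank t = log 2 (real (size (vertices t)))"

primrec pot :: "'a vtree \<Rightarrow> real" where
  "pot VLeaf = 0"
| "pot (VNode l v ms r) =
    rank (VNode l v ms r) + pot l + pot r + \<Sum>\<^sub># (image_mset pot ms)"

lemma rank_nonneg: "0 \<le> rank t"
proof (cases "vertices t = {#}")
  case False
  then have "1 \<le> size (vertices t)" by (simp add: Suc_leI nonempty_has_size)
  then show ?thesis by (simp add: rank_def)
qed (simp add: rank_def log_def)

lemma sum_mset_image_nonneg:
  fixes f :: "'a \<Rightarrow> real"
  shows "(\<And>t. t \<in># ms \<Longrightarrow> 0 \<le> f t) \<Longrightarrow> 0 \<le> \<Sum>\<^sub># (image_mset f ms)"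
  by (induction ms) auto

lemma pot_nonneg: "0 \<le> pot t"
proof (induction t)
  case (VNode l v ms r)
  then have "0 \<le> \<Sum>\<^sub># (image_mset pot ms)" by (intro sum_mset_image_nonneg) auto
  then show ?case using VNode rank_nonneg[of "VNode l v ms r"] by simp
qed simp

lemma rank_mono:
  assumes "t \<noteq> VLeaf" "size (vertices t) \<le> size (vertices t')"
  shows "rank t \<le> rank t'"
proof -
  have "0 < size (vertices t)" using assms(1) by (cases t) auto
  then show ?thesis using assms(2) unfolding rank_def by (subst log_le_cancel_iff) auto
qed

lemma rank_plug: "t \<noteq> VLeaf \<Longrightarrow> rank t \<le> rank (plug t fs)"
  by (intro rank_mono size_mset_mono vertices_plug_sub)

lemma rank_cong: "vertices t = vertices t' \<Longrightarrow> rank t = rank t'"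
  by (simp add: rank_def)

text \<open>The ancestors depend on a subtree only through its number of vertices, so a local change
  of potential is the global one.\<close>

lemma pot_plug:
  "vertices t = vertices t' \<Longrightarrow> pot (plug t fs) - pot (plug t' fs) = pot t - pot t'"
proof (induction t fs arbitrary: t' rule: plug.induct)
  case (2 t p ms r fs)
  then have "pot (plug (VNode t p ms r) fs) - pot (plug (VNode t' p ms r) fs) =
    pot (VNode t p ms r) - pot (VNode t' p ms r)" by simp
  then show ?case using rank_cong[of "VNode t p ms r" "VNode t' p ms r"] 2 by simp
next
  case (3 t l p ms fs)
  then have "pot (plug (VNode l p ms t) fs) - pot (plug (VNode l p ms t') fs) =
    pot (VNode l p ms t) - pot (VNode l p ms t')" by simp
  then show ?case using rank_cong[of "VNode l p ms t" "VNode l p ms t'"] 3 by simp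
next
  case (4 t l p ms r fs)
  then have "pot (plug (VNode l p (add_mset t ms) r) fs) - pot (plug (VNode l p (add_mset t' ms) r) fs) =
    pot (VNode l p (add_mset t ms) r) - pot (VNode l p (add_mset t' ms) r)" by simp
  then show ?case using rank_cong[of "VNode l p (add_mset t ms) r" "VNode l p (add_mset t' ms) r"] 4
    by simp
qed simp

text \<open>Sizes count left and middle children alike, so a splice is free of charge for the
  potential; only the splay before it changes anything.\<close>

lemma pot_swap:
  assumes "t \<noteq> VLeaf"
  shows "pot (VNode t w (add_vtree l ms) r) = pot (VNode l w (add_mset t ms) r)"
proof -
  have "vertices (VNode t w (add_vtree l ms) r) = vertices (VNode l w (add_mset t ms) r)"
    by (auto simp: add_vtree_def)
  from rank_cong[OF this] show ?thesis by (auto simp: add_vtree_def)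
qed

lemma pot_drop_left: "pot (VNode VLeaf w (add_vtree l ms) r) = pot (VNode l w ms r)"
proof -
  have "vertices (VNode VLeaf w (add_vtree l ms) r) = vertices (VNode l w ms r)"
    by (auto simp: add_vtree_def)
  from rank_cong[OF this] show ?thesis by (auto simp: add_vtree_def)
qed

text \<open>AM-GM, in the form \<open>4ab \<le> (a + b)\<^sup>2\<close>.\<close>

lemma log_add_le:
  assumes "0 < a" "0 < b" "a + b \<le> (c::real)"
  shows "log 2 a + log 2 b + 2 \<le> 2 * log 2 c"
proof -
  have "4 * (a * b) \<le> (a + b)\<^sup>2"
    using sum_squares_ge_zero[of "a - b" 0] by (simp add: power2_eq_square algebra_simps)
  also have "\<dots> \<le> c\<^sup>2" using assms by (intro power_mono) auto
  finally have "log 2 (4 * (a * b)) \<le> log 2 (c\<^sup>2)"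
    using assms by (subst log_le_cancel_iff) auto
  moreover have "log 2 (4 * (a * b)) = 2 + (log 2 a + log 2 b)"
    using assms log_pow_cancel[of 2 2] by (simp add: log_mult)
  moreover have "log 2 (c\<^sup>2) = 2 * log 2 c"
    using assms by (simp add: log_nat_power)
  ultimately show ?thesis by simp
qed

section \<open>The change of potential in the rotations\<close>

lemma rank_add_le:
  assumes "t \<noteq> VLeaf" "t' \<noteq> VLeaf" "size (vertices t) + size (vertices t') \<le> size (vertices s)"
  shows "rank t + rank t' + 2 \<le> 2 * rank s"
proof -
  have "0 < size (vertices t)" "0 < size (vertices t')" using assms(1,2) by (cases t; cases t'; auto)+
  then show ?thesis unfolding rank_def using assms(3) by (intro log_add_le) auto
qed

text \<open>The gain of 2 comes from \<open>N\<close> and the new subtree \<open>?D\<close> of the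
  grandparent, whose vertices are disjoint parts of \<open>T\<close>. The remaining new rank is at
  most \<open>rank T\<close>, the remaining old one at least \<open>rank N\<close>.\<close>

lemma zig_zig_left:
  fixes l r a b :: "'a vtree" and x p g :: 'a and xs ms gs :: "'a vtree multiset"
  defines "N \<equiv> VNode l x xs r"
  defines "T \<equiv> VNode (VNode N p ms a) g gs b"
  defines "T' \<equiv> VNode l x xs (VNode r p ms (VNode a g gs b))"
  shows "solid_eq T' T" "pot T' + 2 \<le> pot T + 3 * (rank T - rank N)"
proof -
  show eq: "solid_eq T' T"
    unfolding T'_def T_def N_def
    by (meson solid_eq_rotate solid_eq_right solid_eq_trans)
  let ?B = "VNode N p ms a" and ?D = "VNode a g gs b" and ?P = "VNode r p ms (VNode a g gs b)"
  have "rank N + rank ?D + 2 \<le> 2 * rank T" by (rule rank_add_le) (auto simp: T_def N_def)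
  moreover have "rank ?P \<le> rank T" by (rule rank_mono) (auto simp: T_def N_def)
  moreover have "rank N \<le> rank ?B" by (rule rank_mono) (auto simp: N_def)
  moreover have "rank T' = rank T" using eq by (intro rank_cong) (simp add: solid_eq_def)
  moreover have "pot T' - rank T' - rank ?P - rank ?D = pot T - rank T - rank ?B - rank N"
    unfolding T'_def T_def N_def by simp
  ultimately show "pot T' + 2 \<le> pot T + 3 * (rank T - rank N)" by argo
qed

lemma zig_zig_right:
  fixes l r a b :: "'a vtree" and x p g :: 'a and xs ms gs :: "'a vtree multiset"
  defines "N \<equiv> VNode l x xs r"
  defines "T \<equiv> VNode b g gs (VNode a p ms N)"
  defines "T' \<equiv> VNode (VNode (VNode b g gs a) p ms l) x xs r"
  shows "solid_eq T' T" "pot T' + 2 \<le> pot T + 3 * (rank T - rank N)"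
proof -
  show eq: "solid_eq T' T"
    unfolding T'_def T_def N_def
    by (meson solid_eq_rotate' solid_eq_left solid_eq_trans)
  let ?B = "VNode a p ms N" and ?D = "VNode b g gs a" and ?P = "VNode (VNode b g gs a) p ms l"
  have "rank N + rank ?D + 2 \<le> 2 * rank T" by (rule rank_add_le) (auto simp: T_def N_def)
  moreover have "rank ?P \<le> rank T" by (rule rank_mono) (auto simp: T_def N_def)
  moreover have "rank N \<le> rank ?B" by (rule rank_mono) (auto simp: N_def)
  moreover have "rank T' = rank T" using eq by (intro rank_cong) (simp add: solid_eq_def)
  moreover have "pot T' - rank T' - rank ?P - rank ?D = pot T - rank T - rank ?B - rank N"
    unfolding T'_def T_def N_def by simp
  ultimately show "pot T' + 2 \<le> pot T + 3 * (rank T - rank N)" by argo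
qed

text \<open>Here the disjoint parts are the two new children \<open>?P\<close> and
  \<open>?D\<close>. The change is even bounded by twice the difference of ranks; the factor 3 is
  kept for uniformity, using \<open>rank N <= rank T\<close>.\<close>

lemma zig_zag_left:
  fixes l r a b :: "'a vtree" and x p g :: 'a and xs ms gs :: "'a vtree multiset"
  defines "N \<equiv> VNode l x xs r"
  defines "T \<equiv> VNode b g gs (VNode N p ms a)"
  defines "T' \<equiv> VNode (VNode b g gs l) x xs (VNode r p ms a)"
  shows "solid_eq T' T" "pot T' + 2 \<le> pot T + 3 * (rank T - rank N)"
proof -
  show eq: "solid_eq T' T"
    unfolding T'_def T_def N_def
    by (meson solid_eq_rotate solid_eq_rotate' solid_eq_right solid_eq_trans)
  let ?B = "VNode N p ms a" and ?D = "VNode b g gs l" and ?P = "VNode r p ms a"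
  have "rank ?P + rank ?D + 2 \<le> 2 * rank T" by (rule rank_add_le) (auto simp: T_def N_def)
  moreover have "rank N \<le> rank ?B" by (rule rank_mono) (auto simp: N_def)
  moreover have "rank N \<le> rank T" by (rule rank_mono) (auto simp: T_def N_def)
  moreover have "rank T' = rank T" using eq by (intro rank_cong) (simp add: solid_eq_def)
  moreover have "pot T' - rank T' - rank ?P - rank ?D = pot T - rank T - rank ?B - rank N"
    unfolding T'_def T_def N_def by simp
  ultimately show "pot T' + 2 \<le> pot T + 3 * (rank T - rank N)" by argo
qed

lemma zig_zag_right:
  fixes l r a b :: "'a vtree" and x p g :: 'a and xs ms gs :: "'a vtree multiset"
  defines "N \<equiv> VNode l x xs r"
  defines "T \<equiv> VNode (VNode a p ms N) g gs b"
  defines "T' \<equiv> VNode (VNode a p ms l) x xs (VNode r g gs b)"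
  shows "solid_eq T' T" "pot T' + 2 \<le> pot T + 3 * (rank T - rank N)"
proof -
  show eq: "solid_eq T' T"
    unfolding T'_def T_def N_def
    by (meson solid_eq_rotate solid_eq_rotate' solid_eq_left solid_eq_trans)
  let ?B = "VNode a p ms N" and ?D = "VNode a p ms l" and ?P = "VNode r g gs b"
  have "rank ?P + rank ?D + 2 \<le> 2 * rank T" by (rule rank_add_le) (auto simp: T_def N_def)
  moreover have "rank N \<le> rank ?B" by (rule rank_mono) (auto simp: N_def)
  moreover have "rank N \<le> rank T" by (rule rank_mono) (auto simp: T_def N_def)
  moreover have "rank T' = rank T" using eq by (intro rank_cong) (simp add: solid_eq_def)
  moreover have "pot T' - rank T' - rank ?P - rank ?D = pot T - rank T - rank ?B - rank N"
    unfolding T'_def T_def N_def by simp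
  ultimately show "pot T' + 2 \<le> pot T + 3 * (rank T - rank N)" by argo
qed

text \<open>A single rotation is not credited with any release, but it ends the splay and so
  accounts for one unpaid step only.\<close>

lemma zig_left:
  fixes l r a :: "'a vtree" and x p :: 'a and xs ms :: "'a vtree multiset"
  defines "N \<equiv> VNode l x xs r"
  defines "T \<equiv> VNode N p ms a"
  defines "T' \<equiv> VNode l x xs (VNode r p ms a)"
  shows "solid_eq T' T" "pot T' \<le> pot T + 3 * (rank T - rank N)"
proof -
  show eq: "solid_eq T' T"
    unfolding T'_def T_def N_def by (rule solid_eq_rotate)
  have "rank (VNode r p ms a) \<le> rank T" by (rule rank_mono) (auto simp: T_def N_def)
  moreover have "rank N \<le> rank T" by (rule rank_mono) (auto simp: T_def N_def)
  moreover have "rank T' = rank T" using eq by (intro rank_cong) (simp add: solid_eq_def)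
  moreover have "pot T' - rank T' - rank (VNode r p ms a) = pot T - rank T - rank N"
    unfolding T'_def T_def N_def by simp
  ultimately show "pot T' \<le> pot T + 3 * (rank T - rank N)" by argo
qed

lemma zig_right:
  fixes l r a :: "'a vtree" and x p :: 'a and xs ms :: "'a vtree multiset"
  defines "N \<equiv> VNode l x xs r"
  defines "T \<equiv> VNode a p ms N"
  defines "T' \<equiv> VNode (VNode a p ms l) x xs r"
  shows "solid_eq T' T" "pot T' \<le> pot T + 3 * (rank T - rank N)"
proof -
  show eq: "solid_eq T' T"
    unfolding T'_def T_def N_def by (rule solid_eq_rotate')
  have "rank (VNode a p ms l) \<le> rank T" by (rule rank_mono) (auto simp: T_def N_def)
  moreover have "rank N \<le> rank T" by (rule rank_mono) (auto simp: T_def N_def)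
  moreover have "rank T' = rank T" using eq by (intro rank_cong) (simp add: solid_eq_def)
  moreover have "pot T' - rank T' - rank (VNode a p ms l) = pot T - rank T - rank N"
    unfolding T'_def T_def N_def by simp
  ultimately show "pot T' \<le> pot T + 3 * (rank T - rank N)" by argo
qed

text \<open>
  The access lemma: \<open>ps\<close> are the ancestors of the node inside its solid subtree; each double
  rotation releases two units of potential.
\<close>

definition splay_spec where
  "splay_spec x xs l r fs l' r' fs' k \<longleftrightarrow> (\<exists>ps. fs = ps @ fs' \<and> (\<forall>f\<in>set ps. solid_frame f) \<and>
     (fs' = [] \<or> \<not> solid_frame (hd fs')) \<and> 1 \<le> k \<and> length ps + 1 \<le> 2 * k \<and>
     solid_eq (VNode l' x xs r') (plug (VNode l x xs r) ps) \<and>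
     pot (VNode l' x xs r') + 2 * (real k - 1) \<le>
       pot (plug (VNode l x xs r) ps) + 3 * (rank (plug (VNode l x xs r) ps) - rank (VNode l x xs r)))"

text \<open>A double rotation removes two frames in one step and the final call at most one, whence
  \<open>length ps + 1 <= 2 * k\<close>; the final call is unpaid, whence \<open>k - 1\<close>.
  Rotations keep the rank of the rotated subtree, so the differences of ranks telescope.\<close>

lemma splay_spec_double:
  assumes "splay_spec x xs l1 r1 fs l' r' fs' k" "solid_frame f" "solid_frame g"
    and "solid_eq (VNode l1 x xs r1) (plug (VNode l x xs r) [f, g])"
    and "pot (VNode l1 x xs r1) + 2 \<le> pot (plug (VNode l x xs r) [f, g]) +
      3 * (rank (plug (VNode l x xs r) [f, g]) - rank (VNode l x xs r))"
  shows "splay_spec x xs l r (f # g # fs) l' r' fs' (Suc k)"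
proof -
  let ?T0 = "plug (VNode l x xs r) [f, g]" and ?T1 = "VNode l1 x xs r1"
  obtain ps where ps: "fs = ps @ fs'" "\<forall>f\<in>set ps. solid_frame f" "fs' = [] \<or> \<not> solid_frame (hd fs')"
    "1 \<le> k" "length ps + 1 \<le> 2 * k" "solid_eq (VNode l' x xs r') (plug ?T1 ps)"
    "pot (VNode l' x xs r') + 2 * (real k - 1) \<le> pot (plug ?T1 ps) + 3 * (rank (plug ?T1 ps) - rank ?T1)"
    using assms(1) unfolding splay_spec_def by blast
  have v: "vertices ?T1 = vertices ?T0" using assms(4) by (simp add: solid_eq_def)
  have plug: "plug (VNode l x xs r) (f # g # ps) = plug ?T0 ps"
    using plug_append[of _ "[f, g]" ps] by simp
  have "rank ?T1 = rank ?T0" "rank (plug ?T1 ps) = rank (plug ?T0 ps)"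
    using rank_cong[OF v] rank_cong[OF vertices_plug_cong[OF v]] by auto
  then show ?thesis
    unfolding splay_spec_def using ps assms(2,3,5) pot_plug[OF v, of ps] plug
      solid_eq_trans[OF ps(6) solid_eq_plug[OF assms(4)]]
    by (intro exI[of _ "f # g # ps"]) auto
qed

lemma splay_spec_single:
  assumes "solid_frame f" "fs' = [] \<or> \<not> solid_frame (hd fs')"
    and "solid_eq (VNode l' x xs r') (plug (VNode l x xs r) [f])"
    and "pot (VNode l' x xs r') \<le> pot (plug (VNode l x xs r) [f]) +
      3 * (rank (plug (VNode l x xs r) [f]) - rank (VNode l x xs r))"
  shows "splay_spec x xs l r (f # fs') l' r' fs' (Suc 0)"
  unfolding splay_spec_def using assms by (intro exI[of _ "[f]"]) auto

lemma splay_spec_zig_left: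
  "fs' = [] \<or> \<not> solid_frame (hd fs') \<Longrightarrow>
    splay_spec x xs l r (FromLeft p ms a # fs') l (VNode r p ms a) fs' (Suc 0)"
  by (rule splay_spec_single) (simp_all only: plug.simps solid_frame.simps simp_thms zig_left)

lemma splay_spec_zig_right:
  "fs' = [] \<or> \<not> solid_frame (hd fs') \<Longrightarrow>
    splay_spec x xs l r (FromRight a p ms # fs') (VNode a p ms l) r fs' (Suc 0)"
  by (rule splay_spec_single) (simp_all only: plug.simps solid_frame.simps simp_thms zig_right)

lemma splay_spec_none:
  assumes "fs = [] \<or> \<not> solid_frame (hd fs)"
  shows "splay_spec x xs l r fs l r fs (Suc 0)"
  unfolding splay_spec_def using assms by (intro exI[of _ "[]"]) auto

text \<open>The node and its middle children, which \<open>splay\<close> never inspects, are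
  arbitrary here; every caller supplies its own.\<close>

lemma splay:
  "splay l r fs = TM (l', r', fs') k \<Longrightarrow> splay_spec x xs l r fs l' r' fs' k"
proof (induction l r fs arbitrary: l' r' fs' k rule: splay.induct)
  case (1 l r p ms a g gs b fs)
  then obtain k' where k': "splay l (VNode r p ms (VNode a g gs b)) fs = TM (l', r', fs') k'" "k = Suc k'"
    by (cases "splay l (VNode r p ms (VNode a g gs b)) fs") (auto simp: tm_simps)
  show ?case unfolding k'(2)
    by (rule splay_spec_double[OF "1.IH"[OF k'(1)]]) (simp_all only: plug.simps solid_frame.simps simp_thms zig_zig_left)
next
  case (2 l r a p ms b g gs fs)
  then obtain k' where k': "splay (VNode (VNode b g gs a) p ms l) r fs = TM (l', r', fs') k'" "k = Suc k'"
    by (cases "splay (VNode (VNode b g gs a) p ms l) r fs") (auto simp: tm_simps)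
  show ?case unfolding k'(2)
    by (rule splay_spec_double[OF "2.IH"[OF k'(1)]]) (simp_all only: plug.simps solid_frame.simps simp_thms zig_zig_right)
next
  case (3 l r p ms a b g gs fs)
  then obtain k' where k': "splay (VNode b g gs l) (VNode r p ms a) fs = TM (l', r', fs') k'" "k = Suc k'"
    by (cases "splay (VNode b g gs l) (VNode r p ms a) fs") (auto simp: tm_simps)
  show ?case unfolding k'(2)
    by (rule splay_spec_double[OF "3.IH"[OF k'(1)]]) (simp_all only: plug.simps solid_frame.simps simp_thms zig_zag_left)
next
  case (4 l r a p ms g gs b fs)
  then obtain k' where k': "splay (VNode a p ms l) (VNode r g gs b) fs = TM (l', r', fs') k'" "k = Suc k'"
    by (cases "splay (VNode a p ms l) (VNode r g gs b) fs") (auto simp: tm_simps)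
  show ?case unfolding k'(2)
    by (rule splay_spec_double[OF "4.IH"[OF k'(1)]]) (simp_all only: plug.simps solid_frame.simps simp_thms zig_zag_right)
qed (auto simp: tm_simps intro!: splay_spec_none splay_spec_zig_left splay_spec_zig_right)

text \<open>Here \<open>t\<close> is the subtree one comes from. Per splice two steps stay unpaid,
  the call itself and the final step of its splay, and each splice leaves one frame in
  \<open>fs2\<close>; the last call adds 1. This deficit is kept explicit so that a later splay
  along \<open>fs2\<close> can pay it.\<close>

lemma splice:
  assumes "splice fs = TM fs2 k" "fs = [] \<or> \<not> solid_frame (hd fs)" "t \<noteq> VLeaf"
  shows "real_eq (plug t fs2) (plug t fs) \<and> (\<forall>f\<in>set fs2. solid_frame f) \<and>
    2 * length fs2 + 1 \<le> k \<and>
    pot (plug t fs2) + 2 * (real k - 2 * length fs2 - 1) \<le>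
      pot (plug t fs) + 3 * (rank (plug t fs) - rank t)"
  using assms
proof (induction fs arbitrary: t fs2 k rule: splice.induct)
  case (1 l w ms r fs)
  obtain l' r' fs' k1 where sp: "splay l r fs = TM (l', r', fs') k1"
    by (metis prod_cases3 tm.exhaust)
  obtain fs'' k2 where sc: "splice fs' = TM fs'' k2" by (meson tm.exhaust)
  have fs2: "fs2 = FromLeft w (add_vtree l' ms) r' # fs''" and k: "k = Suc (k1 + k2)"
    using "1.prems"(1) sp sc by (auto simp: tm_simps)
  let ?N = "VNode l w (add_mset t ms) r"
  let ?T1 = "VNode l' w (add_mset t ms) r'"
  let ?T2 = "VNode t w (add_vtree l' ms) r'"
  obtain ps where ps: "fs = ps @ fs'" "fs' = [] \<or> \<not> solid_frame (hd fs')" "1 \<le> k1"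
    "solid_eq ?T1 (plug ?N ps)"
    "pot ?T1 + 2 * (real k1 - 1) \<le> pot (plug ?N ps) + 3 * (rank (plug ?N ps) - rank ?N)"
    using splay[OF sp, of w "add_mset t ms"] unfolding splay_spec_def by blast
  have top: "plug t (FromMiddle l w ms r # fs) = plug (plug ?N ps) fs'"
    by (simp add: ps(1) plug_append)
  have IH: "real_eq (plug ?T2 fs'') (plug ?T2 fs')" "\<forall>f\<in>set fs''. solid_frame f"
    "2 * length fs'' + 1 \<le> k2" "pot (plug ?T2 fs'') + 2 * (real k2 - 2 * length fs'' - 1) \<le>
      pot (plug ?T2 fs') + 3 * (rank (plug ?T2 fs') - rank ?T2)"
    using "1.IH"[of "(l', r', fs')" l' "(r', fs')" r' fs' fs'' k2 ?T2] sp sc ps(2) by auto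
  have r12: "real_eq ?T2 ?T1" by (rule real_eq_swap[OF "1.prems"(3)])
  have v21: "vertices ?T2 = vertices ?T1" using r12 by (simp add: real_eq_def)
  have v1N: "vertices ?T1 = vertices (plug ?N ps)" using ps(4) by (simp add: solid_eq_def)
  have e1: "real_eq (plug ?T2 fs') (plug ?T1 fs')" using real_eq_plug[OF r12 ps(2)] .
  have e2: "solid_eq (plug ?T1 fs') (plug (plug ?N ps) fs')" using solid_eq_plug[OF ps(4)] .
  have "pot (plug ?T2 fs') = pot (plug ?T1 fs')"
    using pot_plug[OF v21, of fs'] pot_swap[OF "1.prems"(3), of w l' ms r'] by simp
  moreover have "pot (plug ?T1 fs') - pot (plug (plug ?N ps) fs') = pot ?T1 - pot (plug ?N ps)"
    using pot_plug[OF v1N] .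
  moreover have "rank ?T2 = rank (plug ?N ps)" "rank (plug ?T2 fs') = rank (plug (plug ?N ps) fs')"
    using v21 v1N vertices_plug_cong by (metis rank_cong)+
  \<comment> \<open>The link of the telescope: the subtree one comes from hangs below the node
    \<open>?N\<close> whose splay is charged next.\<close>
  moreover have "rank t \<le> rank ?N" by (rule rank_mono) (use "1.prems"(3) in auto)
  ultimately have "pot (plug ?T2 fs'') + 2 * (real k2 - 2 * length fs'' - 1) + 2 * (real k1 - 1) \<le>
      pot (plug (plug ?N ps) fs') + 3 * (rank (plug (plug ?N ps) fs') - rank t)"
    using IH(4) ps(5) by argo
  then show ?case
    unfolding top fs2 k
    using IH(2,3) ps(3) real_eq_trans[OF IH(1) real_eq_trans[OF e1 solid_eq_imp_real_eq[OF e2]]]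
    by auto
qed (auto simp: tm_simps real_eq_def)

section \<open>Dereferencing nodes and the cost of an exposure\<close>

lemma locate_vtree:
  "v \<in># vertices t \<Longrightarrow> \<exists>l ms r fs. t = plug (VNode l v ms r) fs"
proof (induction t)
  case (VNode l p ms r)
  consider "v = p" | "v \<in># vertices l" | "v \<in># vertices r" | t where "t \<in># ms" "v \<in># vertices t"
    using VNode.prems by auto
  then show ?case
  proof cases
    case 1
    then have "VNode l p ms r = plug (VNode l v ms r) []" by simp
    then show ?thesis by blast
  next
    case 2
    then obtain l1 ms1 r1 fs where "l = plug (VNode l1 v ms1 r1) fs" using VNode.IH(1) by blast
    then have "VNode l p ms r = plug (VNode l1 v ms1 r1) (fs @ [FromLeft p ms r])"
      by (simp add: plug_append)
    then show ?thesis by blast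
  next
    case 3
    then obtain l1 ms1 r1 fs where "r = plug (VNode l1 v ms1 r1) fs" using VNode.IH(3) by blast
    then have "VNode l p ms r = plug (VNode l1 v ms1 r1) (fs @ [FromRight l p ms])"
      by (simp add: plug_append)
    then show ?thesis by blast
  next
    case 4
    then obtain l1 ms1 r1 fs where "t = plug (VNode l1 v ms1 r1) fs" using VNode.IH(2) by blast
    then have "VNode l p ms r = plug (VNode l1 v ms1 r1) (fs @ [FromMiddle l p (ms - {#t#}) r])"
      using 4 by (simp add: plug_append)
    then show ?thesis by blast
  qed
qed simp

lemma in_forest_vertices: "v \<in># forest_vertices F \<longleftrightarrow> (\<exists>t\<in>#F. v \<in># vertices t)"
  by (auto simp: forest_vertices_def)

lemma forest_vertices_add [simp]: "forest_vertices (add_mset t F) = vertices t + forest_vertices F"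
  by (simp add: forest_vertices_def)

lemma forest_edges_add [simp]: "forest_edges (add_mset t F) = edges t \<union> forest_edges F"
  by (simp add: forest_edges_def)

lemma locate:
  assumes "v \<in># forest_vertices F"
  obtains l ms r fs G where "locate v F = (l, ms, r, fs, G)" "F = add_mset (plug (VNode l v ms r) fs) G"
proof -
  obtain t where t: "t \<in># F" "v \<in># vertices t" using assms in_forest_vertices by metis
  then obtain l ms r fs where "t = plug (VNode l v ms r) fs" using locate_vtree by metis
  then have "F = add_mset (plug (VNode l v ms r) fs) (F - {#t#})" using t by simp
  then have "case (l, ms, r, fs, F - {#t#}) of (l, ms, r, fs, G) \<Rightarrow> F = add_mset (plug (VNode l v ms r) fs) G"
    by simp
  then have "case locate v F of (l, ms, r, fs, G) \<Rightarrow> F = add_mset (plug (VNode l v ms r) fs) G"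
    unfolding locate_def by (rule someI)
  then show thesis using that by (cases "locate v F") auto
qed

text \<open>For a virtual root the choice in \<open>locate\<close> is determined. Another
  decomposition would place \<open>v\<close> in a second tree or strictly below the root, and either
  would be a second occurrence.\<close>

lemma locate_root:
  assumes F: "F = add_mset (VNode l v ms r) G" and count: "count (forest_vertices F) v \<le> 1"
  shows "locate v F = (l, ms, r, [], G)"
proof -
  have "v \<in># forest_vertices F" using F by simp
  then obtain l' ms' r' fs G' where loc: "locate v F = (l', ms', r', fs, G')"
    "F = add_mset (plug (VNode l' v ms' r') fs) G'" by (rule locate)
  let ?N = "VNode l v ms r" and ?N' = "VNode l' v ms' r'"
  have in_plug: "v \<in># vertices (plug ?N' fs)"
    using mset_subset_eqD[OF vertices_plug_sub, of v ?N' fs] by simp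
  have "plug ?N' fs = ?N"
  proof (rule ccontr)
    assume "plug ?N' fs \<noteq> ?N"
    then have "plug ?N' fs \<in># G" using F loc(2) by (metis insert_noteq_member)
    then have "v \<in># forest_vertices G" using in_plug in_forest_vertices by metis
    then have "1 \<le> count (forest_vertices G) v"
      by (metis One_nat_def Suc_leI count_greater_zero_iff)
    moreover have "1 + count (forest_vertices G) v \<le> count (forest_vertices F) v" using F by simp
    ultimately show False using count by linarith
  qed
  moreover have "fs = []"
  proof (cases fs rule: rev_cases)
    case (snoc fs' f)
    let ?s = "plug ?N' fs'"
    have "v \<in># vertices ?s"
      using mset_subset_eqD[OF vertices_plug_sub, of v ?N' fs'] by simp
    then have "1 \<le> count (vertices ?s) v"
      by (metis One_nat_def Suc_leI count_greater_zero_iff)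
    moreover have "plug ?s [f] = ?N"
      using \<open>plug ?N' fs = ?N\<close> snoc by (simp add: plug_append)
    then have "count (vertices (plug ?s [f])) v \<ge> count (vertices ?s) v + 1"
      by (cases f) auto
    moreover have "count (vertices (plug ?s [f])) v \<le> 1"
      using count F \<open>plug ?s [f] = ?N\<close> by simp
    ultimately have False by linarith
    then show ?thesis ..
  qed simp
  ultimately show ?thesis using loc F by simp
qed

text \<open>The factor 18 is 3 * (3 + 3): the first splay and the splices telescope to one
  difference of ranks with factor 3, the last splay adds another, and the potential is taken three
  times. The additive 6 absorbs the step of \<open>expose\<close> and the unpaid ends of its three
  passes.\<close>

lemma expose_vtree:
  assumes loc: "locate v F = (l, ms, r, fs, G)"
  shows "\<exists>ms' r' k. expose v F = TM (add_mset (VNode VLeaf v ms' r') G) k \<and>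
    real_eq (VNode VLeaf v ms' r') (plug (VNode l v ms r) fs) \<and>
    real k + 3 * pot (VNode VLeaf v ms' r') \<le>
      3 * pot (plug (VNode l v ms r) fs) + 18 * rank (plug (VNode l v ms r) fs) + 6"
proof -
  let ?N = "VNode l v ms r"
  obtain l1 r1 fs1 k1 where s1: "splay l r fs = TM (l1, r1, fs1) k1"
    by (metis prod_cases3 tm.exhaust)
  obtain fs2 k2 where s2: "splice fs1 = TM fs2 k2" by (meson tm.exhaust)
  obtain l3 r3 fs3 k3 where s3: "splay l1 r1 fs2 = TM (l3, r3, fs3) k3"
    by (metis prod_cases3 tm.exhaust)
  let ?N1 = "VNode l1 v ms r1" and ?N3 = "VNode l3 v ms r3"
  let ?N4 = "VNode VLeaf v (add_vtree l3 ms) r3"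
  obtain ps where ps: "fs = ps @ fs1" "fs1 = [] \<or> \<not> solid_frame (hd fs1)" "1 \<le> k1"
    "solid_eq ?N1 (plug ?N ps)"
    "pot ?N1 + 2 * (real k1 - 1) \<le> pot (plug ?N ps) + 3 * (rank (plug ?N ps) - rank ?N)"
    using splay[OF s1, of v ms] unfolding splay_spec_def by blast
  have sp: "real_eq (plug ?N1 fs2) (plug ?N1 fs1)" "\<forall>f\<in>set fs2. solid_frame f"
    "2 * length fs2 + 1 \<le> k2"
    "pot (plug ?N1 fs2) + 2 * (real k2 - 2 * length fs2 - 1) \<le>
      pot (plug ?N1 fs1) + 3 * (rank (plug ?N1 fs1) - rank ?N1)"
    using splice[OF s2 ps(2), of ?N1] by auto
  obtain qs where qs: "fs2 = qs @ fs3" "fs3 = [] \<or> \<not> solid_frame (hd fs3)" "1 \<le> k3"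
    "length qs + 1 \<le> 2 * k3" "solid_eq ?N3 (plug ?N1 qs)"
    "pot ?N3 + 2 * (real k3 - 1) \<le> pot (plug ?N1 qs) + 3 * (rank (plug ?N1 qs) - rank ?N1)"
    using splay[OF s3, of v ms] unfolding splay_spec_def by blast
  \<comment> \<open>Splicing leaves solid frames only, and a splay stops short of the top only at a
    dashed edge.\<close>
  have fs3: "fs3 = []"
    using qs(1,2) sp(2) by (cases fs3) auto
  then have "qs = fs2" using qs(1) by simp
  note qs = qs[unfolded this]
  have top: "plug ?N fs = plug (plug ?N ps) fs1" by (simp add: ps(1) plug_append)
  have v1: "vertices ?N1 = vertices (plug ?N ps)" using ps(4) by (simp add: solid_eq_def)
  have eq1: "solid_eq (plug ?N1 fs1) (plug ?N fs)"
    unfolding top by (rule solid_eq_plug[OF ps(4)])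
  have "real_eq ?N4 ?N3" by (rule real_eq_drop_left)
  then have eq: "real_eq ?N4 (plug ?N fs)"
    using real_eq_trans solid_eq_imp_real_eq[OF qs(5)] sp(1) solid_eq_imp_real_eq[OF eq1] by blast
  have "pot (plug ?N1 fs1) - pot (plug ?N fs) = pot ?N1 - pot (plug ?N ps)"
    unfolding top by (rule pot_plug[OF v1])
  moreover have "rank ?N1 = rank (plug ?N ps)" "rank (plug ?N1 fs1) = rank (plug ?N fs)"
    "rank (plug ?N1 fs2) = rank (plug ?N1 fs1)"
    using rank_cong[OF v1] rank_cong[of "plug ?N1 fs1" "plug ?N fs"] eq1
      rank_cong[of "plug ?N1 fs2" "plug ?N1 fs1"] sp(1) by (auto simp: solid_eq_def real_eq_def)
  moreover have "pot ?N4 = pot ?N3" by (rule pot_drop_left)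
  moreover have "0 \<le> rank ?N" "0 \<le> rank ?N1" by (rule rank_nonneg)+
  \<comment> \<open>The \<open>2 * length fs2\<close> unpaid steps of the splices are at most
    \<open>4 * k3 - 2\<close>. Together with the \<open>k3\<close> steps of the last splay they stay
    within the released \<open>6 * (k3 - 1)\<close> up to a constant.\<close>
  moreover have "real (2 * length fs2 + 1) \<le> real k2" "real (length fs2 + 1) \<le> real (2 * k3)"
    "1 \<le> real k1" "1 \<le> real k3"
    using sp(3) qs(3,4) ps(3) by linarith+
  ultimately have "real (1 + k1 + k2 + k3) + 3 * pot ?N4 \<le> 3 * pot (plug ?N fs) + 18 * rank (plug ?N fs) + 6"
    using ps(5) sp(4) qs(6) unfolding right_diff_distrib distrib_left of_nat_add of_nat_mult by linarith
  moreover have "expose v F = TM (add_mset ?N4 G) (1 + k1 + k2 + k3)"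
    using loc s1 s2 s3 fs3 by (simp add: expose_def tm_simps)
  ultimately show ?thesis using eq by blast
qed

text \<open>Whichever decomposition \<open>locate\<close> yields, the answer is the same: the splay
  reaches the virtual root exactly if there is no dashed edge above the node. The factor 9 is that
  of one splay, 3 times 3.\<close>

lemma on_root_path:
  assumes "v \<in># forest_vertices F" "\<And>x. count (forest_vertices F) x \<le> 1"
  shows "\<exists>t t' G k. F = add_mset t G \<and> v \<in># vertices t \<and>
    on_root_path v F = TM (v \<in> set (solid_path t), add_mset t' G) k \<and> solid_eq t' t \<and>
    (v \<in> set (solid_path t) \<longrightarrow> (\<exists>l ms r. t' = VNode l v ms r)) \<and>
    real k + 3 * pot t' \<le> 3 * pot t + 9 * rank t + 2"
proof -
  obtain l ms r fs G where loc: "locate v F = (l, ms, r, fs, G)" "F = add_mset (plug (VNode l v ms r) fs) G"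
    using assms(1) by (rule locate)
  obtain l' r' fs' k where s: "splay l r fs = TM (l', r', fs') k"
    by (metis prod_cases3 tm.exhaust)
  let ?N = "VNode l v ms r" and ?N' = "VNode l' v ms r'"
  obtain ps where ps: "fs = ps @ fs'" "fs' = [] \<or> \<not> solid_frame (hd fs')" "1 \<le> k"
    "solid_eq ?N' (plug ?N ps)"
    "pot ?N' + 2 * (real k - 1) \<le> pot (plug ?N ps) + 3 * (rank (plug ?N ps) - rank ?N)"
    using splay[OF s, of v ms] unfolding splay_spec_def by blast
  have top: "plug ?N fs = plug (plug ?N ps) fs'" by (simp add: ps(1) plug_append)
  have eq: "solid_eq (plug ?N' fs') (plug ?N fs)"
    unfolding top by (rule solid_eq_plug[OF ps(4)])
  have v': "vertices ?N' = vertices (plug ?N ps)" using ps(4) by (simp add: solid_eq_def)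
  have mem: "fs' = [] \<longleftrightarrow> v \<in> set (solid_path (plug ?N fs))"
  proof (cases fs')
    case Nil
    then have "solid_path (plug ?N fs) = solid_path ?N'" using eq by (simp add: solid_eq_def)
    then show ?thesis using Nil by simp
  next
    case (Cons f gs)
    have "count (vertices (plug ?N' fs')) v \<le> 1"
      using assms(2)[of v] loc(2) eq by (simp add: solid_eq_def)
    then have "v \<notin> set (solid_path (plug ?N' fs'))"
      using middle_not_on_solid_path[of v ?N' f gs] ps(2) Cons by simp
    then show ?thesis using eq Cons by (simp add: solid_eq_def)
  qed
  have "pot (plug ?N' fs') - pot (plug ?N fs) = pot ?N' - pot (plug ?N ps)"
    unfolding top by (rule pot_plug[OF v'])
  moreover have "rank (plug ?N ps) \<le> rank (plug ?N fs)"
    unfolding top by (intro rank_plug plug_neq_VLeaf) simp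
  moreover have "0 \<le> rank ?N" by (rule rank_nonneg)
  ultimately have "real (1 + k) + 3 * pot (plug ?N' fs') \<le> 3 * pot (plug ?N fs) + 9 * rank (plug ?N fs) + 2"
    using ps(3,5) by (simp add: algebra_simps)
  moreover have "on_root_path v F = TM (v \<in> set (solid_path (plug ?N fs)), add_mset (plug ?N' fs') G) (1 + k)"
    using loc(1) s mem by (simp add: on_root_path_def tm_simps)
  moreover have "v \<in># vertices (plug ?N fs)"
    using mset_subset_eqD[OF vertices_plug_sub, of v ?N fs] by simp
  moreover have "\<exists>l ms r. plug ?N' fs' = VNode l v ms r" if "v \<in> set (solid_path (plug ?N fs))"
    using mem that by simp
  ultimately show ?thesis using loc(2) eq by blast
qed

text \<open>The walk takes one step per new frame and a final one; \<open>ps\<close> are the frames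
  over which a splay of the node found has to return.\<close>

lemma last_node:
  "last_node l v ms r fs = TM (c, w, ws, gs) k \<Longrightarrow>
    \<exists>ps. gs = ps @ fs \<and> (\<forall>f\<in>set ps. solid_frame f) \<and> length ps + 1 = k \<and>
      plug (VNode c w ws VLeaf) ps = VNode l v ms r \<and> w = last (solid_path (VNode l v ms r))"
proof (induction l v ms r fs arbitrary: c w ws gs k rule: last_node.induct)
  case (1 l v ms fs)
  then show ?case by (auto simp: tm_simps)
next
  case (2 l v ms l' v' ms' r' fs)
  obtain k' where k': "last_node l' v' ms' r' (FromRight l v ms # fs) = TM (c, w, ws, gs) k'" "k = Suc k'"
    using "2.prems" by (cases "last_node l' v' ms' r' (FromRight l v ms # fs)") (auto simp: tm_simps)
  obtain ps where "gs = ps @ FromRight l v ms # fs" "\<forall>f\<in>set ps. solid_frame f" "length ps + 1 = k'"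
    "plug (VNode c w ws VLeaf) ps = VNode l' v' ms' r'" "w = last (solid_path (VNode l' v' ms' r'))"
    using "2.IH"[OF k'(1)] by blast
  then show ?case using k'(2)
    by (intro exI[of _ "ps @ [FromRight l v ms]"]) (auto simp: plug_append)
qed

text \<open>The walk down is not paid by any potential of its own. The splay of the node found
  passes the same number of frames, two at a time, and releases enough for both.\<close>

lemma before:
  assumes F: "F = add_mset (VNode l v ms r) G" and "count (forest_vertices F) v \<le> 1" and "l \<noteq> VLeaf"
  shows "\<exists>t' k. before v F = TM (Some (last (solid_path l)), add_mset t' G) k \<and>
    solid_eq t' (VNode l v ms r) \<and>
    real k + 3 * pot t' \<le> 3 * pot (VNode l v ms r) + 9 * rank (VNode l v ms r) + 4"
proof -
  obtain a u us b where l: "l = VNode a u us b" using assms(3) by (cases l) auto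
  have loc: "locate v F = (l, ms, r, [], G)" using locate_root[OF F assms(2)] .
  obtain c w ws gs k1 where ln: "last_node a u us b [FromLeft v ms r] = TM (c, w, ws, gs) k1"
    by (metis prod_cases4 tm.exhaust)
  obtain c' d' gs' k2 where sp: "splay c VLeaf gs = TM (c', d', gs') k2"
    by (metis prod_cases3 tm.exhaust)
  let ?N = "VNode c w ws VLeaf" and ?N' = "VNode c' w ws d'"
  obtain ps where ps: "gs = ps @ [FromLeft v ms r]" "\<forall>f\<in>set ps. solid_frame f" "length ps + 1 = k1"
    "plug ?N ps = l" "w = last (solid_path l)"
    using last_node[OF ln] l by blast
  obtain qs where qs: "gs = qs @ gs'" "gs' = [] \<or> \<not> solid_frame (hd gs')" "1 \<le> k2"
    "length qs + 1 \<le> 2 * k2" "solid_eq ?N' (plug ?N qs)"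
    "pot ?N' + 2 * (real k2 - 1) \<le> pot (plug ?N qs) + 3 * (rank (plug ?N qs) - rank ?N)"
    using splay[OF sp, of w ws] unfolding splay_spec_def by blast
  \<comment> \<open>The walk stays within the solid subtree of the virtual root \<open>v\<close>, so
    the splay ends at the top.\<close>
  have "\<forall>f\<in>set gs. solid_frame f" using ps(1,2) by simp
  then have gs': "gs' = []" using qs(1,2) by (cases gs') auto
  have plug: "plug ?N gs = VNode l v ms r" using ps(1,4) by (simp add: plug_append)
  have gs_eq: "gs = qs" using qs(1) gs' by simp
  have "before v F = TM (Some w, add_mset ?N' G) (1 + (1 + (k1 + k2)))"
    using loc l ln sp gs' by (simp add: before_def tm_simps)
  moreover have "real k1 = real (length qs)" "real (length qs + 1) \<le> real (2 * k2)" "real 1 \<le> real k2"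
    using ps(1,3) gs_eq qs(3,4) by (simp_all only: of_nat_le_iff) simp
  then have "real (1 + (1 + (k1 + k2))) + 3 * pot ?N' \<le> 3 * pot (VNode l v ms r) + 9 * rank (VNode l v ms r) + 4"
    using qs(6)[folded gs_eq, unfolded plug] rank_nonneg[of ?N]
    unfolding right_diff_distrib distrib_left of_nat_add of_nat_mult by linarith
  ultimately show ?thesis using ps(5) qs(5)[folded gs_eq, unfolded plug] by auto
qed


subsection \<open>Representing a forest\<close>

definition fpot :: "'a forest \<Rightarrow> real" where
  "fpot F = \<Sum>\<^sub># (image_mset pot F)"

lemma fpot_add [simp]: "fpot (add_mset t F) = pot t + fpot F"
  by (simp add: fpot_def)

lemma fpot_nonneg: "0 \<le> fpot F"
  unfolding fpot_def by (rule sum_mset_image_nonneg) (rule pot_nonneg)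

definition wf_forest :: "'a forest \<Rightarrow> bool" where
  "wf_forest F \<longleftrightarrow> (\<forall>t\<in>#F. t \<noteq> VLeaf \<and> wf_vtree t)"

lemma wf_forest_add [simp]:
  "wf_forest (add_mset t F) \<longleftrightarrow> t \<noteq> VLeaf \<and> wf_vtree t \<and> wf_forest F"
  by (auto simp: wf_forest_def)

text \<open>The equation with \<open>mset_set V\<close> also says that every vertex occurs once.
  Finiteness is demanded since \<open>mset_set\<close> of an infinite set is empty.\<close>

definition represents :: "'a set \<Rightarrow> ('a \<times> 'a) set \<Rightarrow> 'a forest \<Rightarrow> bool" where
  "represents V E F \<longleftrightarrow> finite V \<and> wf_forest F \<and> forest_vertices F = mset_set V \<and> forest_edges F = E"

lemma represents_count: "represents V E F \<Longrightarrow> count (forest_vertices F) x \<le> 1"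
  by (cases "x \<in> V") (auto simp: represents_def)

lemma represents_mem: "represents V E F \<Longrightarrow> v \<in># forest_vertices F \<longleftrightarrow> v \<in> V"
  by (simp add: represents_def)

lemma represents_cong:
  assumes "represents V E (add_mset t G)" "real_eq t' t"
  shows "represents V E (add_mset t' G)"
  using assms by (auto simp: represents_def real_eq_def)

lemma represents_rank:
  assumes "represents V E (add_mset t G)"
  shows "rank t \<le> log 2 (card V)"
proof -
  have "size (vertices t) + size (forest_vertices G) = card V"
    using assms unfolding represents_def by (metis forest_vertices_add size_mset_set size_union)
  then have "size (vertices t) \<le> card V" by linarith
  moreover have "0 < size (vertices t)" using assms by (cases t) (auto simp: represents_def)
  ultimately show ?thesis unfolding rank_def by (subst log_le_cancel_iff) auto
qed

lemma represents_subset: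
  assumes "represents V E (add_mset t G)" "x \<in># vertices t"
  shows "x \<in> V"
  using assms by (metis forest_vertices_add represents_mem union_iff)

text \<open>The last conjunct serves \<open>link\<close>, where the second exposure must leave the
  tree of the node exposed first as it is.\<close>

lemma expose:
  assumes "represents V E F" "v \<in> V"
  shows "\<exists>ms r G k. expose v F = TM (add_mset (VNode VLeaf v ms r) G) k \<and>
    represents V E (add_mset (VNode VLeaf v ms r) G) \<and>
    real k + 3 * fpot (add_mset (VNode VLeaf v ms r) G) \<le> 3 * fpot F + (18 * log 2 (card V) + 6) \<and>
    (\<forall>t\<in>#F. v \<notin># vertices t \<longrightarrow> t \<in># G)"
proof -
  obtain l ms r fs G where loc: "locate v F = (l, ms, r, fs, G)" "F = add_mset (plug (VNode l v ms r) fs) G"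
    using assms represents_mem locate by metis
  let ?T = "plug (VNode l v ms r) fs"
  obtain ms' r' k where e: "expose v F = TM (add_mset (VNode VLeaf v ms' r') G) k"
    "real_eq (VNode VLeaf v ms' r') ?T"
    "real k + 3 * pot (VNode VLeaf v ms' r') \<le> 3 * pot ?T + 18 * rank ?T + 6"
    using expose_vtree[OF loc(1)] by blast
  have "v \<in># vertices ?T"
    using mset_subset_eqD[OF vertices_plug_sub, of v "VNode l v ms r" fs] by simp
  then have "\<forall>t\<in>#F. v \<notin># vertices t \<longrightarrow> t \<in># G" using loc(2) by auto
  moreover have "rank ?T \<le> log 2 (card V)" using represents_rank assms(1) loc(2) by blast
  then have "real k + 3 * fpot (add_mset (VNode VLeaf v ms' r') G) \<le> 3 * fpot F + (18 * log 2 (card V) + 6)"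
    using e(3) unfolding loc(2) fpot_add distrib_left by linarith
  ultimately show ?thesis using e(1) represents_cong[OF _ e(2)] assms(1) loc(2) by blast
qed

text \<open>After its exposure the real root \<open>v\<close> has no right subtree. All nodes of its
  tree reach \<open>v\<close>, so \<open>w\<close> is in another tree and stays apart from it. The
  constants are those of two exposures, plus one step and three times the rank that \<open>w\<close>
  may gain with its new middle child.\<close>

lemma link:
  assumes rep: "represents V E F" and vw: "v \<in> V" "w \<in> V"
    and root: "\<And>x. (v, x) \<notin> E" and "(w, v) \<notin> E\<^sup>*"
  shows "\<exists>F' k. link v w F = TM F' k \<and> represents V (insert (v, w) E) F' \<and>
    real k + 3 * fpot F' \<le> 3 * fpot F + (39 * log 2 (card V) + 13)"
proof -
  obtain ms r G k1 where e1: "expose v F = TM (add_mset (VNode VLeaf v ms r) G) k1"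
    "represents V E (add_mset (VNode VLeaf v ms r) G)"
    "real k1 + 3 * fpot (add_mset (VNode VLeaf v ms r) G) \<le> 3 * fpot F + (18 * log 2 (card V) + 6)"
    using expose[OF rep vw(1)] by blast
  have r: "r = VLeaf"
  proof (rule ccontr)
    assume "r \<noteq> VLeaf"
    then have "(v, hd (solid_path r)) \<in> edges (VNode VLeaf v ms r)" by simp
    moreover have "E = edges (VNode VLeaf v ms r) \<union> forest_edges G"
      using e1(2) by (simp only: represents_def forest_edges_add)
    ultimately show False using root by blast
  qed
  let ?Nv = "VNode VLeaf v ms VLeaf"
  note e1 = e1[unfolded r]
  have wNv: "w \<notin># vertices ?Nv"
  proof
    assume "w \<in># vertices ?Nv"
    moreover have "wf_vtree ?Nv" "edges ?Nv \<subseteq> E" using e1(2) by (auto simp: represents_def)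
    ultimately have "(w, v) \<in> E\<^sup>*"
      using reach_last[of ?Nv w] rtrancl_mono[of "edges ?Nv" E] by auto
    then show False using assms(5) by blast
  qed
  obtain ms' r' G' k2 where e2: "expose w (add_mset ?Nv G) = TM (add_mset (VNode VLeaf w ms' r') G') k2"
    "represents V E (add_mset (VNode VLeaf w ms' r') G')"
    "real k2 + 3 * fpot (add_mset (VNode VLeaf w ms' r') G') \<le> 3 * fpot (add_mset ?Nv G) + (18 * log 2 (card V) + 6)"
    "?Nv \<in># G'"
    using expose[OF e1(2) vw(2)] wNv by fastforce
  let ?Nw = "VNode VLeaf w ms' r'"
  define H where "H = G' - {#?Nv#}"
  have G': "G' = add_mset ?Nv H" using e2(4) by (simp add: H_def)
  note e2 = e2[unfolded G']
  \<comment> \<open>Both nodes are virtual roots at this point, so \<open>locate\<close> has no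
    choice left.\<close>
  have l1: "locate v (add_mset ?Nw (add_mset ?Nv H)) = (VLeaf, ms, VLeaf, [], add_mset ?Nw H)"
    by (rule locate_root[OF add_mset_commute represents_count[OF e2(2)]])
  have "count (forest_vertices (add_mset ?Nw H)) w \<le> count (forest_vertices (add_mset ?Nw (add_mset ?Nv H))) w"
    by simp
  then have "count (forest_vertices (add_mset ?Nw H)) w \<le> 1"
    using represents_count[OF e2(2), of w] by linarith
  then have l2: "locate w (add_mset ?Nw H) = (VLeaf, ms', r', [], H)"
    by (intro locate_root) auto
  let ?N = "VNode VLeaf w (add_mset ?Nv ms') r'"
  have "link v w F = TM (add_mset ?N H) (Suc (k1 + k2))"
    using e1(1) e2(1) l1 l2 by (simp add: link_def tm_simps)
  moreover have rep': "represents V (insert (v, w) E) (add_mset ?N H)"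
  proof -
    have "vertices ?N = vertices ?Nw + vertices ?Nv" by (simp add: ac_simps)
    then have "forest_vertices (add_mset ?N H) = forest_vertices (add_mset ?Nw (add_mset ?Nv H))"
      by (simp only: forest_vertices_add add.assoc)
    moreover have link_edges: "{(last (solid_path t), w) |t. t \<in># add_mset s ms'} =
      insert (last (solid_path s), w) {(last (solid_path t), w) |t. t \<in># ms'}" for s by auto
    have "edges ?N = insert (v, w) (edges ?Nw \<union> edges ?Nv)"
      unfolding edges.simps(2)[of VLeaf w "add_mset ?Nv ms'" r'] edges.simps(2)[of VLeaf w ms' r']
        link_edges by auto
    then have "forest_edges (add_mset ?N H) = insert (v, w) (forest_edges (add_mset ?Nw (add_mset ?Nv H)))"
      by (simp only: forest_edges_add) blast
    moreover have "wf_forest (add_mset ?N H)"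
      using e2(2) by (simp add: represents_def)
    ultimately show ?thesis using e2(2) unfolding represents_def by metis
  qed
  moreover have "rank ?N \<le> log 2 (card V)"
    using represents_rank[OF rep'] .
  moreover have "pot ?N - rank ?N = pot ?Nw - rank ?Nw + pot ?Nv" by simp
  moreover have "0 \<le> rank ?Nw" by (rule rank_nonneg)
  ultimately show ?thesis
  proof (intro exI conjI)
    show "real (Suc (k1 + k2)) + 3 * fpot (add_mset ?N H) \<le> 3 * fpot F + (39 * log 2 (card V) + 13)"
      using e1(3) e2(3) \<open>rank ?N \<le> log 2 (card V)\<close> \<open>pot ?N - rank ?N = pot ?Nw - rank ?Nw + pot ?Nv\<close>
        \<open>0 \<le> rank ?Nw\<close>
      unfolding fpot_add distrib_left of_nat_Suc of_nat_add by linarith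
  qed
qed

text \<open>The only edge leaving \<open>v\<close> goes to the head of the right solid path. Every
  other edge starts in a subtree, where \<open>v\<close> does not occur again, or at the top of
  one.\<close>

lemma edges_root_minus:
  assumes "wf_vtree (VNode l v ms r)" "count (vertices (VNode l v ms r)) v \<le> 1"
  shows "{(x, y) \<in> edges (VNode l v ms r). x \<noteq> v} = edges (VNode l v ms VLeaf) \<union> edges r"
proof -
  have nv: "v \<notin># vertices l" "v \<notin># vertices r" "\<And>t. t \<in># ms \<Longrightarrow> v \<notin># vertices t"
  proof -
    have "v \<notin># vertices l + vertices r + \<Sum>\<^sub># (image_mset vertices ms)"
      using assms(2) unfolding not_in_iff by simp
    then show "v \<notin># vertices l" "v \<notin># vertices r" "\<And>t. t \<in># ms \<Longrightarrow> v \<notin># vertices t" by auto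
  qed
  have wf: "wf_vtree l" "wf_vtree r" "\<And>t. t \<in># ms \<Longrightarrow> wf_vtree t \<and> t \<noteq> VLeaf"
    using assms(1) by auto
  have "(v, y) \<notin> edges l" "(v, y) \<notin> edges r" for y
    using edges_vertices[OF wf(1), of v y] edges_vertices[OF wf(2), of v y] nv(1,2) by blast+
  moreover have "(v, y) \<notin> edges t" "last (solid_path t) \<noteq> v" if "t \<in># ms" for y t
    using nv(3)[OF that] wf(3)[OF that] edges_vertices[of t v y] last_solid_path[of t] by auto
  moreover have "last (solid_path l) \<noteq> v" if "l \<noteq> VLeaf"
    using nv(1) last_solid_path[OF that] by auto
  ultimately show ?thesis
    by (cases "l = VLeaf"; cases "r = VLeaf"; simp; blast)
qed

text \<open>If \<open>v\<close> is a real root, its right subtree is empty after the exposure and no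
  edge is lost, so a missing parent is covered by the same statement. Ranks can only fall, hence the
  cost exceeds that of an exposure by one step.\<close>

lemma cut:
  assumes rep: "represents V E F" and v: "v \<in> V"
  shows "\<exists>F' k. cut v F = TM F' k \<and> represents V {(x, y) \<in> E. x \<noteq> v} F' \<and>
    real k + 3 * fpot F' \<le> 3 * fpot F + (18 * log 2 (card V) + 7)"
proof -
  obtain ms r G k1 where e1: "expose v F = TM (add_mset (VNode VLeaf v ms r) G) k1"
    "represents V E (add_mset (VNode VLeaf v ms r) G)"
    "real k1 + 3 * fpot (add_mset (VNode VLeaf v ms r) G) \<le> 3 * fpot F + (18 * log 2 (card V) + 6)"
    using expose[OF rep v] by blast
  let ?N = "VNode VLeaf v ms r" and ?N' = "VNode VLeaf v ms VLeaf"
  let ?F = "add_mset ?N' (add_vtree r G)"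
  have loc: "locate v (add_mset ?N G) = (VLeaf, ms, r, [], G)"
    by (rule locate_root[OF refl represents_count[OF e1(2)]])
  have c: "count (vertices ?N) v + count (forest_vertices G) v \<le> 1"
    using represents_count[OF e1(2), of v] by simp
  have "1 \<le> count (vertices ?N) v" by simp
  then have cG: "count (forest_vertices G) v = 0" using c by linarith
  have G: "(v, y) \<notin> forest_edges G" for y
  proof
    assume "(v, y) \<in> forest_edges G"
    then obtain t where "t \<in># G" "(v, y) \<in> edges t" by (auto simp: forest_edges_def)
    moreover have "wf_vtree t" using e1(2) \<open>t \<in># G\<close> by (auto simp: represents_def wf_forest_def)
    ultimately have "v \<in># forest_vertices G" using edges_vertices in_forest_vertices by metis
    then show False using cG by (simp add: count_eq_zero_iff)
  qed
  have E: "E = edges ?N \<union> forest_edges G" using e1(2) by (simp only: represents_def forest_edges_add)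
  have wfN: "wf_vtree ?N" using e1(2) by (simp only: represents_def wf_forest_add)
  have cN: "count (vertices ?N) v \<le> 1" using c by linarith
  have "{(x, y) \<in> E. x \<noteq> v} = {(x, y) \<in> edges ?N. x \<noteq> v} \<union> forest_edges G"
    unfolding E using G by blast
  also have "\<dots> = forest_edges ?F"
    unfolding edges_root_minus[OF wfN cN] by (auto simp: add_vtree_def)
  finally have "represents V {(x, y) \<in> E. x \<noteq> v} ?F"
    using e1(2) by (auto simp: represents_def add_vtree_def ac_simps)
  moreover have "cut v F = TM ?F (Suc k1)"
    using e1(1) loc by (simp add: cut_def tm_simps)
  moreover have "real (Suc k1) + 3 * fpot ?F \<le> 3 * fpot F + (18 * log 2 (card V) + 7)"
  proof -
    have "rank ?N' \<le> rank ?N" by (rule rank_mono) auto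
    moreover have "pot ?N - rank ?N = pot ?N' - rank ?N' + pot r" by simp
    moreover have "fpot ?F = pot ?N' + pot r + fpot G" by (simp add: add_vtree_def)
    ultimately show ?thesis using e1(3) unfolding fpot_add distrib_left of_nat_Suc by linarith
  qed
  ultimately show ?thesis by blast
qed

lemma new_node:
  assumes "represents V E F" "v \<notin> V"
  shows "\<exists>F' k. new_node v F = TM F' k \<and> represents (insert v V) E F' \<and>
    real k + 3 * fpot F' \<le> 3 * fpot F + 1"
  using assms by (auto simp: new_node_def tm_simps represents_def rank_def)

text \<open>Isolation guarantees that the tree of \<open>v\<close> is literally the singleton being
  subtracted; its rank is the logarithm of 1.\<close>

lemma free_node:
  assumes rep: "represents V E F" and v: "v \<in> V" and isolated: "\<And>x. (x, v) \<notin> E" "\<And>x. (v, x) \<notin> E"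
  shows "\<exists>F' k. free_node v F = TM F' k \<and> represents (V - {v}) E F' \<and>
    real k + 3 * fpot F' \<le> 3 * fpot F + 1"
proof -
  let ?N = "VNode VLeaf v {#} VLeaf"
  obtain t where t: "t \<in># F" "v \<in># vertices t"
    using represents_mem[OF rep] v in_forest_vertices by metis
  moreover have "edges t \<subseteq> E" using t(1) rep by (auto simp: represents_def forest_edges_def)
  moreover have "wf_vtree t" using t(1) rep by (auto simp: represents_def wf_forest_def)
  ultimately have "t = ?N" using isolated_vtree[of t v] isolated by blast
  then obtain G where F: "F = add_mset ?N G" using t(1) by (metis insert_DiffM)
  have "add_mset v (forest_vertices G) = mset_set V" using rep F by (simp add: represents_def)
  then have "forest_vertices G = mset_set (V - {v})"
    using v rep by (metis add_mset_remove_trivial mset_set_Diff singleton_iff represents_def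
      empty_subsetI insert_subset mset_set.insert mset_set.empty finite.emptyI empty_iff)
  then have "represents (V - {v}) E G"
    using rep F by (simp add: represents_def)
  then show ?thesis using F by (simp add: free_node_def tm_simps rank_def)
qed

text \<open>Each virtual tree thus exhibits a real root, which later lets the number of trees be
  determined from the parent function.\<close>

lemma represents_root:
  assumes "represents V E F" "t \<in># F"
  shows "last (solid_path t) \<in> V" "(last (solid_path t), y) \<notin> E"
proof -
  obtain G where F: "F = add_mset t G" using assms(2) by (metis insert_DiffM)
  have wf: "t \<noteq> VLeaf" "wf_vtree t" using assms by (auto simp: represents_def wf_forest_def)
  let ?x = "last (solid_path t)"
  have x: "?x \<in># vertices t" using last_solid_path[OF wf(1)] .
  show "?x \<in> V" using represents_subset assms(1) F x by metis
  show "(?x, y) \<notin> E"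
  proof
    assume "(?x, y) \<in> E"
    then obtain s where s: "s \<in># F" "(?x, y) \<in> edges s"
      using assms(1) by (auto simp: represents_def forest_edges_def)
    have ws: "wf_vtree s" using s(1) assms(1) by (auto simp: represents_def wf_forest_def)
    have cF: "count (vertices t) z + count (forest_vertices G) z \<le> 1" for z
      using represents_count[OF assms(1), of z] F by simp
    show False
    proof (cases "s \<in># G")
      case True
      then have "?x \<in># forest_vertices G"
        using s(2) ws edges_vertices in_forest_vertices by metis
      then have "1 \<le> count (forest_vertices G) ?x" "1 \<le> count (vertices t) ?x"
        using x by (metis One_nat_def Suc_leI count_greater_zero_iff)+
      then show False using cF[of ?x] by linarith
    next
      case False
      then have "s = t" using s(1) F by auto
      moreover have "count (vertices t) z \<le> 1" for z using cF[of z] by linarith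
      ultimately show False using edges_not_last[OF ws] s(2) by blast
    qed
  qed
qed


section \<open>The linearised tree of a monotonic set\<close>

definition instance_on :: "interval set \<Rightarrow> bool" where
  "instance_on I \<longleftrightarrow> finite I \<and> instance_set I"

lemma instance_on_mono:
  assumes "instance_on I" "J \<subseteq> I"
  shows "instance_on J"
  using assms inj_on_subset[of fin I J] finite_subset[of J I]
  unfolding instance_on_def instance_set_def monotonic_def by blast

lemma instance_proper: "instance_on I \<Longrightarrow> i \<in> I \<Longrightarrow> start i < fin i"
  by (simp add: instance_on_def instance_set_def proper_def)

lemma instance_fin_eq: "instance_on I \<Longrightarrow> i \<in> I \<Longrightarrow> j \<in> I \<Longrightarrow> fin i = fin j \<Longrightarrow> i = j"
  unfolding instance_on_def instance_set_def by (meson inj_onD)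

text \<open>Otherwise the interval that finishes first would be properly contained in the other.
  Monotonicity acts on the rest of the proof through this agreement of the two orders.\<close>

lemma instance_start_less:
  assumes I: "instance_on I" "i \<in> I" "j \<in> I" and "fin i < fin j"
  shows "start i < start j"
proof (rule ccontr)
  assume "\<not> start i < start j"
  then have "{start i..fin i} \<subset> {start j..fin j}"
    using assms instance_proper[OF I(1,2)] instance_proper[OF I(1,3)]
    by (auto simp: atLeastatMost_psubset_iff)
  then show False using I by (simp add: instance_on_def instance_set_def monotonic_def)
qed

lemma instance_start_le:
  assumes I: "instance_on I" "i \<in> I" "j \<in> I" and "fin i \<le> fin j"
  shows "start i \<le> start j"
  using instance_start_less[OF I] instance_fin_eq[OF I] assms(4) by force

lemma least_None_iff: "least P = None \<longleftrightarrow> (\<forall>j. \<not> P j)"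
  by (auto simp: least_def)

lemma greatest_None_iff: "greatest P = None \<longleftrightarrow> (\<forall>j. \<not> P j)"
  by (auto simp: greatest_def)

lemma least_Some_iff:
  assumes I: "instance_on I" and P: "\<And>j. P j \<Longrightarrow> j \<in> I"
  shows "least P = Some a \<longleftrightarrow> P a \<and> (\<forall>b. P b \<longrightarrow> fin a \<le> fin b)"
proof -
  have eq: "least P = Some a" if "P a" "\<forall>b. P b \<longrightarrow> fin a \<le> fin b" for a
  proof (rule least_eq_Some)
    show "P a" using that(1) .
  next
    fix b assume "P b" "b \<noteq> a"
    moreover from this have "fin a \<noteq> fin b" using instance_fin_eq[OF I P[OF that(1)] P] by metis
    ultimately show "a \<prec> b" using that(2) by (metis order_le_less prec_def)
  qed
  have "P a \<and> (\<forall>b. P b \<longrightarrow> fin a \<le> fin b)" if "least P = Some a"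
  proof -
    have ex: "\<exists>j. P j" using that by (metis least_None_iff option.distinct(1))
    have fin: "finite {j. P j}" using I P by (auto simp: instance_on_def intro: finite_subset[of _ I])
    then have "Min (fin ` {j. P j}) \<in> fin ` {j. P j}" using ex by (intro Min_in) auto
    then obtain m where "P m" "fin m = Min (fin ` {j. P j})" by auto
    then have "P m" "\<forall>b. P b \<longrightarrow> fin m \<le> fin b" using fin by auto
    then show ?thesis using eq[of m] that by simp
  qed
  then show ?thesis using eq by blast
qed

lemma greatest_Some_iff:
  assumes I: "instance_on I" and P: "\<And>j. P j \<Longrightarrow> j \<in> I"
  shows "greatest P = Some a \<longleftrightarrow> P a \<and> (\<forall>b. P b \<longrightarrow> fin b \<le> fin a)"
proof -
  have eq: "greatest P = Some a" if "P a" "\<forall>b. P b \<longrightarrow> fin b \<le> fin a" for a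
  proof (rule greatest_eq_Some)
    show "P a" using that(1) .
  next
    fix b assume "P b" "b \<noteq> a"
    moreover from this have "fin a \<noteq> fin b" using instance_fin_eq[OF I P[OF that(1)] P] by metis
    ultimately show "b \<prec> a" using that(2) by (metis order_le_less prec_def)
  qed
  have "P a \<and> (\<forall>b. P b \<longrightarrow> fin b \<le> fin a)" if "greatest P = Some a"
  proof -
    have ex: "\<exists>j. P j" using that by (metis greatest_None_iff option.distinct(1))
    have fin: "finite {j. P j}" using I P by (auto simp: instance_on_def intro: finite_subset[of _ I])
    then have "Max (fin ` {j. P j}) \<in> fin ` {j. P j}" using ex by (intro Max_in) auto
    then obtain m where "P m" "fin m = Max (fin ` {j. P j})" by auto
    then have "P m" "\<forall>b. P b \<longrightarrow> fin b \<le> fin m" using fin by auto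
    then show ?thesis using eq[of m] that by simp
  qed
  then show ?thesis using eq by blast
qed

section \<open>Neighbours and compatible intervals in terms of endpoints\<close>

definition next_in :: "interval set \<Rightarrow> interval \<Rightarrow> interval option" where
  "next_in I i = least (\<lambda>j. j \<in> I \<and> i \<prec> j)"

definition lc :: "interval set \<Rightarrow> interval \<Rightarrow> interval option" where
  "lc I i = greatest (\<lambda>j. j \<in> I \<and> j \<prec> i \<and> compatible i j)"

lemma compatible_iff:
  assumes "instance_on I" "i \<in> I" "j \<in> I" "fin i < fin j"
  shows "compatible i j \<longleftrightarrow> fin i < start j" "compatible j i \<longleftrightarrow> fin i < start j"
  using instance_proper[OF assms(1,2)] assms(4) by (auto simp: compatible_def)

lemma next_Some_iff:
  assumes "instance_on I"
  shows "next_in I i = Some k \<longleftrightarrow> k \<in> I \<and> fin i < fin k \<and> (\<forall>j\<in>I. fin i < fin j \<longrightarrow> fin k \<le> fin j)"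
  unfolding next_in_def by (subst least_Some_iff[OF assms]) (auto simp: prec_def)

lemma next_None_iff: "next_in I i = None \<longleftrightarrow> (\<forall>j\<in>I. fin j \<le> fin i)"
  by (auto simp: next_in_def least_None_iff prec_def not_less)

lemma previous_Some_iff:
  assumes "instance_on I"
  shows "previous I i = Some k \<longleftrightarrow> k \<in> I \<and> fin k < fin i \<and> (\<forall>j\<in>I. fin j < fin i \<longrightarrow> fin j \<le> fin k)"
  unfolding previous_def by (subst greatest_Some_iff[OF assms]) (auto simp: prec_def)

text \<open>Order and compatibility collapse to one inequality: as \<open>i\<close> comes first and
  \<open>j\<close> is proper, the other disjunct of \<open>compatible\<close> cannot hold.\<close>

lemma rc_pred:
  assumes "instance_on I" "i \<in> I"
  shows "j \<in> I \<and> i \<prec> j \<and> compatible i j \<longleftrightarrow> j \<in> I \<and> fin i < start j"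
  using compatible_iff(1)[OF assms, of j] instance_proper[OF assms(1), of j]
  unfolding prec_def by force

lemma lc_pred:
  assumes "instance_on I" "i \<in> I"
  shows "j \<in> I \<and> j \<prec> i \<and> compatible i j \<longleftrightarrow> j \<in> I \<and> fin j < start i"
  using compatible_iff(2)[OF assms(1) _ assms(2), of j] instance_proper[OF assms]
  unfolding prec_def by force

lemma rc_Some_iff:
  assumes "instance_on I" "i \<in> I"
  shows "rc I i = Some k \<longleftrightarrow> k \<in> I \<and> fin i < start k \<and> (\<forall>j\<in>I. fin i < start j \<longrightarrow> fin k \<le> fin j)"
  unfolding rc_def rc_pred[OF assms] by (subst least_Some_iff[OF assms(1)]) auto

lemma rc_None_iff:
  assumes "instance_on I" "i \<in> I"
  shows "rc I i = None \<longleftrightarrow> (\<forall>j\<in>I. start j \<le> fin i)"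
  unfolding rc_def rc_pred[OF assms] by (auto simp: least_None_iff not_less)

lemma rc_cong:
  assumes "instance_on I" "i \<in> I" "j \<in> I" "\<And>z. z \<in> I \<Longrightarrow> fin i < start z \<longleftrightarrow> fin j < start z"
  shows "rc I i = rc I j"
  unfolding rc_def rc_pred[OF assms(1,2)] rc_pred[OF assms(1,3)] using assms(4) by metis

lemma lc_Some_iff:
  assumes "instance_on I" "i \<in> I"
  shows "lc I i = Some k \<longleftrightarrow> k \<in> I \<and> fin k < start i \<and> (\<forall>j\<in>I. fin j < start i \<longrightarrow> fin j \<le> fin k)"
  unfolding lc_def lc_pred[OF assms] by (subst greatest_Some_iff[OF assms(1)]) auto

lemma lc_None_iff:
  assumes "instance_on I" "i \<in> I"
  shows "lc I i = None \<longleftrightarrow> (\<forall>j\<in>I. start i \<le> fin j)"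
  unfolding lc_def lc_pred[OF assms] by (auto simp: greatest_None_iff not_less)

lemma rc_mono:
  assumes I: "instance_on I" "x \<in> I" "y \<in> I" and "fin x \<le> fin y" "rc I y = Some b"
  shows "\<exists>a. rc I x = Some a \<and> fin a \<le> fin b"
proof -
  have b: "b \<in> I" "fin x < start b" using assms rc_Some_iff[OF I(1,3)] by auto
  then obtain a where "rc I x = Some a"
    using rc_None_iff[OF I(1,2)] by (metis linorder_not_le not_Some_eq)
  then show ?thesis using b rc_Some_iff[OF I(1,2)] by blast
qed

text \<open>Equivalence classes are contiguous in the order by finishing time: \<open>rc\<close> is
  monotone, so between two equal values it is constant.\<close>

lemma rc_sandwich:
  assumes I: "instance_on I" "x \<in> I" "y \<in> I" "z \<in> I"
    and "fin x \<le> fin y" "fin y \<le> fin z" "rc I x = rc I z"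
  shows "rc I y = rc I x"
proof (cases "rc I z")
  case None
  then show ?thesis
    using assms(7) rc_mono[OF I(1,2,3) assms(5)] by (cases "rc I y") auto
next
  case (Some c)
  obtain b where b: "rc I y = Some b" "fin b \<le> fin c" using rc_mono[OF I(1,3,4) assms(6) Some] by blast
  obtain a where a: "rc I x = Some a" "fin a \<le> fin b" using rc_mono[OF I(1,2,3) assms(5) b(1)] by blast
  have "a = c" "b \<in> I" "c \<in> I" using a(1) Some assms(7) b(1) rc_Some_iff[OF I(1)] I by auto
  then show ?thesis using a b instance_fin_eq[OF I(1), of b c] by simp
qed

section \<open>The parent function and its edges\<close>

definition parent :: "interval set \<Rightarrow> interval \<Rightarrow> interval option" where
  "parent I x = (case next_in I x of None \<Rightarrow> None
     | Some k \<Rightarrow> if rc I k = rc I x then Some k else rc I x)"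

definition parent_edges :: "interval set \<Rightarrow> (interval \<times> interval) set" where
  "parent_edges I = {(x, y). x \<in> I \<and> parent I x = Some y}"

lemma previous_iff_next:
  assumes "instance_on I" "i \<in> I" "j \<in> I"
  shows "previous I j = Some i \<longleftrightarrow> next_in I i = Some j"
  unfolding previous_Some_iff[OF assms(1)] next_Some_iff[OF assms(1)] using assms(2,3)
  by (meson linorder_not_le order_less_le_trans)

text \<open>Since classes are contiguous, an interval is the greatest of its class iff the next
  interval is not equivalent to it. This is the test in \<open>parent\<close> that separates the two
  kinds of edges.\<close>

lemma E_sim_un_E_c:
  assumes I: "instance_on I"
  shows "E_sim I \<union> E_c I = parent_edges I"
proof -
  have "(i, j) \<in> E_sim I \<union> E_c I \<longleftrightarrow> (i, j) \<in> parent_edges I" for i j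
  proof
    assume "(i, j) \<in> E_sim I \<union> E_c I"
    then consider "i \<in> I" "j \<in> I" "rc I i = rc I j" "previous I j = Some i"
      | "i \<in> I" "greatest (\<lambda>k. k \<in> I \<and> rc I k = rc I i) = Some i" "rc I i = Some j"
      unfolding E_sim_def E_c_def equiv_rc_def by blast
    then show "(i, j) \<in> parent_edges I"
    proof cases
      case 1
      then show ?thesis using previous_iff_next[OF I] by (simp add: parent_edges_def parent_def)
    next
      case 2
      have j: "j \<in> I" "fin i < start j" using 2 rc_Some_iff[OF I] by auto
      then have "fin i < fin j" using instance_proper[OF I j(1)] by linarith
      then obtain k where k: "next_in I i = Some k"
        using j(1) next_None_iff[of I i] by (metis linorder_not_le not_Some_eq)
      have "\<forall>k. k \<in> I \<and> rc I k = rc I i \<longrightarrow> fin k \<le> fin i"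
        using 2(2) by (subst (asm) greatest_Some_iff[OF I]) auto
      then have "rc I k \<noteq> rc I i" using k next_Some_iff[OF I] by (metis linorder_not_le)
      then show ?thesis using 2 k by (simp add: parent_edges_def parent_def)
    qed
  next
    assume "(i, j) \<in> parent_edges I"
    then have i: "i \<in> I" and p: "parent I i = Some j" by (auto simp: parent_edges_def)
    then obtain k where k: "next_in I i = Some k" by (auto simp: parent_def split: option.splits)
    then have k': "k \<in> I" "fin i < fin k" "\<forall>j\<in>I. fin i < fin j \<longrightarrow> fin k \<le> fin j"
      using next_Some_iff[OF I] by auto
    show "(i, j) \<in> E_sim I \<union> E_c I"
    proof (cases "rc I k = rc I i")
      case True
      then show ?thesis using p k k' i previous_iff_next[OF I]
        by (simp add: parent_def E_sim_def equiv_rc_def)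
    next
      case False
      then have "rc I i = Some j" using p k by (simp add: parent_def)
      moreover have "fin z \<le> fin i" if "z \<in> I" "rc I z = rc I i" for z
      proof (rule ccontr)
        assume "\<not> fin z \<le> fin i"
        then have "fin k \<le> fin z" using k'(3) that(1) by (meson linorder_not_le)
        then have "rc I k = rc I i" using rc_sandwich[OF I i k'(1) that(1)] k'(2) that(2) by simp
        then show False using False by simp
      qed
      then have "greatest (\<lambda>k. k \<in> I \<and> rc I k = rc I i) = Some i"
        using i by (subst greatest_Some_iff[OF I]) auto
      ultimately show ?thesis using i by (simp add: E_c_def equiv_rc_def)
    qed
  qed
  then show ?thesis by auto
qed

lemma parent_edge:
  assumes I: "instance_on I" and e: "(x, y) \<in> parent_edges I"
  shows "x \<in> I" "y \<in> I" "fin x < fin y"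
    "rc I x = Some y \<or> next_in I x = Some y \<and> rc I y = rc I x"
proof -
  show x: "x \<in> I" using e by (simp add: parent_edges_def)
  obtain k where k: "next_in I x = Some k" "(if rc I k = rc I x then Some k else rc I x) = Some y"
    using e by (auto simp: parent_edges_def parent_def split: option.splits)
  then show *: "rc I x = Some y \<or> next_in I x = Some y \<and> rc I y = rc I x" by (auto split: if_splits)
  have "y \<in> I \<and> fin x < fin y"
    using * rc_Some_iff[OF I x, of y] next_Some_iff[OF I, of x y] instance_proper[OF I, of y] by auto
  then show "y \<in> I" "fin x < fin y" by auto
qed

lemma parent_edges_reach:
  assumes I: "instance_on I" and "(x, y) \<in> (parent_edges I)\<^sup>*"
  shows "fin x \<le> fin y"
  using assms(2) 
proof induction
  case (step y z)
  then show ?case using parent_edge(3)[OF I step.hyps(2)] by linarith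
qed simp

lemma single_valued_parent_edges: "single_valued (parent_edges I)"
  by (auto simp: single_valued_def parent_edges_def)

text \<open>A next interval that is not equivalent to an \<open>x\<close> without \<open>rc\<close>
  would have a right compatible interval itself, and so would the earlier \<open>x\<close>.\<close>

lemma parent_None:
  assumes I: "instance_on I" and x: "x \<in> I" and "parent I x = None"
  shows "next_in I x = None"
proof (rule ccontr)
  assume "next_in I x \<noteq> None"
  then obtain k where k: "next_in I x = Some k" "rc I k \<noteq> rc I x" "rc I x = None"
    using assms(3) by (auto simp: parent_def split: if_splits)
  then obtain b where b: "rc I k = Some b" by (metis not_Some_eq)
  have "k \<in> I" "fin x \<le> fin k" using k next_Some_iff[OF I] by auto
  then show False using rc_mono[OF I x _ _ b] k(3) by simp
qed

text \<open>The link between \<open>parent\<close> and the test that the data structure performs.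
  For \<open>r = rc x\<close>, \<open>lc r = x\<close> says that the next interval no longer ends
  before \<open>r\<close> starts, so it is not equivalent to \<open>x\<close>.\<close>

lemma parent_link_target:
  assumes I: "instance_on I" and x: "x \<in> I"
  shows "parent I x = (case next_in I x of None \<Rightarrow> None
    | Some k \<Rightarrow> (case rc I x of None \<Rightarrow> Some k | Some r \<Rightarrow> if lc I r = Some x then Some r else Some k))"
proof (cases "next_in I x")
  case (Some k)
  then have k: "k \<in> I" "fin x < fin k" "\<forall>j\<in>I. fin x < fin j \<longrightarrow> fin k \<le> fin j"
    using next_Some_iff[OF I] by auto
  show ?thesis
  proof (cases "rc I x")
    case None
    then have "rc I k = None"
      using rc_mono[OF I x k(1) less_imp_le[OF k(2)]] by (cases "rc I k") auto
    then show ?thesis using Some None by (simp add: parent_def)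
  next
    case r: (Some r)
    then have r': "r \<in> I" "fin x < start r" "\<forall>j\<in>I. fin x < start j \<longrightarrow> fin r \<le> fin j"
      using rc_Some_iff[OF I x] by auto
    have lc: "lc I r = Some x \<longleftrightarrow> (\<forall>j\<in>I. fin j < start r \<longrightarrow> fin j \<le> fin x)"
      using lc_Some_iff[OF I r'(1)] x r'(2) by auto
    have "lc I r = Some x \<longleftrightarrow> start r \<le> fin k"
      unfolding lc using k by (meson linorder_not_le order_le_less_trans)
    moreover have "rc I k = Some r \<longleftrightarrow> fin k < start r"
      using rc_Some_iff[OF I k(1), of r] r' k(2) by (meson order_less_trans)
    ultimately show ?thesis using Some r by (auto simp: parent_def)
  qed
qed (simp add: parent_def)

section \<open>The effect of one more interval on the parent function\<close>

context
  fixes i :: interval and J I :: "interval set"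
  assumes I: "instance_on I" and i: "i \<notin> J" and I_eq: "I = insert i J"
begin

lemma instance_J: "instance_on J"
  using instance_on_mono[OF I] I_eq by auto

lemma next_insert:
  assumes "next_in I x \<noteq> Some i"
  shows "next_in J x = next_in I x"
proof (cases "next_in I x")
  case None
  moreover from None have "next_in J x = None"
    unfolding next_None_iff using I_eq by blast
  ultimately show ?thesis by simp
next
  case (Some k)
  then have "next_in J x = Some k"
    using assms I_eq next_Some_iff[OF I, of x k] next_Some_iff[OF instance_J, of x k] by auto
  then show ?thesis using Some by simp
qed

lemma rc_insert:
  assumes "x \<in> J" "rc I x \<noteq> Some i"
  shows "rc J x = rc I x"
proof -
  have x: "x \<in> I" using assms(1) I_eq by simp
  show ?thesis
  proof (cases "rc I x")
    case None
    moreover from None have "rc J x = None"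
      unfolding rc_None_iff[OF I x] rc_None_iff[OF instance_J assms(1)] using I_eq by blast
    ultimately show ?thesis by simp
  next
    case (Some k)
    then have "rc J x = Some k"
      using assms I_eq rc_Some_iff[OF I x, of k] rc_Some_iff[OF instance_J assms(1), of k] by auto
    then show ?thesis using Some by simp
  qed
qed

text \<open>In the larger set \<open>i\<close> stands between \<open>j\<close> and the parent that
  \<open>j\<close> has without it: \<open>j\<close> and \<open>i\<close> share their class, and what
  follows \<open>j\<close> without \<open>i\<close> is what follows \<open>i\<close>.\<close>

lemma parent_insert_previous:
  assumes j: "previous I i = Some j" and rc: "rc I j = rc I i"
  shows "parent I j = Some i" "parent J j = parent I i"
proof -
  have iI: "i \<in> I" using I_eq by simp
  have j': "j \<in> I" "fin j < fin i" "\<forall>z\<in>I. fin z < fin i \<longrightarrow> fin z \<le> fin j"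
    using j previous_Some_iff[OF I] by auto
  then have jJ: "j \<in> J" using I_eq by auto
  have "next_in I j = Some i" using previous_iff_next[OF I j'(1) iI] j by simp
  then show "parent I j = Some i" using rc by (simp add: parent_def)
  \<comment> \<open>An interval that does not end before \<open>i\<close> cannot have
    \<open>i\<close> on its right, so its \<open>rc\<close> is the same in both sets.\<close>
  have rc_ne: "rc I z \<noteq> Some i" if "z \<in> I" "fin i \<le> fin z" for z
    using rc_Some_iff[OF I that(1), of i] instance_proper[OF I iI] that(2) by auto
  have rcj: "rc J j = rc I i" using rc_insert[OF jJ] rc rc_ne[OF iI] by simp
  have nx: "next_in J j = next_in I i"
  proof (cases "next_in I i")
    case None
    have "fin z \<le> fin j" if "z \<in> J" for z
    proof -
      have "z \<in> I" "z \<noteq> i" using that I_eq i by auto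
      then have "fin z < fin i"
        using None next_None_iff instance_fin_eq[OF I _ iI, of z] by (metis order_le_less)
      then show ?thesis using j'(3) \<open>z \<in> I\<close> by blast
    qed
    then show ?thesis using None next_None_iff by metis
  next
    case (Some k)
    then have k: "k \<in> I" "fin i < fin k" "\<forall>z\<in>I. fin i < fin z \<longrightarrow> fin k \<le> fin z"
      using next_Some_iff[OF I] by auto
    have "fin k \<le> fin z" if "z \<in> J" "fin j < fin z" for z
    proof -
      have "z \<in> I" "z \<noteq> i" using that I_eq i by auto
      then have "fin i < fin z" using that(2) j'(3) instance_fin_eq[OF I _ iI, of z]
        by (metis linorder_neqE_linordered_idom linorder_not_le)
      then show ?thesis using k \<open>z \<in> I\<close> by blast
    qed
    then have "next_in J j = Some k"
      using next_Some_iff[OF instance_J, of j k] k j' I_eq by auto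
    then show ?thesis using Some by simp
  qed
  show "parent J j = parent I i"
  proof (cases "next_in I i")
    case (Some k)
    then have k: "k \<in> I" "fin i < fin k" using next_Some_iff[OF I] by auto
    then have "k \<in> J" using I_eq by auto
    then have "rc J k = rc I k" using rc_insert[of k] rc_ne[OF k(1)] k(2) by simp
    then show ?thesis using Some nx rcj by (simp add: parent_def)
  qed (use nx in \<open>simp add: parent_def\<close>)
qed

text \<open>\<open>j\<close> is the last interval that ends before \<open>i\<close> starts, so the
  next one has a different \<open>rc\<close> and \<open>j\<close> is the greatest of its
  class.\<close>

lemma parent_insert_lc:
  assumes j: "lc I i = Some j" and rc: "rc I j = Some i"
  shows "parent I j = Some i"
proof -
  have iI: "i \<in> I" using I_eq by simp
  have j': "j \<in> I" "fin j < start i" "\<forall>z\<in>I. fin z < start i \<longrightarrow> fin z \<le> fin j"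
    using j lc_Some_iff[OF I iI] by auto
  have "fin j < fin i" using j'(2) instance_proper[OF I iI] by simp
  then obtain k where k: "next_in I j = Some k"
    using iI next_None_iff[of I j] by (metis linorder_not_le not_Some_eq)
  then have k': "k \<in> I" "fin j < fin k" using next_Some_iff[OF I] by auto
  have "rc I k \<noteq> Some i"
    using rc_Some_iff[OF I k'(1), of i] j'(3) k' by (metis linorder_not_le)
  then show ?thesis using k rc by (simp add: parent_def)
qed

text \<open>The new interval can interfere as the next of \<open>x\<close>, as \<open>rc x\<close>,
  or as \<open>rc\<close> of the next interval. In the first case \<open>x\<close> ends its class in
  both sets; in the second the next interval is equivalent to \<open>x\<close> in both; in the third
  it is so in neither.\<close>

lemma parent_insert_other:
  assumes x: "x \<in> J"
    and nprev: "\<not> (previous I i = Some x \<and> rc I x = rc I i)"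
    and nlc: "\<not> (lc I i = Some x \<and> rc I x = Some i)"
  shows "parent I x = parent J x"
proof -
  have iI: "i \<in> I" and xI: "x \<in> I" using I_eq x by auto
  have rc_ne: "rc I z \<noteq> Some i" if "z \<in> I" "fin i \<le> fin z" for z
    using rc_Some_iff[OF I that(1), of i] instance_proper[OF I iI] that(2) by auto
  show ?thesis
  proof (cases "next_in I x")
    case None
    then show ?thesis using next_insert[of x] by (simp add: parent_def)
  next
    case (Some k)
    then have k: "k \<in> I" "fin x < fin k" "\<forall>z\<in>I. fin x < fin z \<longrightarrow> fin k \<le> fin z"
      using next_Some_iff[OF I] by auto
    show ?thesis
    proof (cases "k = i")
      case True
      then have prev: "previous I i = Some x" using previous_iff_next[OF I xI iI] Some by simp
      then have rcx: "rc I x \<noteq> rc I i" using nprev by simp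
      have xi: "fin x < fin i" using True k(2) by simp
      \<comment> \<open>Otherwise \<open>x\<close>, immediately before \<open>i\<close> and
        compatible with it, would be \<open>lc i\<close>, which the hypothesis excludes.\<close>
      have "rc I x \<noteq> Some i"
      proof
        assume a: "rc I x = Some i"
        then have "fin x < start i" using rc_Some_iff[OF I xI] by simp
        moreover have "fin z \<le> fin x" if "z \<in> I" "fin z < start i" for z
        proof -
          have "fin z < fin i" using that(2) instance_proper[OF I iI] by simp
          then show ?thesis using prev previous_Some_iff[OF I] that(1) by blast
        qed
        ultimately have "lc I i = Some x" using lc_Some_iff[OF I iI] xI by blast
        then show False using nlc a by simp
      qed
      then have rcJ: "rc J x = rc I x" using rc_insert[OF x] by simp
      have pI: "parent I x = rc I x" using Some True rcx by (auto simp: parent_def)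
      show ?thesis
      proof (cases "next_in J x")
        case None
        have "start z \<le> fin x" if "z \<in> J" for z
        proof -
          have "fin z \<le> fin x" using None that unfolding next_None_iff by blast
          then show ?thesis using instance_proper[OF instance_J that] by linarith
        qed
        then have "rc I x = None" using rcJ rc_None_iff[OF instance_J x] by simp
        then show ?thesis using pI None by (simp add: parent_def)
      next
        case k2: (Some k2)
        then have k2': "k2 \<in> J" "fin x < fin k2" using next_Some_iff[OF instance_J] by auto
        then have k2I: "k2 \<in> I" using I_eq by simp
        then have ik2: "fin i \<le> fin k2" using k(3) k2'(2) True by blast
        have "rc J k2 = rc I k2" using rc_insert[OF k2'(1)] rc_ne[OF k2I ik2] by simp
        moreover have "rc I k2 \<noteq> rc I x"
        proof
          assume "rc I k2 = rc I x"
          then have "rc I i = rc I x"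
            using rc_sandwich[OF I xI iI k2I] xi ik2 by simp
          then show False using rcx by simp
        qed
        ultimately show ?thesis using pI k2 rcJ by (simp add: parent_def)
      qed
    next
      case False
      then have kJ: "k \<in> J" using k I_eq by simp
      have nJ: "next_in J x = Some k" using next_insert[of x] Some False by simp
      show ?thesis
      proof (cases "rc I x = Some i")
        case True
        then have xi: "fin x < start i" "\<forall>z\<in>I. fin x < start z \<longrightarrow> fin i \<le> fin z"
          using rc_Some_iff[OF I xI] by auto
        obtain j where j: "lc I i = Some j"
          using xi(1) xI lc_None_iff[OF I iI] by (metis linorder_not_le not_Some_eq)
        then have j': "j \<in> I" "fin j < start i" "fin x \<le> fin j"
          using lc_Some_iff[OF I iI] xi(1) xI by auto
        have "j \<noteq> x" using nlc j True by simp
        then have "fin x < fin j" using j' instance_fin_eq[OF I xI j'(1)] by fastforce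
        \<comment> \<open>As \<open>x\<close> is not \<open>lc i\<close>, the next interval
          \<open>k\<close> is still at most \<open>lc i\<close>. Both \<open>x\<close> and
          \<open>k\<close> end before \<open>i\<close> starts, so the same intervals lie to their
          right.\<close>
        then have ki: "fin k < start i" using k(3) j'(1,2) by (meson order_le_less_trans)
        have cmp: "fin x < start z \<longleftrightarrow> fin k < start z" if "z \<in> I" for z
        proof
          assume "fin x < start z"
          then have "fin i \<le> fin z" using xi(2) that by blast
          then have "start i \<le> start z" using instance_start_le[OF I iI that] by simp
          then show "fin k < start z" using ki by simp
        next
          assume "fin k < start z"
          then show "fin x < start z" using k(2) by simp
        qed
        have "rc I x = rc I k" using rc_cong[OF I xI k(1)] cmp by blast
        moreover have "rc J x = rc J k" using rc_cong[OF instance_J x kJ] cmp I_eq by blast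
        ultimately show ?thesis using Some nJ by (simp add: parent_def)
      next
        case nrc: False
        then have rcJx: "rc J x = rc I x" using rc_insert[OF x] by simp
        show ?thesis
        proof (cases "rc I k = Some i")
          case True
          have "rc J k \<noteq> rc J x"
          proof
            assume eq: "rc J k = rc J x"
            obtain a where a: "rc I x = Some a" "fin a \<le> fin i"
              using rc_mono[OF I xI k(1) less_imp_le[OF k(2)] True] by blast
            then have aI: "a \<in> I" using rc_Some_iff[OF I xI] by simp
            have "a \<noteq> i" using a(1) nrc by simp
            then have ai: "fin a < fin i" using a(2) instance_fin_eq[OF I aI iI] by fastforce
            have "rc J k = Some a" using eq rcJx a(1) by simp
            then have "fin k < start a" using rc_Some_iff[OF instance_J kJ] by simp
            then have "fin i \<le> fin a" using True rc_Some_iff[OF I k(1)] aI by blast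
            then show False using ai by simp
          qed
          then show ?thesis using Some nJ True nrc rcJx by (auto simp: parent_def)
        next
          case False
          then have "rc J k = rc I k" using rc_insert[OF kJ] by simp
          then show ?thesis using Some nJ rcJx by (simp add: parent_def)
        qed
      qed
    qed
  qed
qed

end


subsection \<open>The greedy optimal set on the path of the least interval\<close>

lemma greedy_subset:
  assumes "instance_on I" "x \<in> greedy I"
  shows "x \<in> I"
  using assms(2)
proof cases
  case first
  then show ?thesis using least_Some_iff[OF assms(1), of "\<lambda>j. j \<in> I" x] by auto
next
  case (succ i)
  then show ?thesis
    using least_Some_iff[OF assms(1), of "\<lambda>j. j \<in> I \<and> i \<prec> j \<and> compatible i j" x] by auto
qed

text \<open>The parents inside a class lead to its greatest element \<open>h\<close>, whose own
  parent is the common \<open>rc\<close>. The induction counts the intervals that finish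
  later.\<close>

lemma reach_rc:
  assumes I: "instance_on I"
  shows "x \<in> I \<Longrightarrow> rc I x = Some k \<Longrightarrow>
    \<exists>h. (x, h) \<in> (parent_edges I)\<^sup>* \<and> rc I h = Some k \<and> (h, k) \<in> parent_edges I"
proof (induction "card {z \<in> I. fin x < fin z}" arbitrary: x rule: less_induct)
  case less
  have k: "k \<in> I" "fin x < start k" using less.prems rc_Some_iff[OF I] by auto
  then have "fin x < fin k" using instance_proper[OF I k(1)] by linarith
  then obtain n where n: "next_in I x = Some n"
    using k(1) next_None_iff[of I x] by (metis linorder_not_le not_Some_eq)
  then have n': "n \<in> I" "fin x < fin n" using next_Some_iff[OF I] by auto
  show ?case
  proof (cases "rc I n = rc I x")
    case True
    have "{z \<in> I. fin n < fin z} \<subset> {z \<in> I. fin x < fin z}" using n' by auto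
    then have "card {z \<in> I. fin n < fin z} < card {z \<in> I. fin x < fin z}"
      using I by (intro psubset_card_mono) (auto simp: instance_on_def)
    then obtain h where "(n, h) \<in> (parent_edges I)\<^sup>*" "rc I h = Some k" "(h, k) \<in> parent_edges I"
      using less.hyps[of n] n'(1) True less.prems(2) by auto
    moreover have "(x, n) \<in> parent_edges I"
      using n True less.prems(1) by (simp add: parent_edges_def parent_def)
    ultimately show ?thesis by (meson converse_rtrancl_into_rtrancl)
  next
    case False
    then have "(x, k) \<in> parent_edges I"
      using n less.prems by (simp add: parent_edges_def parent_def)
    then show ?thesis using less.prems(2) by blast
  qed
qed

lemma greedy_reach:
  assumes I: "instance_on I" and m: "least (\<lambda>j. j \<in> I) = Some m"
  shows "x \<in> greedy I \<Longrightarrow> (m, x) \<in> (parent_edges I)\<^sup>*"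
proof (induction rule: greedy.induct)
  case (first i)
  then show ?case using m by simp
next
  case (succ i k)
  obtain h where "(i, h) \<in> (parent_edges I)\<^sup>*" "(h, k) \<in> parent_edges I"
    using reach_rc[OF I greedy_subset[OF I succ(1)], of k] succ(2) by (auto simp: rc_def)
  then show ?case using succ.IH by (meson rtrancl.rtrancl_into_rtrancl rtrancl_trans)
qed

text \<open>A node on the path need not be greedy, but its class always contains a greedy interval.
  Leaving the class along an \<open>rc\<close> edge therefore ends in a greedy one.\<close>

lemma reach_equiv_greedy:
  assumes I: "instance_on I" and m: "least (\<lambda>j. j \<in> I) = Some m"
    and "(m, x) \<in> (parent_edges I)\<^sup>*"
  shows "\<exists>g\<in>greedy I. rc I g = rc I x"
  using assms(3)
proof (induction rule: rtrancl_induct)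
  case base
  then show ?case using greedy.first[OF m] by blast
next
  case (step x y)
  then obtain g where g: "g \<in> greedy I" "rc I g = rc I x" by blast
  from parent_edge(4)[OF I step.hyps(2)] show ?case
  proof
    assume "rc I x = Some y"
    then have "y \<in> greedy I" using greedy.succ[OF g(1)] g(2) by (simp add: rc_def)
    then show ?thesis by blast
  next
    assume "next_in I x = Some y \<and> rc I y = rc I x"
    then show ?thesis using g by auto
  qed
qed

text \<open>For a greedy \<open>i\<close> that is \<open>rc g\<close>, the class of \<open>g\<close>
  ends in a node \<open>h\<close> with parent \<open>i\<close>. Both \<open>h\<close> and
  \<open>j\<close> lie on the path from the minimum and have the same parent, so they
  coincide.\<close>

lemma greedy_iff_compatible:
  assumes I: "instance_on I" and m: "least (\<lambda>j. j \<in> I) = Some m"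
    and j: "(m, j) \<in> (parent_edges I)\<^sup>*" and i: "(j, i) \<in> parent_edges I"
  shows "i \<in> greedy I \<longleftrightarrow> compatible i j"
proof -
  let ?E = "parent_edges I"
  note ji = parent_edge[OF I i]
  have comp: "compatible i j \<longleftrightarrow> fin j < start i"
    using compatible_iff(2)[OF I ji(1,2,3)] .
  show ?thesis
  proof
    assume "compatible i j"
    have "rc I j = Some i"
    \<comment> \<open>If \<open>i\<close> and \<open>j\<close> are equivalent with common
      \<open>rc\<close> equal to \<open>b\<close>, compatibility gives that \<open>b\<close> ends no
      later than \<open>i\<close>, although \<open>b\<close> starts after \<open>i\<close>
      ends.\<close>
    proof (rule ccontr)
      assume "rc I j \<noteq> Some i"
      then have eq: "rc I i = rc I j" using ji(4) by blast
      obtain b where b: "rc I j = Some b"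
        using \<open>compatible i j\<close> comp ji(2) rc_None_iff[OF I ji(1)] by (metis linorder_not_le not_Some_eq)
      then have "fin b \<le> fin i" using \<open>compatible i j\<close> comp ji(2) rc_Some_iff[OF I ji(1)] by blast
      moreover have "b \<in> I" "fin i < start b" using b eq rc_Some_iff[OF I ji(2)] by auto
      ultimately show False using instance_proper[OF I, of b] by simp
    qed
    then obtain g where "g \<in> greedy I" "rc I g = Some i"
      using reach_equiv_greedy[OF I m j] by metis
    then show "i \<in> greedy I" unfolding rc_def by (rule greedy.succ)
  next
    assume "i \<in> greedy I"
    then show "compatible i j"
    proof (cases rule: greedy.cases)
      case first
      then have "\<forall>b. b \<in> I \<longrightarrow> fin i \<le> fin b"
        using least_Some_iff[OF I, of "\<lambda>j. j \<in> I"] by auto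
      then show ?thesis using ji(1,3) by (meson linorder_not_le)
    next
      case (succ g)
      have gI: "g \<in> I" using greedy_subset[OF I succ(1)] .
      obtain h where h: "(g, h) \<in> ?E\<^sup>*" "rc I h = Some i" "(h, i) \<in> ?E"
        using reach_rc[OF I gI, of i] succ(2) by (auto simp: rc_def)
      have hI: "h \<in> I" using parent_edge(1)[OF I h(3)] .
      have "(m, h) \<in> ?E\<^sup>*" using greedy_reach[OF I m succ(1)] h(1) by (rule rtrancl_trans)
      then have "(h, j) \<in> ?E\<^sup>* \<or> (j, h) \<in> ?E\<^sup>*"
        using single_valued_confluent[OF single_valued_parent_edges _ j] by blast
      \<comment> \<open>A nonempty path from \<open>x\<close> to \<open>y\<close> would pass through
        \<open>i\<close>, and back from \<open>i\<close> to \<open>y\<close>, against increasing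
        finishing times.\<close>
      moreover have "x = y" if "(x, y) \<in> ?E\<^sup>*" "(x, i) \<in> ?E" "(y, i) \<in> ?E" for x y
      proof (rule ccontr)
        assume "x \<noteq> y"
        with that(1) obtain z where "(x, z) \<in> ?E" "(z, y) \<in> ?E\<^sup>*"
          by (cases rule: converse_rtranclE) auto
        then have "(i, y) \<in> ?E\<^sup>*"
          using that(2) single_valuedD[OF single_valued_parent_edges, of x z I i] by simp
        then show False using parent_edges_reach[OF I] parent_edge(3)[OF I that(3)] by (meson linorder_not_le)
      qed
      ultimately have "h = j" using h(3) i by blast
      then have "fin j < start i" using h(2) rc_Some_iff[OF I hI, of i] by simp
      then show ?thesis using comp by simp
    qed
  qed
qed


section \<open>Amortised analysis of the operations\<close>

text \<open>
  Computations are verified by weakest preconditions on the result and on a credit from which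
  every step is paid.
\<close>

definition wp :: "'a tm \<Rightarrow> ('a \<Rightarrow> real \<Rightarrow> bool) \<Rightarrow> real \<Rightarrow> bool" where
  "wp m Q c \<longleftrightarrow> Q (result m) (c - real (steps m))"

lemma wp_return [simp]: "wp (return x) Q = Q x"
  by (rule ext) (simp add: wp_def return_def)

lemma wp_bind [simp]: "wp (bind_tm m f) Q = wp m (\<lambda>x. wp (f x) Q)"
  by (rule ext) (simp add: wp_def bind_tm_def algebra_simps)

lemma wp_tick [simp]: "wp (tick m) Q c \<longleftrightarrow> wp m Q (c - 1)"
  by (simp add: wp_def tick_def algebra_simps)

lemma wp_TM [simp]: "wp (TM x k) Q c \<longleftrightarrow> Q x (c - real k)"
  by (simp add: wp_def)

text \<open>The constants are those of \<open>link\<close>, the dearest operation. The summand 2 has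
  two origins: an insertion temporarily raises the size to \<open>n + 1\<close>, and the bound on
  the height of the search tree adds another 1. It also keeps the logarithm nonnegative for the
  empty set.\<close>

definition unit_cost :: "nat \<Rightarrow> real" where
  "unit_cost n = 39 * log 2 (real n + 2) + 13"

lemma log_unit_cost: "k \<le> n + 1 \<Longrightarrow> log 2 (real k) \<le> log 2 (real n + 2)" "0 \<le> log 2 (real n + 2)"
proof -
  show "0 \<le> log 2 (real n + 2)" by simp
  then show "log 2 (real k) \<le> log 2 (real n + 2)" if "k \<le> n + 1"
    using that by (cases "k = 0") (auto simp: log_def[of 2 0])
qed

lemma unit_cost_ge: "13 \<le> unit_cost n"
  using log_unit_cost(2)[of n] by (simp add: unit_cost_def)

text \<open>The state of a computation that can still pay for \<open>k\<close> basic operations.\<close>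

definition state ::
  "nat \<Rightarrow> interval set \<Rightarrow> (interval \<Rightarrow> interval option) \<Rightarrow> interval forest \<Rightarrow> real \<Rightarrow> nat \<Rightarrow> bool" where
  "state n V f F c k \<longleftrightarrow> represents V (Map.graph f) F \<and> (\<forall>x y. f x = Some y \<longrightarrow> fin x < fin y) \<and>
     card V \<le> n + 1 \<and> 3 * fpot F + real k * unit_cost n \<le> c"

lemma state_pay:
  assumes "state n V f F c k" "0 < k" "real j \<le> unit_cost n"
  shows "state n V f F (c - real j) (k - 1)"
proof -
  have "real k * unit_cost n = real (k - 1) * unit_cost n + unit_cost n"
    using assms(2) by (cases k) (auto simp: algebra_simps)
  then show ?thesis using assms by (simp add: state_def)
qed

lemma state_weaken:
  assumes "state n V f F c k" "j \<le> k"
  shows "state n V f F c j"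
proof -
  have "real j * unit_cost n \<le> real k * unit_cost n"
    using assms(2) unit_cost_ge[of n] by (intro mult_right_mono) auto
  then show ?thesis using assms by (simp add: state_def)
qed

lemma state_credit: "state n V f F c k \<Longrightarrow> 3 * fpot F \<le> c"
  using state_weaken[of n V f F c k 0] by (simp add: state_def)

lemma wp_pay:
  assumes "state n V f F c k" "0 < k" "real (steps m) \<le> unit_cost n"
    and "\<And>c'. state n V f F c' (k - 1) \<Longrightarrow> Q (result m) c'"
  shows "wp m Q c"
  using assms state_pay by (simp add: wp_def)

lemma wp_tickI:
  assumes "state n V f F c k" "0 < k" "\<And>c'. state n V f F c' (k - 1) \<Longrightarrow> wp m Q c'"
  shows "wp (tick m) Q c"
proof -
  have "real 1 \<le> unit_cost n" using unit_cost_ge[of n] by simp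
  then show ?thesis using assms(3) state_pay[OF assms(1,2), of 1] by simp
qed

lemma in_graph_iff: "(x, y) \<in> Map.graph f \<longleftrightarrow> f x = Some y"
  by (simp add: graph_def)

lemma graph_reach:
  assumes "\<forall>x y. f x = Some y \<longrightarrow> fin x < fin y" "(x, y) \<in> (Map.graph f)\<^sup>*"
  shows "fin x \<le> fin y"
  using assms(2)
proof induction
  case (step y z)
  then have "fin y < fin z" using assms(1) unfolding in_graph_iff by blast
  then show ?case using step.IH by linarith
qed simp

lemma state_change:
  assumes "state n V f F c k" "0 < k" "represents V' (Map.graph f') F'"
    "\<forall>x y. f' x = Some y \<longrightarrow> fin x < fin y" "card V' \<le> n + 1"
    "real j + 3 * fpot F' \<le> 3 * fpot F + unit_cost n"
  shows "state n V' f' F' (c - real j) (k - 1)"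
proof -
  have "real k * unit_cost n = real (k - 1) * unit_cost n + unit_cost n"
    using assms(2) by (cases k) (auto simp: algebra_simps)
  then show ?thesis using assms by (simp add: state_def)
qed

text \<open>A path from \<open>w\<close> to \<open>v\<close> would imply
  \<open>fin w <= fin v\<close>, so the order of finishing times replaces any analysis of which tree
  contains which node.\<close>

lemma wp_link:
  assumes st: "state n V f F c k" "0 < k" and "v \<in> V" "w \<in> V" "f v = None" "fin v < fin w"
    and Q: "\<And>F' c'. state n V (f(v := Some w)) F' c' (k - 1) \<Longrightarrow> Q F' c'"
  shows "wp (link v w F) Q c"
proof -
  have inc: "\<forall>x y. f x = Some y \<longrightarrow> fin x < fin y" using st by (simp add: state_def)
  have "(w, v) \<notin> (Map.graph f)\<^sup>*" using graph_reach[OF inc, of w v] assms(6) by auto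
  then obtain F' j where l: "link v w F = TM F' j" "represents V (insert (v, w) (Map.graph f)) F'"
    "real j + 3 * fpot F' \<le> 3 * fpot F + (39 * log 2 (card V) + 13)"
    using link[of V "Map.graph f" F v w] assms(3-5) st(1) unfolding state_def in_graph_iff by auto
  have "insert (v, w) (Map.graph f) = Map.graph (f(v := Some w))"
    using assms(5) by (auto simp: in_graph_iff split: if_splits)
  moreover have "39 * log 2 (card V) + 13 \<le> unit_cost n"
    using log_unit_cost(1)[of "card V" n] st(1) by (simp add: unit_cost_def state_def)
  ultimately have "state n V (f(v := Some w)) F' (c - real j) (k - 1)"
    using l inc assms(6) st(1) by (intro state_change[OF st]) (auto simp: state_def)
  then show ?thesis using Q l(1) by simp
qed

lemma wp_cut:
  assumes st: "state n V f F c k" "0 < k" and "v \<in> V"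
    and Q: "\<And>F' c'. state n V (f(v := None)) F' c' (k - 1) \<Longrightarrow> Q F' c'"
  shows "wp (cut v F) Q c"
proof -
  obtain F' j where l: "cut v F = TM F' j" "represents V {(x, y) \<in> Map.graph f. x \<noteq> v} F'"
    "real j + 3 * fpot F' \<le> 3 * fpot F + (18 * log 2 (card V) + 7)"
    using cut[of V "Map.graph f" F v] assms(3) st(1) by (auto simp: state_def)
  have "{(x, y) \<in> Map.graph f. x \<noteq> v} = Map.graph (f(v := None))"
    by (auto simp: in_graph_iff split: if_splits)
  moreover have "card V \<le> n + 1" using st(1) by (simp add: state_def)
  then have "18 * log 2 (card V) + 7 \<le> unit_cost n"
    using log_unit_cost(1)[of "card V" n] log_unit_cost(2)[of n] unfolding unit_cost_def by linarith
  ultimately have "state n V (f(v := None)) F' (c - real j) (k - 1)"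
    using l st(1) by (intro state_change[OF st]) (auto simp: state_def split: if_splits)
  then show ?thesis using Q l(1) by simp
qed

lemma wp_new_node:
  assumes st: "state n V f F c k" "0 < k" and "v \<notin> V" "card V \<le> n"
    and Q: "\<And>F' c'. state n (insert v V) f F' c' (k - 1) \<Longrightarrow> Q F' c'"
  shows "wp (new_node v F) Q c"
proof -
  obtain F' j where l: "new_node v F = TM F' j" "represents (insert v V) (Map.graph f) F'"
    "real j + 3 * fpot F' \<le> 3 * fpot F + 1"
    using new_node[of V "Map.graph f" F v] assms(3) st(1) by (auto simp: state_def)
  have "card (insert v V) \<le> n + 1" using assms(4) by (simp add: card_insert_if card_insert_le_m1)
  then have "state n (insert v V) f F' (c - real j) (k - 1)"
    using l st(1) unit_cost_ge[of n] by (intro state_change[OF st]) (auto simp: state_def)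
  then show ?thesis using Q l(1) by simp
qed

lemma wp_free_node:
  assumes st: "state n V f F c k" "0 < k" and "v \<in> V" "f v = None" "\<And>x. f x \<noteq> Some v"
    and Q: "\<And>F' c'. state n (V - {v}) f F' c' (k - 1) \<Longrightarrow> Q F' c'"
  shows "wp (free_node v F) Q c"
proof -
  obtain F' j where l: "free_node v F = TM F' j" "represents (V - {v}) (Map.graph f) F'"
    "real j + 3 * fpot F' \<le> 3 * fpot F + 1"
    using free_node[of V "Map.graph f" F v] assms(3-5) st(1) unfolding state_def in_graph_iff by auto
  have "card (V - {v}) \<le> n + 1" using st(1) card_Diff1_le[of V v] by (auto simp: state_def)
  then have "state n (V - {v}) f F' (c - real j) (k - 1)"
    using l st(1) unit_cost_ge[of n] by (intro state_change[OF st]) (auto simp: state_def)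
  then show ?thesis using Q l(1) by simp
qed


subsection \<open>Queries to the search tree\<close>

definition stores_T :: "interval set \<Rightarrow> search_tree \<Rightarrow> bool" where
  "stores_T I T \<longleftrightarrow> avl T \<and> sorted_wrt (\<prec>) (keys T) \<and> set (keys T) = I"

lemma sorted_wrt_prec_distinct: "sorted_wrt (\<prec>) xs \<Longrightarrow> distinct xs"
  by (induction xs) (auto simp: prec_def)

lemma height_le_unit_cost:
  assumes "stores_T I T" "card I \<le> n + 1"
  shows "real (height T + 1) \<le> unit_cost n"
proof -
  have "card I = length (keys T)"
    using assms(1) sorted_wrt_prec_distinct distinct_card unfolding stores_T_def by metis
  then have "size T = card I" by simp
  then have "real (height T) \<le> 2 * log 2 (real (card I) + 1)"
    using height_le_log[of T] assms(1) by (simp add: stores_T_def)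
  moreover have "log 2 (real (card I) + 1) \<le> log 2 (real n + 2)"
    using assms(2) by (subst log_le_cancel_iff) auto
  ultimately show ?thesis using log_unit_cost(2)[of n] unfolding unit_cost_def of_nat_add by linarith
qed

lemma search_least:
  assumes "stores_T I T" "\<And>x y. x \<in> I \<Longrightarrow> y \<in> I \<Longrightarrow> x \<prec> y \<Longrightarrow> P x \<Longrightarrow> P y"
  shows "result (search_least P T None) = least (\<lambda>j. j \<in> I \<and> P j)"
proof -
  have "result (search_least P T None) = find P (keys T)"
    using search_least_find[of T P None] assms by (auto simp: stores_T_def split: option.splits)
  then show ?thesis using find_eq_least[of "keys T" P] assms(1) by (simp add: stores_T_def)
qed

lemma search_greatest:
  assumes "stores_T I T" "\<And>x y. x \<in> I \<Longrightarrow> y \<in> I \<Longrightarrow> x \<prec> y \<Longrightarrow> P y \<Longrightarrow> P x"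
  shows "result (search_greatest P T None) = greatest (\<lambda>j. j \<in> I \<and> P j)"
proof -
  have "result (search_greatest P T None) = find P (rev (keys T))"
    using search_greatest_find[of T P None] assms by (auto simp: stores_T_def split: option.splits)
  then show ?thesis using find_rev_eq_greatest[of "keys T" P] assms(1) by (simp add: stores_T_def)
qed

lemma search_results:
  assumes T: "stores_T I T" and I: "instance_on I"
  shows "result (min_T T) = least (\<lambda>j. j \<in> I)"
    and "result (next_T i T) = next_in I i"
    and "result (previous_T i T) = previous I i"
    and "i \<in> I \<Longrightarrow> result (rc_T i T) = rc I i"
    and "i \<in> I \<Longrightarrow> result (lc_T i T) = lc I i"
proof -
  show "result (min_T T) = least (\<lambda>j. j \<in> I)"
    using search_least[OF T, of "\<lambda>_. True"] by (simp add: min_T_def)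
  show "result (next_T i T) = next_in I i"
    using search_least[OF T, of "\<lambda>j. i \<prec> j"] by (simp add: next_T_def next_in_def prec_def)
  show "result (previous_T i T) = previous I i"
    using search_greatest[OF T, of "\<lambda>j. j \<prec> i"] by (simp add: previous_T_def previous_def prec_def)
  show "result (rc_T i T) = rc I i" if i: "i \<in> I"
    unfolding rc_T_def rc_def
  proof (rule search_least[OF T])
    fix x y assume xy: "x \<in> I" "y \<in> I" "x \<prec> y" "i \<prec> x \<and> compatible i x"
    then have "fin i < start x" using rc_pred[OF I i, of x] by blast
    also have "start x < start y" using instance_start_less[OF I xy(1,2)] xy(3) by (simp add: prec_def)
    finally show "i \<prec> y \<and> compatible i y" using rc_pred[OF I i, of y] xy(2) by blast
  qed
  show "result (lc_T i T) = lc I i" if i: "i \<in> I"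
    unfolding lc_T_def lc_def
  proof (rule search_greatest[OF T])
    fix x y assume xy: "x \<in> I" "y \<in> I" "x \<prec> y" "y \<prec> i \<and> compatible i y"
    then have "fin y < start i" using lc_pred[OF I i, of y] by blast
    then have "fin x < start i" using xy(3) by (simp add: prec_def)
    then show "x \<prec> i \<and> compatible i x" using lc_pred[OF I i, of x] xy(1) by blast
  qed
qed

lemma search_steps:
  assumes T: "stores_T I T" "card I \<le> n + 1"
  shows "real (steps (min_T T)) \<le> unit_cost n"
    and "real (steps (next_T i T)) \<le> unit_cost n"
    and "real (steps (previous_T i T)) \<le> unit_cost n"
    and "real (steps (rc_T i T)) \<le> unit_cost n"
    and "real (steps (lc_T i T)) \<le> unit_cost n"
    and "real (steps (member_T i T)) \<le> unit_cost n"
    and "real (steps (insert_T i T)) \<le> unit_cost n"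
    and "real (steps (delete_T i T)) \<le> unit_cost n"
proof -
  have *: "real k \<le> unit_cost n" if "k \<le> height T + 1" for k
    using height_le_unit_cost[OF T] of_nat_mono[OF that, where ?'a = real] by linarith
  show "real (steps (min_T T)) \<le> unit_cost n" "real (steps (next_T i T)) \<le> unit_cost n"
    "real (steps (previous_T i T)) \<le> unit_cost n" "real (steps (rc_T i T)) \<le> unit_cost n"
    "real (steps (lc_T i T)) \<le> unit_cost n" "real (steps (member_T i T)) \<le> unit_cost n"
    "real (steps (insert_T i T)) \<le> unit_cost n" "real (steps (delete_T i T)) \<le> unit_cost n"
    unfolding min_T_def next_T_def previous_T_def rc_T_def lc_T_def
    by (intro * steps_search_least steps_search_greatest steps_member_T steps_insert_T steps_delete_T)+
qed

lemma stores_T_insert: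
  assumes "stores_T J T" "instance_on (insert i J)" "i \<notin> J"
  shows "stores_T (insert i J) (result (insert_T i T))"
proof -
  have "inj_on fin (insert i (set (keys T)))"
    using assms(1,2) by (simp add: stores_T_def instance_on_def instance_set_def)
  then show ?thesis
    using insert_T_keys[of T i] avl_insert_T[of T i] assms by (auto simp: stores_T_def)
qed

lemma stores_T_delete:
  assumes "stores_T I T" "i \<in> I"
  shows "stores_T (I - {i}) (result (delete_T i T))"
proof -
  have "keys (result (delete_T i T)) = filter (\<lambda>x. x \<noteq> i) (keys T)"
    using delete_T_keys[of T i] assms by (simp add: stores_T_def removeAll_filter_not_eq) (metis (mono_tags))
  then show ?thesis
    using avl_delete_T[of T i] assms sorted_wrt_filter[of "(\<prec>)" "keys T" "\<lambda>x. x \<noteq> i"]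
    unfolding stores_T_def by auto
qed

lemma wp_search:
  assumes "state n V f F c k" "0 < k" "stores_T I T" "card I \<le> n + 1" "instance_on I"
  shows "(\<And>c'. state n V f F c' (k - 1) \<Longrightarrow> Q (least (\<lambda>j. j \<in> I)) c') \<Longrightarrow> wp (min_T T) Q c"
    and "(\<And>c'. state n V f F c' (k - 1) \<Longrightarrow> Q (next_in I i) c') \<Longrightarrow> wp (next_T i T) Q c"
    and "(\<And>c'. state n V f F c' (k - 1) \<Longrightarrow> Q (previous I i) c') \<Longrightarrow> wp (previous_T i T) Q c"
    and "i \<in> I \<Longrightarrow> (\<And>c'. state n V f F c' (k - 1) \<Longrightarrow> Q (rc I i) c') \<Longrightarrow> wp (rc_T i T) Q c"
    and "i \<in> I \<Longrightarrow> (\<And>c'. state n V f F c' (k - 1) \<Longrightarrow> Q (lc I i) c') \<Longrightarrow> wp (lc_T i T) Q c"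
  using wp_pay[OF assms(1,2)] search_results[OF assms(3,5)] search_steps[OF assms(3,4)] by metis+


subsection \<open>Insertion and removal\<close>

text \<open>Cutting \<open>parent\<close> off outside \<open>I\<close> makes the maps of different
  sets comparable as functions, so that insertion and removal become plain function updates.\<close>

definition parent_map :: "interval set \<Rightarrow> interval \<Rightarrow> interval option" where
  "parent_map I x = (if x \<in> I then parent I x else None)"

lemma graph_parent_map: "Map.graph (parent_map I) = parent_edges I"
  by (auto simp: parent_map_def parent_edges_def in_graph_iff split: if_splits)

lemma parent_map_mono:
  "instance_on I \<Longrightarrow> parent_map I x = Some y \<Longrightarrow> y \<in> I \<and> fin x < fin y"
  using parent_edge(2,3)[of I x y] by (auto simp: parent_map_def parent_edges_def split: if_splits)

text \<open>The invariant is stronger than \<open>stores_LT\<close>: it adds the balance of the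
  search tree and the well-formedness of the virtual trees.\<close>

definition stores :: "interval set \<Rightarrow> linearised_tree \<Rightarrow> bool" where
  "stores I D \<longleftrightarrow> stores_T I (fst D) \<and> represents I (parent_edges I) (snd D)"

lemma state_parent_map:
  "state n I (parent_map I) F c k \<Longrightarrow> stores_T I T \<Longrightarrow> stores I (T, F) \<and> 3 * fpot F \<le> c"
  using state_credit[of n I "parent_map I" F c k] unfolding stores_def state_def graph_parent_map by simp

lemma wp_relink:
  assumes st: "state n V f F c k" "2 \<le> k" and "v \<in> V" "w \<in> V" "fin v < fin w"
    and Q: "\<And>F' c'. state n V (f(v := Some w)) F' c' (k - 2) \<Longrightarrow> Q F' c'"
  shows "wp (do { F \<leftarrow> cut v F; link v w F }) Q c"
proof -
  have k: "0 < k" "0 < k - 1" "k - 1 - 1 = k - 2" using st(2) by auto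
  show ?thesis
    unfolding wp_bind
  proof (rule wp_cut[OF st(1) k(1) assms(3)])
    fix F' c' assume "state n V (f(v := None)) F' c' (k - 1)"
    then show "wp (link v w F') Q c'"
      by (rule wp_link[OF _ k(2) assms(3,4) _ assms(5)]) (use Q k(3) in auto)
  qed
qed

text \<open>By \<open>parent_link_target\<close> the tests amount to assigning
  \<open>parent I i\<close>. Without a next interval nothing is linked, in accordance with
  \<open>f v = None\<close>. One unit pays the search for \<open>lc\<close>, one the link.\<close>

lemma wp_link_parent:
  assumes st: "state n V f F c k" "2 \<le> k" and T: "stores_T I T" "card I \<le> n + 1" "instance_on I"
    and i: "i \<in> I" and v: "v \<in> V" "f v = None" "fin v \<le> fin i" and "I \<subseteq> V"
    and Q: "\<And>F' c'. state n V (f(v := parent I i)) F' c' (k - 2) \<Longrightarrow> Q F' c'"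
  shows "wp (case next_in I i of None \<Rightarrow> return F
      | Some k \<Rightarrow> (case rc I i of None \<Rightarrow> link v k F
        | Some r' \<Rightarrow> do { h \<leftarrow> lc_T r' T; if h = Some i then link v r' F else link v k F })) Q c"
proof (cases "next_in I i")
  case None
  then have "f(v := parent I i) = f" using v(2) by (auto simp: parent_def)
  then show ?thesis using None Q[of F c] state_weaken[OF st(1), of "k - 2"] by simp
next
  case (Some a)
  have a: "a \<in> V" "fin v < fin a"
    using Some next_Some_iff[OF T(3), of i a] v(3) \<open>I \<subseteq> V\<close> by auto
  have k: "0 < k" "0 < k - 1" "k - 1 - 1 = k - 2" "k - 2 \<le> k - 1" using st(2) by auto
  note target = parent_link_target[OF T(3) i]
  show ?thesis
  proof (cases "rc I i")
    case None
    have "wp (link v a F) Q c"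
    proof (rule wp_link[OF st(1) k(1) v(1) a(1) v(2) a(2)])
      fix F' c' assume "state n V (f(v := Some a)) F' c' (k - 1)"
      then have "state n V (f(v := Some a)) F' c' (k - 2)" using state_weaken k(4) by blast
      then show "Q F' c'" using Q target Some None by simp
    qed
    then show ?thesis using Some None by simp
  next
    case r: (Some r)
    have r': "r \<in> I" "fin i < start r" using r rc_Some_iff[OF T(3) i, of r] by auto
    then have rV: "r \<in> V" "fin v < fin r"
      using instance_proper[OF T(3) r'(1)] v(3) \<open>I \<subseteq> V\<close> by auto
    have "wp (do { h \<leftarrow> lc_T r T; if h = Some i then link v r F else link v a F }) Q c"
      unfolding wp_bind
    proof (rule wp_search(5)[OF st(1) k(1) T r'(1)])
      fix c' assume st': "state n V f F c' (k - 1)"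
      show "wp (if lc I r = Some i then link v r F else link v a F) Q c'"
        using wp_link[OF st' k(2) v(1) rV(1) v(2) rV(2), of Q]
          wp_link[OF st' k(2) v(1) a(1) v(2) a(2), of Q] Q target Some r k(3)
        by (cases "lc I r = Some i") auto
    qed
    then show ?thesis using Some r by simp
  qed
qed


text \<open>The effect of one conditional relinking on the parent map: \<open>p\<close> is the
  candidate, \<open>r\<close> the value of \<open>rc\<close> that it must have, and \<open>g\<close>
  supplies its new parent.\<close>

definition relinked ::
  "interval set \<Rightarrow> interval option \<Rightarrow> interval option \<Rightarrow> (interval \<Rightarrow> interval option) \<Rightarrow>
    (interval \<Rightarrow> interval option) \<Rightarrow> interval \<Rightarrow> interval option" where
  "relinked I p r g f = (case p of None \<Rightarrow> f | Some j \<Rightarrow> if rc I j = r then f(j := g j) else f)"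

lemma wp_relink_if:
  assumes st: "state n V f F c k" "3 \<le> k" and T: "stores_T I T" "card I \<le> n + 1" "instance_on I"
    and w: "w \<in> V" "I \<subseteq> V" and p: "\<And>j. p = Some j \<Longrightarrow> j \<in> I \<and> fin j < fin w"
    and Q: "\<And>F' c'. state n V (relinked I p r (\<lambda>_. Some w) f) F' c' (k - 3) \<Longrightarrow> Q F' c'"
  shows "wp (case p of None \<Rightarrow> return F | Some j \<Rightarrow> do {
      rj \<leftarrow> rc_T j T;
      if rj = r then do { F \<leftarrow> cut j F; link j w F } else return F }) Q c"
proof (cases p)
  case None
  then show ?thesis using Q[of F c] state_weaken[OF st(1), of "k - 3"] by (simp add: relinked_def)
next
  case (Some j)
  then have j: "j \<in> I" "fin j < fin w" "j \<in> V" using p w(2) by auto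
  have k: "0 < k" "2 \<le> k - 1" "k - 1 - 2 = k - 3" "k - 3 \<le> k - 1" using st(2) by auto
  have "wp (do { rj \<leftarrow> rc_T j T; if rj = r then do { F \<leftarrow> cut j F; link j w F } else return F }) Q c"
    unfolding wp_bind
  proof (rule wp_search(4)[OF st(1) k(1) T j(1)])
    fix c' assume st': "state n V f F c' (k - 1)"
    show "wp (if rc I j = r then do { F \<leftarrow> cut j F; link j w F } else return F) Q c'"
    proof (cases "rc I j = r")
      case True
      have "wp (do { F \<leftarrow> cut j F; link j w F }) Q c'"
        by (rule wp_relink[OF st' k(2) j(3) w(1) j(2)]) (use Q k(3) Some True in \<open>simp add: relinked_def\<close>)
      then show ?thesis using True by simp
    next
      case False
      then show ?thesis
        using Q[of F c'] state_weaken[OF st' k(4)] Some by (simp add: relinked_def)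
    qed
  qed
  then show ?thesis using Some by simp
qed

text \<open>The first equation is the effect of insertion, the second that of removal, with the
  updates in the order in which the operations perform them. Both are read off the same five cases,
  in which \<open>lc\<close> takes precedence over \<open>previous\<close>.\<close>

lemma parent_map_insert:
  assumes I: "instance_on I" and i: "i \<notin> J" and I_eq: "I = insert i J"
  shows "parent_map I = relinked I (lc I i) (Some i) (\<lambda>_. Some i)
    (relinked I (previous I i) (rc I i) (\<lambda>_. Some i) ((parent_map J)(i := parent I i)))"
    and "parent_map J = relinked I (lc I i) (Some i) (parent J)
    (relinked I (previous I i) (rc I i) (\<lambda>_. parent I i) ((parent_map I)(i := None)))"
proof -
  have iI: "i \<in> I" using I_eq by simp
  have prev: "j \<in> J" if "previous I i = Some j" for j
    using that previous_Some_iff[OF I, of i j] I_eq by auto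
  have lc: "j \<in> J" if "lc I i = Some j" for j
    using that lc_Some_iff[OF I iI, of j] instance_proper[OF I iI] I_eq by auto
  have "parent_map I x = relinked I (lc I i) (Some i) (\<lambda>_. Some i)
    (relinked I (previous I i) (rc I i) (\<lambda>_. Some i) ((parent_map J)(i := parent I i))) x \<and>
    parent_map J x = relinked I (lc I i) (Some i) (parent J)
    (relinked I (previous I i) (rc I i) (\<lambda>_. parent I i) ((parent_map I)(i := None))) x" for x
  proof -
    consider "lc I i = Some x" "rc I x = Some i" "x \<in> J"
      | "\<not> (lc I i = Some x \<and> rc I x = Some i)" "previous I i = Some x" "rc I x = rc I i" "x \<in> J"
      | "\<not> (lc I i = Some x \<and> rc I x = Some i)" "\<not> (previous I i = Some x \<and> rc I x = rc I i)" "x \<in> J"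
      | "x = i" | "x \<notin> I"
      using prev lc I_eq by blast
    then show ?thesis
    proof cases
      case 1
      then have "parent_map I x = Some i" "parent_map J x = parent J x"
        using parent_insert_lc[OF I i I_eq] I_eq by (auto simp: parent_map_def)
      then show ?thesis using 1 by (simp add: relinked_def)
    next
      case 2
      then have "parent_map I x = Some i" "parent_map J x = parent I i"
        using parent_insert_previous[OF I i I_eq] I_eq by (auto simp: parent_map_def)
      then show ?thesis using 2 by (auto simp: relinked_def split: option.split)
    next
      case 3
      then have "x \<noteq> i" "parent_map I x = parent_map J x"
        using parent_insert_other[OF I i I_eq] I_eq i by (auto simp: parent_map_def)
      then show ?thesis using 3 by (auto simp: relinked_def split: option.split)
    next
      case 4
      moreover have "lc I i \<noteq> Some i" "previous I i \<noteq> Some i" using prev[of i] lc[of i] i by blast+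
      ultimately have "lc I i \<noteq> Some x" "previous I i \<noteq> Some x" "parent_map I x = parent I i" "parent_map J x = None"
        using i iI by (simp_all add: parent_map_def)
      then show ?thesis using 4 by (auto simp: relinked_def split: option.split)
    next
      case 5
      moreover from this have "x \<notin> J" using I_eq by blast
      ultimately have "x \<noteq> i" "lc I i \<noteq> Some x" "previous I i \<noteq> Some x"
        "parent_map I x = None" "parent_map J x = None"
        using prev[of x] lc[of x] iI unfolding parent_map_def by metis+
      then show ?thesis by (auto simp: relinked_def split: option.split)
    qed
  qed
  then show "parent_map I = relinked I (lc I i) (Some i) (\<lambda>_. Some i)
    (relinked I (previous I i) (rc I i) (\<lambda>_. Some i) ((parent_map J)(i := parent I i)))"
    "parent_map J = relinked I (lc I i) (Some i) (parent J)
    (relinked I (previous I i) (rc I i) (\<lambda>_. parent I i) ((parent_map I)(i := None)))"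
    by blast+
qed

lemma state_parent_mapI:
  assumes "stores I (T, F)" "instance_on I" "card I \<le> n + 1" "3 * fpot F + real k * unit_cost n \<le> c"
  shows "state n I (parent_map I) F c k"
  using assms parent_map_mono[OF assms(2)]
  unfolding state_def stores_def graph_parent_map snd_conv by blast

text \<open>The credit is measured by the size before the insertion, while the searches run on a set
  with one more element. Fifteen of the thirty units are spent.\<close>

lemma wp_insertLT:
  assumes D: "stores J (T, F)" and I: "instance_on (insert i J)" and i: "i \<notin> J"
    and c: "3 * fpot F + 30 * unit_cost (card J) \<le> c"
  shows "wp (insertLT i (T, F)) (\<lambda>D c. stores (insert i J) D \<and> 3 * fpot (snd D) \<le> c) c"
proof -
  define I' where "I' = insert i J"
  define n where "n = card J"
  define T' where "T' = result (insert_T i T)"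
  have J: "instance_on J" using instance_on_mono[OF I] by blast
  have I': "instance_on I'" "i \<in> I'" "card I' \<le> n + 1"
    using I i by (simp_all add: I'_def n_def card_insert_if card_insert_le_m1)
  have T: "stores_T J T" using D by (simp add: stores_def)
  have T': "stores_T I' T'" using stores_T_insert[OF T I i] by (simp add: T'_def I'_def)
  have st: "state n J (parent_map J) F c 30"
    using state_parent_mapI[OF D J, of n 30 c] c by (simp add: n_def)
  have prev: "j \<in> I' \<and> fin j < fin i" if "previous I' i = Some j" for j
    using that previous_Some_iff[OF I'(1), of i j] by blast
  have lc: "j \<in> I' \<and> fin j < fin i" if "lc I' i = Some j" for j
    using that lc_Some_iff[OF I'(1,2), of j] instance_proper[OF I'(1,2)] by auto
  have "wp (insertLT i (T, F)) (\<lambda>D c. stores I' D \<and> 3 * fpot (snd D) \<le> c) c"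
    unfolding insertLT_def prod.case
    \<comment> \<open>Every rule from here on handles the next call of the program, lowers the
      number of units by a fixed amount and updates the map in \<open>state\<close>.\<close>
    apply (rule wp_tickI[OF st])
     apply simp
    apply (simp only: wp_bind)
    apply (erule wp_pay)
      apply simp
     apply (rule search_steps(7)[OF T])
     apply (simp add: n_def)
    apply (fold T'_def)
    apply (erule wp_new_node)
       apply simp
      apply (rule i)
     apply (simp add: n_def)
    apply (fold I'_def)
    apply (erule wp_search(2)[OF _ _ T' I'(3,1)])
     apply simp
    apply (erule wp_search(4)[OF _ _ T' I'(3,1,2)])
     apply simp
    apply (erule wp_link_parent[OF _ _ T' I'(3,1,2,2) _ order_refl subset_refl])
      apply simp
     apply (simp add: parent_map_def i)
    apply (erule wp_search(3)[OF _ _ T' I'(3,1)])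
     apply simp
    apply (erule wp_relink_if[OF _ _ T' I'(3,1,2) subset_refl prev])
      apply simp
     apply assumption
    apply (erule wp_search(5)[OF _ _ T' I'(3,1,2)])
     apply simp
    apply (erule wp_relink_if[OF _ _ T' I'(3,1,2) subset_refl lc])
      apply simp
     apply assumption
    \<comment> \<open>The accumulated updates are folded into the parent map of the enlarged
      set.\<close>
    apply (simp only: wp_return parent_map_insert(1)[OF I'(1) i I'_def, symmetric] snd_conv)
    apply (erule state_parent_map[OF _ T'])
    done
  then show ?thesis by (simp add: I'_def)
qed

text \<open>The new parent of \<open>j\<close> is computed from the neighbours of \<open>i\<close>,
  which is still in the search tree: \<open>j\<close> inherits \<open>parent I i\<close>. The four
  units pay for two searches, a cut and a link.\<close>

lemma wp_remove_previous:
  assumes st: "state n V f F c k" "4 \<le> k" and T: "stores_T I T" "card I \<le> n + 1" "instance_on I"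
    and i: "i \<in> I" and "I \<subseteq> V"
  shows "(\<And>F' c'. state n V (relinked I (previous I i) (rc I i) (\<lambda>_. parent I i) f) F' c' (k - 4) \<Longrightarrow> Q F' c')
    \<Longrightarrow> wp (case previous I i of None \<Rightarrow> return F | Some j \<Rightarrow> do {
      rj \<leftarrow> rc_T j T;
      if rj = rc I i then do {
        F \<leftarrow> cut j F;
        h \<leftarrow> (case rc I i of None \<Rightarrow> return None | Some r' \<Rightarrow> lc_T r' T);
        case next_in I i of
          None \<Rightarrow> return F
        | Some k \<Rightarrow> if h = Some i then link j (the (rc I i)) F else link j k F }
      else return F }) Q c"
proof (cases "previous I i")
  case None
  assume "\<And>F' c'. state n V (relinked I (previous I i) (rc I i) (\<lambda>_. parent I i) f) F' c' (k - 4) \<Longrightarrow> Q F' c'"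
  then show ?thesis using None state_weaken[OF st(1), of "k - 4"] by (simp add: relinked_def)
next
  case (Some j)
  assume Q: "\<And>F' c'. state n V (relinked I (previous I i) (rc I i) (\<lambda>_. parent I i) f) F' c' (k - 4) \<Longrightarrow> Q F' c'"
  have j: "j \<in> I" "fin j < fin i" "j \<in> V"
    using Some previous_Some_iff[OF T(3), of i j] \<open>I \<subseteq> V\<close> by auto
  have k: "0 < k" "0 < k - 1" "0 < k - 1 - 1" "0 < k - 1 - 1 - 1" "k - 1 - 1 - 1 - 1 = k - 4"
    "k - 4 \<le> k - 1 - 1 - 1" "k - 4 \<le> k - 1" "k - 1 - 1 - 1 \<le> k - 1 - 1"
    using st(2) by auto
  let ?h = "case rc I i of None \<Rightarrow> return None | Some r' \<Rightarrow> lc_T r' T"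
  let ?l = "\<lambda>h F. case next_in I i of None \<Rightarrow> return F
        | Some k \<Rightarrow> if h = Some i then link j (the (rc I i)) F else link j k F"
  have "wp (do { rj \<leftarrow> rc_T j T; if rj = rc I i then do { F \<leftarrow> cut j F; h \<leftarrow> ?h; ?l h F } else return F }) Q c"
    unfolding wp_bind
  proof (rule wp_search(4)[OF st(1) k(1) T j(1)])
    fix c1 assume st1: "state n V f F c1 (k - 1)"
    show "wp (if rc I j = rc I i then do { F \<leftarrow> cut j F; h \<leftarrow> ?h; ?l h F } else return F) Q c1"
    proof (cases "rc I j = rc I i")
      case False
      then show ?thesis
        using Q[of F c1] state_weaken[OF st1 k(7)] Some by (simp add: relinked_def)
    next
      case True
      then have Q': "state n V (f(j := parent I i)) F' c' (k - 4) \<Longrightarrow> Q F' c'" for F' c'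
        using Q Some by (simp add: relinked_def)
      note target = parent_link_target[OF T(3) i]
      have link: "wp (?l (case rc I i of None \<Rightarrow> None | Some r' \<Rightarrow> lc I r') F2) Q c2"
        if st2: "state n V (f(j := None)) F2 c2 (k - 1 - 1 - 1)" for F2 c2
      proof (cases "parent I i")
        case None
        then have "next_in I i = None" using parent_None[OF T(3) i] by blast
        then show ?thesis using Q'[of F2 c2] None state_weaken[OF st2 k(6)] by simp
      next
        case w: (Some w)
        have "(i, w) \<in> parent_edges I" using i w by (simp add: parent_edges_def)
        then have "w \<in> V" "fin j < fin w"
          using parent_edge(2,3)[OF T(3), of i w] j(2) \<open>I \<subseteq> V\<close> by auto
        then have "wp (link j w F2) Q c2"
          by (intro wp_link[OF st2 k(4) j(3)]) (use Q' w k(5) in auto)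
        \<comment> \<open>\<open>the (rc I i)\<close> is evaluated only when \<open>lc\<close>
          returned \<open>i\<close>, hence only when \<open>rc I i\<close> exists.\<close>
        moreover have "?l (case rc I i of None \<Rightarrow> None | Some r' \<Rightarrow> lc I r') F2 = link j w F2"
          using target w by (auto split: option.splits if_splits)
        ultimately show ?thesis by simp
      qed
      have "wp (do { F \<leftarrow> cut j F; h \<leftarrow> ?h; ?l h F }) Q c1"
        unfolding wp_bind
      proof (rule wp_cut[OF st1 k(2) j(3)])
        fix F2 c2 assume st2: "state n V (f(j := None)) F2 c2 (k - 1 - 1)"
        show "wp ?h (\<lambda>h. wp (?l h F2) Q) c2"
        proof (cases "rc I i")
          case None
          then show ?thesis
            using link[OF state_weaken[OF st2 k(8)]] unfolding None option.case wp_return by simp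
        next
          case (Some r)
          have "r \<in> I" using Some rc_Some_iff[OF T(3) i] by simp
          have "wp (lc_T r T) (\<lambda>h. wp (?l h F2) Q) c2"
          proof (rule wp_search(5)[OF st2 k(3) T \<open>r \<in> I\<close>])
            fix c' assume "state n V (f(j := None)) F2 c' (k - 1 - 1 - 1)"
            from link[OF this] show "wp (?l (lc I r) F2) Q c'" unfolding Some option.case .
          qed
          then show ?thesis using Some by simp
        qed
      qed
      then show ?thesis using True by simp
    qed
  qed
  then show ?thesis using Some by simp
qed

text \<open>The search tree and the forest are out of step here: after the deletion the searches
  refer to the set without \<open>i\<close>, whereas the forest still has all of \<open>I\<close> as
  vertices. The parent of \<open>j\<close> is therefore taken in the smaller set.\<close>

lemma wp_remove_lc:
  assumes st: "state n I f F c k" "6 \<le> k" and T: "stores_T I T" "card I \<le> n + 1" "instance_on I"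
    and i: "i \<in> I" and q: "rq = (case lc I i of None \<Rightarrow> None | Some j \<Rightarrow> rc I j)"
    and Q: "\<And>F' c'. state n I (relinked I (lc I i) (Some i) (parent (I - {i})) f) F' c' (k - 6) \<Longrightarrow>
      Q (result (delete_T i T), F') c'"
  shows "wp (if rq = Some i then let j = the (lc I i) in do {
        F \<leftarrow> cut j F;
        T \<leftarrow> delete_T i T;
        ko \<leftarrow> next_T j T;
        case ko of
          None \<Rightarrow> return (T, F)
        | Some k \<Rightarrow> do {
            rk \<leftarrow> rc_T k T;
            rj \<leftarrow> rc_T j T;
            F \<leftarrow> (if rk = rj then link j k F else link j (the rj) F);
            return (T, F) } }
      else do {
        T \<leftarrow> delete_T i T;
        return (T, F) }) Q c"
proof -
  define J where "J = I - {i}"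
  define T' where "T' = result (delete_T i T)"
  have J: "instance_on J" using instance_on_mono[OF T(3)] by (auto simp: J_def)
  have T': "stores_T J T'" using stores_T_delete[OF T(1) i] by (simp add: J_def T'_def)
  have cJ: "card J \<le> n + 1" using T(2) card_Diff1_le[of I i] by (simp add: J_def)
  note del = search_steps(8)[OF T(1,2)]
  have k: "0 < k" "k - 6 \<le> k - 1" using st(2) by auto
  show ?thesis
  proof (cases "rq = Some i")
    case False
    then have "relinked I (lc I i) (Some i) (parent (I - {i})) f = f"
      using q by (auto simp: relinked_def split: option.splits)
    then have "Q (T', F) c'" if "state n I f F c' (k - 1)" for c'
      using Q state_weaken[OF that k(2)] by (simp add: T'_def)
    then have "wp (delete_T i T) (\<lambda>T. Q (T, F)) c"
      by (intro wp_pay[OF st(1) k(1) del]) (simp add: T'_def)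
    then show ?thesis using False by simp
  next
    case True
    then obtain j where j: "lc I i = Some j" "rc I j = Some i"
      using q by (auto split: option.splits)
    have jI: "j \<in> I" "j \<in> J"
      using j(1) lc_Some_iff[OF T(3) i, of j] instance_proper[OF T(3) i] by (auto simp: J_def)
    have Q': "Q (T', F') c'" if "state n I (f(j := parent J j)) F' c' (k - 6)" for F' c'
      using that Q j by (simp add: relinked_def T'_def J_def)
    let ?rest = "\<lambda>F ko. case ko of
          None \<Rightarrow> return (T', F)
        | Some k \<Rightarrow> do {
            rk \<leftarrow> rc_T k T';
            rj \<leftarrow> rc_T j T';
            F \<leftarrow> (if rk = rj then link j k F else link j (the rj) F);
            return (T', F) }"
    have rest: "wp (?rest F1 (next_in J j)) Q c1"
      if st1: "state n I (f(j := None)) F1 c1 (k - 1 - 1 - 1)" for F1 c1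
    proof (cases "parent J j")
      case None
      then have "next_in J j = None" using parent_None[OF J jI(2)] by blast
      then show ?thesis using Q'[of F1 c1] None state_weaken[OF st1, of "k - 6"] by simp
    next
      case w: (Some w)
      then obtain a where a: "next_in J j = Some a" by (auto simp: parent_def split: option.splits)
      then have aJ: "a \<in> J" using next_Some_iff[OF J] by blast
      have "(j, w) \<in> parent_edges J" using jI(2) w by (simp add: parent_edges_def)
      then have w': "w \<in> I" "fin j < fin w" using parent_edge(2,3)[OF J] by (auto simp: J_def)
      have link: "wp (link j w F1) (\<lambda>F. Q (T', F)) c2"
        if "state n I (f(j := None)) F1 c2 (k - 1 - 1 - 1 - 1 - 1)" for c2
        using that
        by (rule wp_link[OF _ _ jI(1) w'(1) _ w'(2)]) (use Q' w st(2) in \<open>auto simp: numeral_eq_Suc\<close>)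
      \<comment> \<open>The test of the program is the defining one of \<open>parent\<close>. If the
        next interval is not equivalent to \<open>j\<close> and \<open>j\<close> has a parent, that
        parent is \<open>rc J j\<close>, so \<open>the\<close> is harmless.\<close>
      have tgt: "(if rc J a = rc J j then link j a F1 else link j (the (rc J j)) F1) = link j w F1"
        using w a by (auto simp: parent_def split: if_splits)
      have "wp (rc_T a T') (\<lambda>rk. wp (rc_T j T') (\<lambda>rj.
          wp (if rk = rj then link j a F1 else link j (the rj) F1) (\<lambda>F. Q (T', F)))) c1"
        apply (rule wp_search(4)[OF st1 _ T' cJ J aJ])
        using st(2) apply simp
        apply (erule wp_search(4)[OF _ _ T' cJ J jI(2)])
        using st(2) apply simp
        apply (simp only: tgt)
        apply (erule link)
        done
      then show ?thesis using a by simp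
    qed
    have "wp (do { F \<leftarrow> cut j F; T \<leftarrow> delete_T i T; ko \<leftarrow> next_T j T;
      case ko of
          None \<Rightarrow> return (T, F)
        | Some k \<Rightarrow> do {
            rk \<leftarrow> rc_T k T;
            rj \<leftarrow> rc_T j T;
            F \<leftarrow> (if rk = rj then link j k F else link j (the rj) F);
            return (T, F) } }) Q c"
      apply (simp only: wp_bind)
      apply (rule wp_cut[OF st(1) k(1) jI(1)])
      apply (erule wp_pay[OF _ _ del])
      using st(2) apply simp
      apply (fold T'_def)
      apply (erule wp_search(2)[OF _ _ T' cJ J])
      using st(2) apply simp
      apply (erule rest)
      done
    then show ?thesis using True j by (simp add: Let_def)
  qed
qed

text \<open>Eighteen of the thirty units are spent. The final \<open>free_node\<close> relies on the
  relinked map being already the parent map without \<open>i\<close>.\<close>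

lemma wp_removeLT:
  assumes D: "stores I (T, F)" and I: "instance_on I" and i: "i \<in> I"
    and c: "3 * fpot F + 30 * unit_cost (card I) \<le> c"
  shows "wp (removeLT i (T, F)) (\<lambda>D c. stores (I - {i}) D \<and> 3 * fpot (snd D) \<le> c) c"
proof -
  define n where "n = card I"
  have T: "stores_T I T" "card I \<le> n + 1" using D by (simp_all add: stores_def n_def)
  have st: "state n I (parent_map I) F c 30"
    using state_parent_mapI[OF D I, of n 30 c] c by (simp add: n_def)
  have T': "stores_T (I - {i}) (result (delete_T i T))" using stores_T_delete[OF T(1) i] .
  have Ii: "i \<notin> I - {i}" "I = insert i (I - {i})" using i by auto
  note map = parent_map_insert(2)[OF I Ii, symmetric]
  have J: "instance_on (I - {i})" using instance_on_mono[OF I] by blast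
  \<comment> \<open>The parent map of the smaller set neither starts nor ends an edge in
    \<open>i\<close>, which is the isolation that \<open>free_node\<close> requires.\<close>
  have no_i: "parent_map (I - {i}) i = None" "parent_map (I - {i}) x \<noteq> Some i" for x
    using parent_map_mono[OF J, of x i] by (auto simp: parent_map_def)
  have rq: "wp (case lc I i of None \<Rightarrow> return None | Some j \<Rightarrow> rc_T j T) Q c'"
    if "state n I f F' c' k" "0 < k"
      "\<And>c'. state n I f F' c' (k - 1) \<Longrightarrow> Q (case lc I i of None \<Rightarrow> None | Some j \<Rightarrow> rc I j) c'"
    for f F' c' k Q
  proof (cases "lc I i")
    case None
    then show ?thesis using that(3) state_weaken[OF that(1), of "k - 1"] by simp
  next
    case (Some j)
    then have "j \<in> I" using lc_Some_iff[OF I i] by blast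
    then show ?thesis using wp_search(4)[OF that(1,2) T I, of j Q] that(3) Some by simp
  qed
  show ?thesis
    unfolding removeLT_def prod.case
    apply (rule wp_tickI[OF st])
     apply simp
    apply (simp only: wp_bind)
    apply (erule wp_cut[OF _ _ i])
     apply simp
    apply (erule wp_search(2)[OF _ _ T I])
     apply simp
    apply (erule wp_search(4)[OF _ _ T I i])
     apply simp
    apply (erule wp_search(3)[OF _ _ T I])
     apply simp
    apply (erule wp_remove_previous[OF _ _ T I i subset_refl])
     apply simp
    apply (erule wp_search(5)[OF _ _ T I i])
     apply simp
    apply (erule rq)
     apply simp
    apply (erule wp_remove_lc[OF _ _ T I i refl])
     apply simp
    apply (simp only: map prod.case wp_bind)
    apply (erule wp_free_node[OF _ _ i])
       apply simp
      apply (rule no_i(1))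
     apply (rule no_i(2))
    apply (simp only: wp_return snd_conv)
    apply (erule state_parent_map[OF _ T'])
    done
qed


subsection \<open>Queries\<close>

lemma wp_expose:
  assumes st: "state n V f F c k" "0 < k" and "v \<in> V"
    and Q: "\<And>ms r G c'. state n V f (add_mset (VNode VLeaf v ms r) G) c' (k - 1) \<Longrightarrow>
      Q (add_mset (VNode VLeaf v ms r) G) c'"
  shows "wp (expose v F) Q c"
proof -
  obtain ms r G j where l: "expose v F = TM (add_mset (VNode VLeaf v ms r) G) j"
    "represents V (Map.graph f) (add_mset (VNode VLeaf v ms r) G)"
    "real j + 3 * fpot (add_mset (VNode VLeaf v ms r) G) \<le> 3 * fpot F + (18 * log 2 (card V) + 6)"
    using expose[of V "Map.graph f" F v] assms(3) st(1) unfolding state_def by blast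
  have "card V \<le> n + 1" using st(1) by (simp add: state_def)
  then have "18 * log 2 (card V) + 6 \<le> unit_cost n"
    using log_unit_cost(1)[of "card V" n] log_unit_cost(2)[of n] unfolding unit_cost_def by linarith
  then have "state n V f (add_mset (VNode VLeaf v ms r) G) (c - real j) (k - 1)"
    using l st(1) by (intro state_change[OF st]) (auto simp: state_def simp del: fpot_add)
  then show ?thesis using Q l(1) by simp
qed

lemma state_solid_eq:
  assumes st: "state n V f (add_mset t G) c k" "0 < k" and "solid_eq t' t"
    and "real j + 3 * pot t' \<le> 3 * pot t + 9 * rank t + 4"
  shows "state n V f (add_mset t' G) (c - real j) (k - 1)"
proof -
  have "represents V (Map.graph f) (add_mset t' G)"
    using represents_cong[OF _ solid_eq_imp_real_eq[OF assms(3)]] st(1) by (simp add: state_def)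
  moreover have "rank t \<le> log 2 (card V)" "card V \<le> n + 1"
    using represents_rank st(1) unfolding state_def by blast+
  then have "9 * rank t + 4 \<le> unit_cost n"
    using log_unit_cost(1)[of "card V" n] log_unit_cost(2)[of n] unfolding unit_cost_def by linarith
  then have "real j + 3 * fpot (add_mset t' G) \<le> 3 * fpot (add_mset t G) + unit_cost n"
    using assms(4) unfolding fpot_add distrib_left by linarith
  ultimately show ?thesis
    using st(1) by (intro state_change[OF st]) (auto simp: state_def simp del: fpot_add)
qed

text \<open>The continuation learns about both trees: the answer refers to the solid path of
  \<open>t\<close>, the later walk starts in the splayed \<open>t'\<close>, and
  \<open>solid_eq\<close> carries the path over.\<close>

lemma wp_on_root_path:
  assumes st: "state n V f F c k" "0 < k" and "v \<in> V"
    and Q: "\<And>t t' G c'. F = add_mset t G \<Longrightarrow> solid_eq t' t \<Longrightarrow>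
      v \<in> set (solid_path t) \<longrightarrow> (\<exists>l ms r. t' = VNode l v ms r) \<Longrightarrow>
      state n V f (add_mset t' G) c' (k - 1) \<Longrightarrow>
      Q (v \<in> set (solid_path t), add_mset t' G) c'"
  shows "wp (on_root_path v F) Q c"
proof -
  have rep: "represents V (Map.graph f) F" using st(1) by (simp add: state_def)
  obtain t t' G j where l: "F = add_mset t G"
    "on_root_path v F = TM (v \<in> set (solid_path t), add_mset t' G) j" "solid_eq t' t"
    "v \<in> set (solid_path t) \<longrightarrow> (\<exists>l ms r. t' = VNode l v ms r)"
    "real j + 3 * pot t' \<le> 3 * pot t + 9 * rank t + 2"
    using on_root_path[of v F] represents_mem[OF rep] represents_count[OF rep] assms(3) by blast
  have "state n V f (add_mset t' G) (c - real j) (k - 1)"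
    using l(1,3,5) st by (intro state_solid_eq[of n V f t G]) auto
  then show ?thesis using Q[OF l(1,3,4)] l(2) by simp
qed

lemma wp_before:
  assumes st: "state n V f (add_mset (VNode l v ms r) G) c k" "0 < k" and "l \<noteq> VLeaf"
    and Q: "\<And>t' c'. state n V f (add_mset t' G) c' (k - 1) \<Longrightarrow>
      Q (Some (last (solid_path l)), add_mset t' G) c'"
  shows "wp (before v (add_mset (VNode l v ms r) G)) Q c"
proof -
  have rep: "represents V (Map.graph f) (add_mset (VNode l v ms r) G)" using st(1) by (simp add: state_def)
  obtain t' j where l: "before v (add_mset (VNode l v ms r) G) = TM (Some (last (solid_path l)), add_mset t' G) j"
    "solid_eq t' (VNode l v ms r)"
    "real j + 3 * pot t' \<le> 3 * pot (VNode l v ms r) + 9 * rank (VNode l v ms r) + 4"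
    using before[OF refl represents_count[OF rep] assms(3)] by blast
  then show ?thesis using Q state_solid_eq[OF st l(2,3)] by simp
qed

text \<open>Only the greatest interval has no parent, so the forest consists of a single tree.\<close>

lemma represents_single:
  assumes I: "instance_on I" and rep: "represents I (parent_edges I) (add_mset t G)"
  shows "G = {#}"
proof (rule ccontr)
  assume "G \<noteq> {#}"
  then obtain s where s: "s \<in># G" by blast
  have root: "last (solid_path u) \<in> I" "next_in I (last (solid_path u)) = None"
    if "u \<in># add_mset t G" for u
  proof -
    show "last (solid_path u) \<in> I" using represents_root(1)[OF rep that] .
    then have "parent I (last (solid_path u)) = None"
      using represents_root(2)[OF rep that] by (cases "parent I (last (solid_path u))") (auto simp: parent_edges_def)
    then show "next_in I (last (solid_path u)) = None"
      using parent_None[OF I \<open>last (solid_path u) \<in> I\<close>] by blast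
  qed
  have "fin (last (solid_path s)) = fin (last (solid_path t))"
    using root[of s] root[of t] s by (auto simp: next_None_iff intro: order_antisym)
  then have eq: "last (solid_path s) = last (solid_path t)"
    using instance_fin_eq[OF I root(1) root(1)] s by simp
  have "s \<noteq> VLeaf" "t \<noteq> VLeaf" using rep s by (auto simp: represents_def wf_forest_def)
  then have "last (solid_path t) \<in># vertices t" "last (solid_path t) \<in># forest_vertices G"
    using last_solid_path[of t] last_solid_path[of s] eq s in_forest_vertices by metis+
  then have "1 \<le> count (vertices t) (last (solid_path t))" "1 \<le> count (forest_vertices G) (last (solid_path t))"
    by (metis One_nat_def Suc_leI count_greater_zero_iff)+
  moreover have "count (vertices t) (last (solid_path t)) + count (forest_vertices G) (last (solid_path t)) \<le> 1"
    using represents_count[OF rep] by (metis count_union forest_vertices_add)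
  ultimately show False by linarith
qed

text \<open>Once the minimum heads the solid path, this path is the real path from the minimum to
  the root. It contains every node reachable from the minimum, in particular every greedy
  interval.\<close>

lemma solid_path_greedy:
  assumes I: "instance_on I" and rep: "represents I (parent_edges I) {#t#}"
    and m: "least (\<lambda>j. j \<in> I) = Some m" and hd: "hd (solid_path t) = m" and mt: "t \<noteq> VLeaf"
  shows "i \<in> greedy I \<Longrightarrow> i \<in> set (solid_path t)"
    and "solid_path t = xs @ j # i # ys \<Longrightarrow> i \<in> greedy I \<longleftrightarrow> compatible i j"
proof -
  have t: "wf_vtree t" "edges t = parent_edges I" "\<And>x. count (vertices t) x \<le> 1"
    using rep represents_count[OF rep]
    unfolding represents_def forest_edges_def forest_vertices_def by simp_all
  note succ = successively_solid_path[of t, unfolded t(2)]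
  show "i \<in> set (solid_path t)" if "i \<in> greedy I"
    using reach_set_solid_path[OF t(1,3), of m i] greedy_reach[OF I m that] hd mt
      single_valued_parent_edges[of I] t(2) by (metis list.set_sel(1) solid_path_eq_Nil)
  show "i \<in> greedy I \<longleftrightarrow> compatible i j" if p: "solid_path t = xs @ j # i # ys"
  proof (rule greedy_iff_compatible[OF I m])
    show "(m, j) \<in> (parent_edges I)\<^sup>*"
      using successively_reach[OF succ, of j] p hd by simp
    show "(j, i) \<in> parent_edges I"
      using succ unfolding p by (simp add: successively_append_iff successively_Cons)
  qed
qed

lemma wp_queryLT:
  assumes D: "stores I (T, F)" and I: "instance_on I"
    and c: "3 * fpot F + 30 * unit_cost (card I) \<le> c"
  shows "wp (queryLT i (T, F)) (\<lambda>(b, D) c. b = (i \<in> greedy I) \<and> stores I D \<and> 3 * fpot (snd D) \<le> c) c"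
    (is "wp _ ?Q c")
proof -
  define n where "n = card I"
  have T: "stores_T I T" "card I \<le> n + 1" using D by (simp_all add: stores_def n_def)
  have st: "state n I (parent_map I) F c 30"
    using state_parent_mapI[OF D I, of n 30 c] c by (simp add: n_def)
  have answer: "?Q (b, (T, F')) c'" if "state n I (parent_map I) F' c' k" "b = (i \<in> greedy I)" for b F' c' k
    using state_parent_map[OF that(1) T(1)] that(2) by simp
  have member: "result (member_T i T) = (i \<in> I)" using member_T T(1) by (simp add: stores_T_def)
  have "wp (case least (\<lambda>j. j \<in> I) of
      None \<Rightarrow> return (False, (T, F))
    | Some m \<Rightarrow>
        if i = m then return (True, (T, F))
        else do {
          F \<leftarrow> expose m F;
          isin \<leftarrow> member_T i T;
          if \<not> isin then return (False, (T, F))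
          else do {
            (on_path, F) \<leftarrow> on_root_path i F;
            if \<not> on_path then return (False, (T, F))
            else do {
              (jo, F) \<leftarrow> before i F;
              return (case jo of None \<Rightarrow> False | Some j \<Rightarrow> compatible i j, (T, F)) } } }) ?Q c'"
    if st1: "state n I (parent_map I) F c' 28" for c'
  proof (cases "least (\<lambda>j. j \<in> I)")
    case None
    then have "i \<notin> greedy I" using greedy_subset[OF I, of i] by (auto simp: least_None_iff)
    then show ?thesis using None answer[OF st1] by simp
  next
    case m: (Some m)
    then have mI: "m \<in> I" using least_Some_iff[OF I, of "\<lambda>j. j \<in> I" m] by blast
    show ?thesis
    proof (cases "i = m")
      case True
      then have "i \<in> greedy I" using greedy.first[OF m] by simp
      then show ?thesis using m True answer[OF st1] by simp
    next
      case False
      \<comment> \<open>26 units are left after the initial step, the search for the minimum, the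
        exposure and the membership test.\<close>
      have path: "wp (do { (on_path, F) \<leftarrow> on_root_path i F1;
            if \<not> on_path then return (False, (T, F))
            else do {
              (jo, F) \<leftarrow> before i F;
              return (case jo of None \<Rightarrow> False | Some j \<Rightarrow> compatible i j, (T, F)) } }) ?Q c2"
        if st2: "state n I (parent_map I) F1 c2 26" and F1: "F1 = add_mset (VNode VLeaf m ms r) G"
          and iI: "i \<in> I"
        for F1 c2 ms r G
        unfolding wp_bind
      proof (rule wp_on_root_path[OF st2 _ iI])
        fix t t' G' c3
        assume F1': "F1 = add_mset t G'" and eq: "solid_eq t' t"
          and root: "i \<in> set (solid_path t) \<longrightarrow> (\<exists>l ms r. t' = VNode l i ms r)"
          and st3: "state n I (parent_map I) (add_mset t' G') c3 (26 - 1)"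
        have rep: "represents I (parent_edges I) F1"
          using st2 by (simp add: state_def graph_parent_map)
        \<comment> \<open>With a single tree in the forest, the tree in which \<open>i\<close> is
          found is the one exposed at \<open>m\<close>.\<close>
        then have "G = {#}" "G' = {#}"
          using represents_single[OF I] F1 F1' by blast+
        then have t: "t = VNode VLeaf m ms r" using F1 F1' by simp
        have rep': "represents I (parent_edges I) {#t#}" using rep F1' \<open>G' = {#}\<close> by simp
        have hd: "hd (solid_path t) = m" "t \<noteq> VLeaf" using t by simp_all
        note greedy = solid_path_greedy[OF I rep' m hd]
        show "wp (case (i \<in> set (solid_path t), add_mset t' G') of (on_path, F) \<Rightarrow>
            if \<not> on_path then return (False, (T, F))
            else do {
              (jo, F) \<leftarrow> before i F;
              return (case jo of None \<Rightarrow> False | Some j \<Rightarrow> compatible i j, (T, F)) }) ?Q c3"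
        proof (cases "i \<in> set (solid_path t)")
          case notin: False
          then have "i \<notin> greedy I" using greedy(1) by blast
          then show ?thesis using answer[OF st3] notin by simp
        next
          case True
          then obtain l ms' r' where t': "t' = VNode l i ms' r'" using root by blast
          have p: "solid_path t = solid_path l @ i # solid_path r'" using eq t' by (simp add: solid_eq_def)
          \<comment> \<open>The path starts with \<open>m\<close>, which differs from
            \<open>i\<close>, so \<open>i\<close> has a predecessor.\<close>
          have l: "l \<noteq> VLeaf" using p hd(1) False by auto
          then have "solid_path t = butlast (solid_path l) @ last (solid_path l) # i # solid_path r'"
            using p by simp
          then have ans: "compatible i (last (solid_path l)) = (i \<in> greedy I)" using greedy(2) by blast
          have "wp (before i (add_mset t' G')) (\<lambda>x. wp (case x of (jo, F) \<Rightarrow>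
              return (case jo of None \<Rightarrow> False | Some j \<Rightarrow> compatible i j, (T, F))) ?Q) c3"
            using st3 unfolding t'
            by (rule wp_before[OF _ _ l]) (use answer ans in \<open>auto simp del: fpot_add\<close>)
          then show ?thesis using True by simp
        qed
      qed simp
      have "wp (do {
          F \<leftarrow> expose m F;
          isin \<leftarrow> member_T i T;
          if \<not> isin then return (False, (T, F))
          else do {
            (on_path, F) \<leftarrow> on_root_path i F;
            if \<not> on_path then return (False, (T, F))
            else do {
              (jo, F) \<leftarrow> before i F;
              return (case jo of None \<Rightarrow> False | Some j \<Rightarrow> compatible i j, (T, F)) } } }) ?Q c'"
        unfolding wp_bind[of "expose m F"] wp_bind[of "member_T i T"]
      proof (rule wp_expose[OF st1 _ mI])
        fix ms r G c2
        let ?F1 = "add_mset (VNode VLeaf m ms r) G"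
        assume st2: "state n I (parent_map I) ?F1 c2 (28 - 1)"
        show "wp (member_T i T) (\<lambda>isin. wp (if \<not> isin then return (False, (T, ?F1))
          else do {
            (on_path, F) \<leftarrow> on_root_path i ?F1;
            if \<not> on_path then return (False, (T, F))
            else do {
              (jo, F) \<leftarrow> before i F;
              return (case jo of None \<Rightarrow> False | Some j \<Rightarrow> compatible i j, (T, F)) } }) ?Q) c2"
        proof (rule wp_pay[OF st2 _ search_steps(6)[OF T]], goal_cases)
          case (2 c3)
          show ?case
          proof (cases "i \<in> I")
            case notin: False
            then have "i \<notin> greedy I" using greedy_subset[OF I] by blast
            then show ?thesis using answer[OF 2] member notin by simp
          next
            case True
            have "state n I (parent_map I) ?F1 c3 26" using 2 by simp
            from path[OF this refl True] show ?thesis using member True by simp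
          qed
        qed simp
      qed simp
      then show ?thesis using m False by simp
    qed
  qed
  note main = this
  show ?thesis
    unfolding queryLT_def prod.case
    apply (rule wp_tickI[OF st])
     apply simp
    apply (subst wp_bind)
    apply (erule wp_search(1)[OF _ _ T I])
     apply simp
    apply (rule main)
    apply simp
    done
qed


section \<open>Sequences of operations\<close>

text \<open>Each operation pays its steps and the rise of the potential from 30 units at its current
  size; over the sequence the potentials cancel except for the first and the last.\<close>

lemma run_LT_correct:
  assumes "admissible ops I" "stores I D" "finite I"
    and "run_LT ops D = TM (answers, D') time"
  shows "answers = correct_answers ops I \<and> stores (fold apply_op ops I) D' \<and>
    real time + 3 * fpot (snd D') \<le> 3 * fpot (snd D) + (\<Sum>n\<leftarrow>sizes ops I. 30 * unit_cost n)"
  using assms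
proof (induction ops arbitrary: I D answers time)
  case Nil
  then show ?case by (auto simp: return_def)
next
  case (Cons p ops)
  obtain T F where D: "D = (T, F)" by fastforce
  have I: "instance_on I" using Cons.prems(1,3) by (simp add: instance_on_def)
  have adm: "admissible ops (apply_op p I)" "admissible_op p I" using Cons.prems(1) by auto
  have fin: "finite (apply_op p I)" using Cons.prems(3) by (cases p) auto
  \<comment> \<open>Admissibility of the remaining sequence includes that the set after the
    operation is a valid instance, which insertion needs for its enlarged set.\<close>
  have inst: "instance_on (apply_op p I)"
    using adm(1) fin by (cases ops) (auto simp: instance_on_def)
  note pay = order_refl[of "3 * fpot F + 30 * unit_cost (card I)"]
  show ?case
  proof (cases p)
    case (Insert i)
    define m where "m = insertLT i D"
    have m: "stores (insert i I) (result m)"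
      "real (steps m) + 3 * fpot (snd (result m)) \<le> 3 * fpot F + 30 * unit_cost (card I)"
      using wp_insertLT[OF Cons.prems(2)[unfolded D] _ _ pay, of i] inst adm(2) Insert
      by (auto simp: wp_def m_def D)
    obtain t' where t': "run_LT ops (result m) = TM (answers, D') t'" "time = steps m + t'"
      using Cons.prems(4) Insert by (cases "run_LT ops (result m)") (auto simp: bind_tm_def m_def)
    show ?thesis
      using Cons.IH[OF adm(1) _ fin t'(1)] m t'(2) Insert D by simp
  next
    case (Remove i)
    define m where "m = removeLT i D"
    have m: "stores (I - {i}) (result m)"
      "real (steps m) + 3 * fpot (snd (result m)) \<le> 3 * fpot F + 30 * unit_cost (card I)"
      using wp_removeLT[OF Cons.prems(2)[unfolded D] I _ pay, of i] adm(2) Remove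
      by (auto simp: wp_def m_def D)
    obtain t' where t': "run_LT ops (result m) = TM (answers, D') t'" "time = steps m + t'"
      using Cons.prems(4) Remove by (cases "run_LT ops (result m)") (auto simp: bind_tm_def m_def)
    show ?thesis
      using Cons.IH[OF adm(1) _ fin t'(1)] m t'(2) Remove D by simp
  next
    case (Query i)
    obtain b E k where m: "queryLT i D = TM (b, E) k" by (metis surj_pair tm.exhaust)
    have E: "b = (i \<in> greedy I)" "stores I E"
      "real k + 3 * fpot (snd E) \<le> 3 * fpot F + 30 * unit_cost (card I)"
      using wp_queryLT[OF Cons.prems(2)[unfolded D] I pay, of i] m by (auto simp: wp_def D)
    obtain bs D2 t' where r: "run_LT ops E = TM (bs, D2) t'" by (metis surj_pair tm.exhaust)
    have t': "answers = b # bs" "D2 = D'" "time = k + t'"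
      using Cons.prems(4) Query m r by (auto simp: bind_tm_def return_def)
    show ?thesis
      using Cons.IH[of I E bs t'] adm(1) E Cons.prems(3) r t' Query D by simp
  qed
qed

lemma admissible_fold: "admissible ops I \<Longrightarrow> instance_set (fold apply_op ops I)"
  by (induction ops arbitrary: I) auto

text \<open>\<open>A\<close> is chosen before the sequence, so the constant hidden in the bound is
  uniform. Charging each operation at the size when it is invoked gives the amortised bound.\<close>

theorem theorem3:
  "\<exists>A :: nat \<Rightarrow> real. A \<in> O(\<lambda>n. ln (real n)) \<and>
     (\<forall>ops answers D time.
        admissible ops {} \<longrightarrow> run_LT ops empty_LT = TM (answers, D) time \<longrightarrow>
          answers = correct_answers ops {} \<and>
          stores_LT (fold apply_op ops {}) D \<and>
          real time \<le> (\<Sum>n\<leftarrow>sizes ops {}. A n))"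
proof (intro exI[of _ "\<lambda>n. 30 * unit_cost n"] conjI allI impI)
  \<comment> \<open>Only large \<open>n\<close> matter for the Landau symbol, so the positive cost
    at sizes where \<open>ln\<close> vanishes does no harm.\<close>
  show "(\<lambda>n. 30 * unit_cost n) \<in> O(\<lambda>n. ln (real n))"
    unfolding unit_cost_def log_def by real_asymp
next
  fix ops answers D time
  assume adm: "admissible ops {}" and run: "run_LT ops empty_LT = TM (answers, D) time"
  let ?I = "fold apply_op ops {}"
  have "stores {} empty_LT"
    by (simp add: stores_def stores_T_def empty_LT_def represents_def wf_forest_def
        forest_vertices_def forest_edges_def parent_edges_def)
  note correct = run_LT_correct[OF adm this finite.emptyI run]
  show "answers = correct_answers ops {}" using correct by blast
  have inst: "instance_set ?I"
    using admissible_fold[OF adm] .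
  obtain T F where D: "D = (T, F)" by fastforce
  have rep: "stores_T ?I T" "represents ?I (parent_edges ?I) F"
    using correct D by (simp_all add: stores_def)
  then have "instance_on ?I" using inst by (simp add: instance_on_def represents_def)
  then show "stores_LT ?I D"
    using rep E_sim_un_E_c by (simp add: stores_LT_def D stores_T_def represents_def)
  \<comment> \<open>The initial potential is zero and the final one nonnegative, so the amortised
    bound dominates the actual time.\<close>
  have "fpot (snd (empty_LT :: linearised_tree)) = 0" by (simp add: empty_LT_def fpot_def)
  then show "real time \<le> (\<Sum>n\<leftarrow>sizes ops {}. 30 * unit_cost n)"
    using correct fpot_nonneg[of "snd D"] by linarith
qed

end
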